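(* Let $I_{\mathcal B}\subseteq R=\mathbf C[a_0,\dots,a_5]$ be the defining (homogeneous radical) ideal of $\mathcal B$, the singular locus of the hypersurface $\mathcal H\subseteq\mathbb P^5$ of binary quintics in involution. Then $I_{\mathcal B}$ is a complete intersection, generated by the two coefficients of the covariant $\vartheta_{51}=(\vartheta_{22}^2,\mathbb F)_4$ (a linear form in $x_1,x_2$ whose coefficients have degree $5$ in $a_0,\dots,a_5$), where $\vartheta_{22}=(\mathbb F,\mathbb F)_4$.
   Context: The base field is $\mathbf C$. $S_m$ is the space of binary forms of order (homogeneous degree) $m$ in $x_1,x_2$. For forms $A,B$ of orders $m,n$ the $r$-th transvectant is $$(A,B)_r=\frac{(m-r)!\,(n-r)!}{m!\,n!}\sum_{i=0}^r(-1)^i\binom ri\frac{\partial^rA}{\partial x_1^{r-i}\partial x_2^i}\,\frac{\partial^rB}{\partial x_1^i\partial x_2^{r-i}},$$ a form of order $m+n-2r$; it is $0$ if $r>\min(m,n)$. $\mathbb F=\sum_{i=0}^5\binom5i a_i x_1^{5-i}x_2^i$ is the generic binary quintic, $R=\mathbf C[a_0,\dots,a_5]$, $\mathbb P^5=\mathbb P S_5=\mathrm{Proj}\,R$. $\mathcal H$ is defined as follows. Let $C=\{[l^2]:l\in S_1\setminus\{0\}\}\subseteq\mathbb P S_2=\mathbb P^2$, a smooth conic; $\mathbb P^5=\mathbb PS_5$ is identified with effective degree $5$ divisors on $C$, $[l_1\cdots l_5]$ corresponding to $\sum[l_i^2]$. $\mathcal H$ is the closure of the set of divisors $\mathsf a_1+\mathsf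 b_1+\mathsf a_2+\mathsf b_2+\mathsf c$ such that, for some $\mathsf z\in\mathbb P^2\setminus C$ and lines $L_1,L_2$ through $\mathsf z$, $L_i\cap C=\{\mathsf a_i,\mathsf b_i\}$ and the line $\overline{\mathsf c\,\mathsf z}$ is tangent to $C$ at $\mathsf c\in C$. It is an irreducible hypersurface. Explicitly, $\mathcal B$ is the union of the $SL_2(\mathbf C)$-orbits in $\mathbb P^5$ of $x_1^5+x_2^5$, $x_1x_2(x_1-x_2)(x_1^2+x_1x_2+x_2^2)$, $x_1^3x_2(x_1+x_2)$, $x_1^3x_2^2$, $x_1^4x_2$ and $x_1^5$; it is a closed set. *)

theory Defs
  imports "HOL-Analysis.Analysis" "HOL-Library.Poly_Mapping"
begin

section \<open>Polynomials in finitely many variables\<close>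

text \<open>
  The index type \<open>'v\<close> is the set of variables.  The variables \<open>x\<^sub>1, x\<^sub>2\<close> of binary forms are
  indexed by \<open>1, 2 :: 2\<close>, as the components of a vector of type \<open>real^2\<close>; the coefficients
  \<open>a\<^sub>0, \<dots>, a\<^sub>5\<close> of a quintic are indexed by \<open>0, \<dots>, 5 :: 6\<close>.
\<close>

type_synonym ('v, 'a) mpoly = "('v \<Rightarrow>\<^sub>0 nat) \<Rightarrow>\<^sub>0 'a"

definition Const :: "'a::comm_ring_1 \<Rightarrow> ('v::finite, 'a) mpoly" where
  "Const c = Poly_Mapping.single 0 c"

definition Var :: "'v::finite \<Rightarrow> ('v, 'a::comm_ring_1) mpoly" where
  "Var i = Poly_Mapping.single (Poly_Mapping.single i 1) 1"

definition eval :: "('v::finite \<Rightarrow> 'a::comm_ring_1) \<Rightarrow> ('v, 'a) mpoly \<Rightarrow> 'a" where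
  "eval v p = (\<Sum>t\<in>Poly_Mapping.keys p.
      Poly_Mapping.lookup p t * (\<Prod>i\<in>UNIV. v i ^ Poly_Mapping.lookup t i))"

definition subst :: "('v::finite \<Rightarrow> ('w::finite, 'a) mpoly) \<Rightarrow> ('v, 'a::comm_ring_1) mpoly \<Rightarrow> ('w, 'a) mpoly" where
  "subst h p = (\<Sum>t\<in>Poly_Mapping.keys p.
      Const (Poly_Mapping.lookup p t) * (\<Prod>i\<in>UNIV. h i ^ Poly_Mapping.lookup t i))"

text \<open>The truncated subtraction is harmless: if \<open>i\<close> does not occur in \<open>t\<close>, the coefficient is \<open>0\<close>.\<close>

definition partial :: "'v::finite \<Rightarrow> ('v, 'a::comm_ring_1) mpoly \<Rightarrow> ('v, 'a) mpoly" where
  "partial i p = (\<Sum>t\<in>Poly_Mapping.keys p.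
      Poly_Mapping.single (t - Poly_Mapping.single i 1)
        (of_nat (Poly_Mapping.lookup t i) * Poly_Mapping.lookup p t))"

definition homogeneous :: "nat \<Rightarrow> ('v::finite, 'a::comm_ring_1) mpoly \<Rightarrow> bool" where
  "homogeneous d p \<longleftrightarrow> (\<forall>t\<in>Poly_Mapping.keys p. (\<Sum>i\<in>UNIV. Poly_Mapping.lookup t i) = d)"


section \<open>Ideals and regular sequences\<close>

text \<open>A commutative ring is a module over itself; its submodules are its ideals.\<close>

lemma module_mult: "module ((*) :: 'a::comm_ring_1 \<Rightarrow> 'a \<Rightarrow> 'a)"
  by unfold_locales (simp_all add: algebra_simps)

definition ideal_generated :: "'a::comm_ring_1 set \<Rightarrow> 'a set" where
  "ideal_generated G = module.span (*) G"

text \<open>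
  An ideal of a polynomial ring over a field is a complete intersection if it is generated
  by a regular sequence; the length of the sequence is then the height of the ideal.
\<close>

definition regular_sequence :: "'a::comm_ring_1 list \<Rightarrow> bool" where
  "regular_sequence rs \<longleftrightarrow>
     (\<forall>k<length rs. \<forall>u. u * rs ! k \<in> ideal_generated (set (take k rs)) \<longrightarrow>
                        u \<in> ideal_generated (set (take k rs))) \<and>
     ideal_generated (set rs) \<noteq> UNIV"


section \<open>Subsets of projective space\<close>

text \<open>
  A point of \<open>\<P>\<^sup>5 = Proj R\<close> is represented by its nonzero coordinate vectors, a subset of \<open>\<P>\<^sup>5\<close>
  by the set of all nonzero coordinate vectors of its points.
\<close>

type_synonym R = "(6, complex) mpoly"

definition vanishing_ideal :: "(complex^6) set \<Rightarrow> R set" where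
  "vanishing_ideal X = ideal_generated {f. (\<exists>d. homogeneous d f) \<and> (\<forall>v\<in>X. eval (($) v) f = 0)}"

definition zariski_closure :: "(complex^6) set \<Rightarrow> (complex^6) set" where
  "zariski_closure X = {v. v \<noteq> 0 \<and> (\<forall>f\<in>vanishing_ideal X. eval (($) v) f = 0)}"

text \<open>
  Jacobian criterion for a hypersurface: a point is singular iff the Jacobian matrix of
  generators of the ideal has rank less than \<open>1\<close> there.
\<close>

definition hypersurface_singular_locus :: "(complex^6) set \<Rightarrow> (complex^6) set" where
  "hypersurface_singular_locus X =
     {v\<in>X. \<forall>f\<in>vanishing_ideal X. \<forall>i. eval (($) v) (partial i f) = 0}"


section \<open>Binary forms\<close>

type_synonym 'a binary_poly = "(2, 'a) mpoly"

definition S :: "nat \<Rightarrow> complex binary_poly set" where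
  "S m = {A. homogeneous m A}"

definition quintic :: "(6 \<Rightarrow> 'a::comm_ring_1) \<Rightarrow> 'a binary_poly" where
  "quintic a = (\<Sum>i\<le>5. of_nat (5 choose i) * Const (a (of_nat i)) * Var 1 ^ (5 - i) * Var 2 ^ i)"

definition proportional :: "complex binary_poly \<Rightarrow> complex binary_poly \<Rightarrow> bool" where
  "proportional A B \<longleftrightarrow> (\<exists>k. k \<noteq> 0 \<and> A = Const k * B)"


subsection \<open>Transvectants\<close>

text \<open>The \<open>r\<close>-th transvectant of forms \<open>A\<close>, \<open>B\<close> of orders \<open>m\<close>, \<open>n\<close> whose coefficients lie in \<open>R\<close>.\<close>

definition transvectant :: "nat \<Rightarrow> nat \<Rightarrow> nat \<Rightarrow> R binary_poly \<Rightarrow> R binary_poly \<Rightarrow> R binary_poly" where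
  "transvectant m n r A B =
     (if r \<le> min m n then
        Const (Const (fact (m - r) * fact (n - r) / (fact m * fact n))) *
        (\<Sum>i\<le>r. (-1) ^ i * of_nat (r choose i) *
           (partial 1 ^^ (r - i)) ((partial 2 ^^ i) A) *
           (partial 1 ^^ i) ((partial 2 ^^ (r - i)) B))
      else 0)"

definition generic_quintic :: "R binary_poly" where
  "generic_quintic = quintic Var"

definition theta22 :: "R binary_poly" where
  "theta22 = transvectant 5 5 4 generic_quintic generic_quintic"

definition theta51 :: "R binary_poly" where
  "theta51 = transvectant 4 5 4 (theta22\<^sup>2) generic_quintic"

definition theta51_coeff :: "2 \<Rightarrow> R" where
  "theta51_coeff j = Poly_Mapping.lookup theta51 (Poly_Mapping.single j 1)"


subsection \<open>Quintics in involution\<close>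

text \<open>
  Points of the plane \<open>\<P>S\<^sub>2\<close> are represented by nonzero quadratic forms, points of the conic \<open>C\<close>
  by squares of nonzero linear forms.
\<close>

definition line :: "complex binary_poly set \<Rightarrow> bool" where
  "line L \<longleftrightarrow> (\<exists>A\<in>S 2. \<exists>B\<in>S 2.
     (\<forall>s t. Const s * A + Const t * B = 0 \<longrightarrow> s = 0 \<and> t = 0) \<and>
     L = {Const s * A + Const t * B | s t. True})"

definition on_conic :: "complex binary_poly \<Rightarrow> bool" where
  "on_conic A \<longleftrightarrow> (\<exists>l\<in>S 1 - {0}. proportional A (l\<^sup>2))"

text \<open>The line \<open>L\<close> meets \<open>C\<close> exactly in the points \<open>[a\<^sup>2]\<close> and \<open>[b\<^sup>2]\<close> (which coincide if \<open>L\<close> is tangent).\<close>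

definition meets_conic_in :: "complex binary_poly set \<Rightarrow> complex binary_poly \<Rightarrow> complex binary_poly \<Rightarrow> bool" where
  "meets_conic_in L a b \<longleftrightarrow>
     {A\<in>L - {0}. on_conic A} = {A. proportional A (a\<^sup>2) \<or> proportional A (b\<^sup>2)}"

text \<open>The tangent line at \<open>[c\<^sup>2]\<close>: the derivative of \<open>t \<mapsto> (c + t m)\<^sup>2\<close> at \<open>t = 0\<close> is \<open>2 c m\<close>.\<close>

definition conic_tangent :: "complex binary_poly \<Rightarrow> complex binary_poly set" where
  "conic_tangent c = {c * m | m. m \<in> S 1}"

text \<open>
  As \<open>z\<close> is not on the conic, the line joining it to \<open>[c\<^sup>2]\<close> is tangent to \<open>C\<close> at \<open>[c\<^sup>2]\<close> iff \<open>z\<close> lies on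
  the tangent there.  The divisor \<open>[a\<^sub>1\<^sup>2] + [b\<^sub>1\<^sup>2] + [a\<^sub>2\<^sup>2] + [b\<^sub>2\<^sup>2] + [c\<^sup>2]\<close> is the quintic
  \<open>[a\<^sub>1 b\<^sub>1 a\<^sub>2 b\<^sub>2 c]\<close>; scalar factors are absorbed by \<open>c\<close>.
\<close>

definition involution_divisors :: "(complex^6) set" where
  "involution_divisors = {v. \<exists>a1\<in>S 1 - {0}. \<exists>b1\<in>S 1 - {0}. \<exists>a2\<in>S 1 - {0}. \<exists>b2\<in>S 1 - {0}. \<exists>c\<in>S 1 - {0}.
     quintic (($) v) = a1 * b1 * a2 * b2 * c \<and>
     (\<exists>z\<in>S 2 - {0}. \<not> on_conic z \<and>
        (\<exists>L1 L2. line L1 \<and> line L2 \<and> z \<in> L1 \<and> z \<in> L2 \<and>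
           meets_conic_in L1 a1 b1 \<and> meets_conic_in L2 a2 b2) \<and>
        z \<in> conic_tangent c)}"

definition calH :: "(complex^6) set" where
  "calH = zariski_closure involution_divisors"


subsection \<open>The orbits\<close>

definition SL2_act :: "complex^2^2 \<Rightarrow> complex binary_poly \<Rightarrow> complex binary_poly" where
  "SL2_act g A = subst (\<lambda>i. Const (g $ i $ 1) * Var 1 + Const (g $ i $ 2) * Var 2) A"

definition SL2_orbit :: "complex binary_poly \<Rightarrow> (complex^6) set" where
  "SL2_orbit A = {v. v \<noteq> 0 \<and> (\<exists>g. det g = 1 \<and> proportional (quintic (($) v)) (SL2_act g A))}"

definition calB :: "(complex^6) set" where
  "calB = (let x1 = Var 1; x2 = Var 2 in
       SL2_orbit (x1 ^ 5 + x2 ^ 5)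
     \<union> SL2_orbit (x1 * x2 * (x1 - x2) * (x1\<^sup>2 + x1 * x2 + x2\<^sup>2))
     \<union> SL2_orbit (x1 ^ 3 * x2 * (x1 + x2))
     \<union> SL2_orbit (x1 ^ 3 * x2\<^sup>2)
     \<union> SL2_orbit (x1 ^ 4 * x2)
     \<union> SL2_orbit (x1 ^ 5))"

end

theory Submission
  imports Defs "HOL-Computational_Algebra.Fundamental_Theorem_Algebra"
begin

text \<open>
  Write \<open>F\<close> for a quintic with coefficients \<open>a\<close>, let \<open>i = A x\<^sup>2 + B x y + C y\<^sup>2\<close> be half of
  \<open>(F, F)\<^sub>4\<close>, and let \<open>L = \<theta>\<^sub>0 x + \<theta>\<^sub>1 y\<close> be a quarter of the linear covariant \<open>((F, F)\<^sub>4\<^sup>2, F)\<^sub>4\<close>.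
  The proof compares three descriptions of the locus \<open>L = 0\<close>: as a union of orbits, as a scheme,
  and as the singular locus of the hypersurface.

  As for the zero set, \<open>L\<close> is covariant, so \<open>i\<close> may be brought to one of the normal forms \<open>x y\<close>,
  \<open>x\<^sup>2\<close>, \<open>0\<close>.  In the first two cases \<open>L = 0\<close> says that two of the six coefficients vanish, and in
  all cases the equations that express the normal form of \<open>i\<close> can then be solved.  The solutions
  are the six orbits (\<open>th_zero_iff\<close>).

  Regularity of homogeneous elements may be tested after restriction to a linear
  section (\<open>nonzerodivisor_lift\<close>).  On a suitable plane of quintics \<open>\<theta>\<^sub>0\<close> and \<open>\<theta>\<^sub>1\<close> become forms in
  two variables without common factor, so they form a regular sequence; on a three-dimensional
  space containing that plane \<open>A\<close> becomes the square of a linear form, so \<open>A\<close> is a nonzerodivisor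
  modulo \<open>(\<theta>\<^sub>0, \<theta>\<^sub>1)\<close> (\<open>th_regular\<close>).

  As \<open>A\<close> is a nonzerodivisor, it may be inverted, and completing the square turns \<open>i\<close>
  into a multiple of \<open>x\<^sup>2 + \<Delta> y\<^sup>2\<close>.  For such an \<open>i\<close> the equations \<open>L = 0\<close> express the last two
  coefficients of \<open>F\<close> by the others and by \<open>\<Delta>\<close>.  There remain two equations \<open>E1\<close>, \<open>E2\<close>, which say
  that \<open>i\<close> is what it was assumed to be.  The first is linear in the fourth coefficient, and
  eliminating that coefficient turns the second into a product of distinct irreducible factors times
  a factor that divides \<open>A\<close> up to nonzerodivisors (\<open>elimination_identities\<close>).  Hence every form
  that vanishes on the orbits lies in \<open>(\<theta>\<^sub>0, \<theta>\<^sub>1)\<close> (\<open>radical\<close>).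

  Five points of the conic are in involution exactly if, up to a degenerate
  limit, the quintic is invariant up to sign under an involution of the projective line that fixes
  one of its roots: it has the form \<open>l (\<alpha> l\<^sup>4 + \<beta> l\<^sup>2 m\<^sup>2 + \<gamma> m\<^sup>4)\<close> with independent linear forms
  \<open>l\<close>, \<open>m\<close>.  The closure of these even quintics is the hypersurface (\<open>vanishing_ideal_calH\<close>).

  The orbits are singular for the following reason.  A polynomial that vanishes on the even
  quintics is killed by the tangent vectors of all families of even quintics through a point.
  Through \<open>x\<^sup>5 + y\<^sup>5\<close> pass five branches, one for each involution exchanging \<open>x\<close> with the product of
  \<open>y\<close> and a fifth root of unity, and through \<open>x y (x\<^sup>3 - y\<^sup>3)\<close> three; their tangent vectors span
  everything.  Through a quintic with a triple root passes one branch whose tangent vectors fill a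
  hyperplane, and a further curve of even quintics provides the missing direction
  (\<open>triple_root_last\<close>).

  All other points are smooth.  Where \<open>L\<close> is nonzero, the root of \<open>L\<close> and the root of the Jacobian
  of \<open>i\<close> and \<open>L\<close> recover the two fixed points of the involution.  Expressing \<open>F\<close> in the frame given
  by these roots yields three covariantly defined polynomials that vanish on every even quintic
  (\<open>adapted_vanishes\<close>).  At an even quintic with \<open>L \<noteq> 0\<close> one of them has a nonzero derivative, and a
  point of the hypersurface with \<open>L \<noteq> 0\<close> at which they vanish is an even quintic
  (\<open>normalised_cone_point\<close>).
\<close>

section \<open>Polynomials\<close>

lemma sum_monomials:
  fixes p :: "'k \<Rightarrow>\<^sub>0 'a::comm_monoid_add"
  shows "p = (\<Sum>t\<in>Poly_Mapping.keys p. Poly_Mapping.single t (Poly_Mapping.lookup p t))"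
proof (rule poly_mapping_eqI)
  fix k
  have "Poly_Mapping.lookup p k = (\<Sum>t\<in>Poly_Mapping.keys p. if t = k then Poly_Mapping.lookup p t else 0)"
    by (simp add: in_keys_iff)
  also have "\<dots> = (\<Sum>t\<in>Poly_Mapping.keys p. Poly_Mapping.lookup (Poly_Mapping.single t (Poly_Mapping.lookup p t)) k)"
    by (intro sum.cong) (auto simp: lookup_single when_def)
  finally show "Poly_Mapping.lookup p k = Poly_Mapping.lookup (\<Sum>t\<in>Poly_Mapping.keys p. Poly_Mapping.single t (Poly_Mapping.lookup p t)) k"
    by (simp add: lookup_sum)
qed

lemma monomial_induct:
  fixes p :: "'k \<Rightarrow>\<^sub>0 'a::comm_monoid_add"
  assumes mono: "\<And>t c. P (Poly_Mapping.single t c)" and add: "\<And>p q. P p \<Longrightarrow> P q \<Longrightarrow> P (p + q)"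
  shows "P p"
proof -
  have "P (\<Sum>t\<in>T. Poly_Mapping.single t (Poly_Mapping.lookup p t))" if "finite T" for T
    using that
  proof (induction T)
    case empty
    show ?case using mono[of undefined 0] by simp
  qed (simp add: mono add)
  from this[of "Poly_Mapping.keys p"] show ?thesis using sum_monomials[of p] by simp
qed

text \<open>
  Evaluation and substitution are both instances, so that the homomorphism laws are proved once.
\<close>

definition gen_eval :: "('a \<Rightarrow> 'b) \<Rightarrow> ('v::finite \<Rightarrow> 'b) \<Rightarrow> ('v, 'a::comm_ring_1) mpoly \<Rightarrow> 'b::comm_ring_1" where
  "gen_eval \<phi> h p = (\<Sum>t\<in>Poly_Mapping.keys p.
      \<phi> (Poly_Mapping.lookup p t) * (\<Prod>i\<in>UNIV. h i ^ Poly_Mapping.lookup t i))"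

lemma eval_gen: "eval v = gen_eval id v" by (simp add: fun_eq_iff eval_def gen_eval_def)
lemma subst_gen: "subst h = gen_eval Const h" by (simp add: fun_eq_iff subst_def gen_eval_def)

locale coefficient_hom =
  fixes \<phi> :: "'a::comm_ring_1 \<Rightarrow> 'b::comm_ring_1"
  assumes hom_one: "\<phi> 1 = 1" and hom_add: "\<phi> (a + b) = \<phi> a + \<phi> b" and hom_mult: "\<phi> (a * b) = \<phi> a * \<phi> b"
begin

lemma hom_zero: "\<phi> 0 = 0"
  using hom_add[of 0 0] by simp

lemma gen_eval_superset:
  assumes "finite T" "Poly_Mapping.keys p \<subseteq> T"
  shows "gen_eval \<phi> h p = (\<Sum>t\<in>T. \<phi> (Poly_Mapping.lookup p t) * (\<Prod>i\<in>UNIV. h i ^ Poly_Mapping.lookup t i))"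
  unfolding gen_eval_def
  by (rule sum.mono_neutral_left) (use assms in \<open>auto simp: in_keys_iff hom_zero\<close>)

lemma gen_eval_add: "gen_eval \<phi> h (p + q) = gen_eval \<phi> h p + gen_eval \<phi> h q"
proof -
  let ?T = "Poly_Mapping.keys p \<union> Poly_Mapping.keys q"
  have T: "finite ?T" "Poly_Mapping.keys (p + q) \<subseteq> ?T" "Poly_Mapping.keys p \<subseteq> ?T" "Poly_Mapping.keys q \<subseteq> ?T"
    using keys_add[of p q] by auto
  show ?thesis
    unfolding gen_eval_superset[OF T(1,2)] gen_eval_superset[OF T(1,3)] gen_eval_superset[OF T(1,4)]
    by (simp add: lookup_add hom_add ring_distribs sum.distrib)
qed

lemma gen_eval_single: "gen_eval \<phi> h (Poly_Mapping.single t c) = \<phi> c * (\<Prod>i\<in>UNIV. h i ^ Poly_Mapping.lookup t i)"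
  by (subst gen_eval_superset[of "{t}"]) auto

lemma gen_eval_mult: "gen_eval \<phi> h (p * q) = gen_eval \<phi> h p * gen_eval \<phi> h q"
proof (induction p rule: monomial_induct)
  case (1 s a)
  show ?case
    by (induction q rule: monomial_induct)
      (simp_all add: mult_single gen_eval_single gen_eval_add ring_distribs hom_mult lookup_add power_add prod.distrib mult_ac)
qed (simp add: gen_eval_add ring_distribs)

lemma gen_eval_Const: "gen_eval \<phi> h (Const c) = \<phi> c"
  by (simp add: Const_def gen_eval_single)

lemma gen_eval_Var: "gen_eval \<phi> h (Var i) = h i"
proof -
  have "(\<Prod>j\<in>UNIV. h j ^ Poly_Mapping.lookup (Poly_Mapping.single i 1) j) = (\<Prod>j\<in>UNIV. if j = i then h j else 1)"
    by (intro prod.cong) (auto simp: lookup_single when_def)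
  then show ?thesis by (simp add: Var_def gen_eval_single hom_one)
qed

end

lemma Const_add: "Const (a + b) = Const a + Const b" by (simp add: Const_def single_add)
lemma Const_mult: "Const (a * b) = Const a * Const b" by (simp add: Const_def mult_single)
lemma Const_0: "Const 0 = 0" by (simp add: Const_def)
lemma Const_1: "Const 1 = 1" by (simp add: Const_def)
lemma Const_minus: "Const (- a) = - Const a" by (simp add: Const_def single_uminus)
lemma Const_diff: "Const (a - b) = Const a - Const b" by (simp add: Const_def single_diff)
lemma Const_numeral: "Const (numeral n) = numeral n" by (simp add: Const_def)
lemma Const_of_nat: "Const (of_nat n) = of_nat n" by (simp add: Const_def)
lemma Const_power: "Const (a ^ n) = Const a ^ n" by (induction n) (simp_all add: Const_1 Const_mult)
lemma Const_eq_0_iff: "Const c = (0 :: ('v::finite,'a::comm_ring_1) mpoly) \<longleftrightarrow> c = 0"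
  by (metis Const_def Const_0 lookup_single_eq lookup_zero)

interpretation id_hom: coefficient_hom "id :: 'a::comm_ring_1 \<Rightarrow> 'a"
  by unfold_locales auto
interpretation Const_hom: coefficient_hom "Const :: 'a::comm_ring_1 \<Rightarrow> ('w::finite, 'a) mpoly"
  by unfold_locales (simp_all add: Const_1 Const_add Const_mult)

lemma mpoly_induct [case_names Const Var add mult]:
  fixes p :: "('v::finite, 'a::comm_ring_1) mpoly"
  assumes Const: "\<And>c. P (Const c)" and Var: "\<And>i. P (Var i)"
    and add: "\<And>p q. P p \<Longrightarrow> P q \<Longrightarrow> P (p + q)" and mult: "\<And>p q. P p \<Longrightarrow> P q \<Longrightarrow> P (p * q)"
  shows "P p"
proof (induction p rule: monomial_induct)
  case (1 t c)
  have Var_power: "Var i ^ n = (Poly_Mapping.single (Poly_Mapping.single i n) 1 :: ('v, 'a) mpoly)" for i n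
    by (induction n) (simp_all add: Var_def mult_single flip: single_add)
  have Var_pow: "P (Var i ^ n)" for i n
  proof (induction n)
    case 0 show ?case using Const[of 1] by (simp add: Const_1)
  qed (simp add: Var mult)
  have pr1: "P (\<Prod>i\<in>X. Var i ^ Poly_Mapping.lookup t i)" if "finite X" for X
    using that
  proof (induction X)
    case empty show ?case using Const[of 1] by (simp add: Const_1)
  next
    case (insert i X)
    then show ?case using mult[OF Var_pow[of i "Poly_Mapping.lookup t i"]] by simp
  qed
  have pr2: "(\<Prod>i\<in>X. Var i ^ Poly_Mapping.lookup t i :: ('v, 'a) mpoly) = Poly_Mapping.single (\<Sum>i\<in>X. Poly_Mapping.single i (Poly_Mapping.lookup t i)) 1"
    if "finite X" for X
    using that by (induction X) (simp_all add: Var_power mult_single)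
  have "t = (\<Sum>i\<in>UNIV. Poly_Mapping.single i (Poly_Mapping.lookup t i))"
    by (subst sum_monomials) (rule sum.mono_neutral_left, auto simp: in_keys_iff)
  then have "Poly_Mapping.single t c = Const c * (\<Prod>i\<in>UNIV. Var i ^ Poly_Mapping.lookup t i)"
    using pr2[of UNIV] by (simp add: Const_def mult_single)
  then show ?case using mult[OF Const pr1[of UNIV]] by simp
qed (rule add)

lemma eval_simps [simp]:
  "eval v (p + q) = eval v p + eval v q"
  "eval v (p * q) = eval v p * eval v q"
  "eval v (Const c) = c"
  "eval v (Var i) = v i"
  by (simp_all add: eval_gen id_hom.gen_eval_add id_hom.gen_eval_mult id_hom.gen_eval_Const id_hom.gen_eval_Var)

lemma eval_simps2 [simp]:
  "eval v 0 = 0" "eval v 1 = 1" "eval v (numeral n) = numeral n" "eval v (of_nat k) = of_nat k"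
  using eval_simps(3)[of v] by (simp_all flip: Const_0 Const_1 Const_numeral Const_of_nat)

lemma eval_simps3 [simp]:
  "eval v (- p) = - eval v p" "eval v (p - q) = eval v p - eval v q" "eval v (p ^ k) = eval v p ^ k"
proof -
  show m: "eval v (- p) = - eval v p" for p
    using eval_simps(1)[of v p "- p"] by (simp add: add_eq_0_iff)
  show "eval v (p - q) = eval v p - eval v q" using eval_simps(1)[of v p "- q"] m by simp
  show "eval v (p ^ k) = eval v p ^ k" by (induction k) simp_all
qed

lemma eval_sum [simp]: "eval v (sum f X) = (\<Sum>x\<in>X. eval v (f x))"
  by (induction X rule: infinite_finite_induct) simp_all

lemma subst_simps [simp]:
  "subst h (p + q) = subst h p + subst h q"
  "subst h (p * q) = subst h p * subst h q"
  "subst h (Const c) = Const c"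
  "subst h (Var i) = h i"
  by (simp_all add: subst_gen Const_hom.gen_eval_add Const_hom.gen_eval_mult Const_hom.gen_eval_Const Const_hom.gen_eval_Var)

lemma subst_simps2 [simp]:
  "subst h 0 = 0" "subst h 1 = 1" "subst h (numeral n) = numeral n" "subst h (of_nat k) = of_nat k"
  using subst_simps(3)[of h] by (simp_all flip: Const_0 Const_1 Const_numeral Const_of_nat)

lemma subst_simps3 [simp]:
  "subst h (- p) = - subst h p" "subst h (p - q) = subst h p - subst h q" "subst h (p ^ k) = subst h p ^ k"
proof -
  show m: "subst h (- p) = - subst h p" for p
    using subst_simps(1)[of h p "- p"] by (simp add: add_eq_0_iff)
  show "subst h (p - q) = subst h p - subst h q" using subst_simps(1)[of h p "- q"] m by simp
  show "subst h (p ^ k) = subst h p ^ k" by (induction k) simp_all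
qed

lemma eval_subst: "eval v (subst h p) = eval (\<lambda>i. eval v (h i)) p"
  by (induction p rule: mpoly_induct) simp_all

lemma partial_superset:
  assumes "finite T" "Poly_Mapping.keys p \<subseteq> T"
  shows "partial i p = (\<Sum>t\<in>T. Poly_Mapping.single (t - Poly_Mapping.single i 1)
        (of_nat (Poly_Mapping.lookup t i) * Poly_Mapping.lookup p t))"
  unfolding partial_def
  by (rule sum.mono_neutral_left) (use assms in \<open>auto simp: in_keys_iff\<close>)

lemma partial_single: "partial i (Poly_Mapping.single t c) =
    Poly_Mapping.single (t - Poly_Mapping.single i 1) (of_nat (Poly_Mapping.lookup t i) * c)"
  by (subst partial_superset[of "{t}"]) auto

lemma partial_add [simp]: "partial i (p + q) = partial i p + partial i q"
proof -
  let ?T = "Poly_Mapping.keys p \<union> Poly_Mapping.keys q"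
  have T: "finite ?T" "Poly_Mapping.keys (p + q) \<subseteq> ?T" "Poly_Mapping.keys p \<subseteq> ?T" "Poly_Mapping.keys q \<subseteq> ?T"
    using keys_add[of p q] by auto
  show ?thesis
    unfolding partial_superset[OF T(1,2)] partial_superset[OF T(1,3)] partial_superset[OF T(1,4)]
    by (simp add: lookup_add ring_distribs sum.distrib single_add)
qed

lemma partial_mult [simp]: "partial i (p * q) = partial i p * q + p * partial i q"
proof (induction p rule: monomial_induct)
  case (1 s a)
  show ?case
  proof (induction q rule: monomial_induct)
    case (1 t b)
    let ?e = "Poly_Mapping.single i (1::nat)"
    have shift: "(s - ?e) + t = s + t - ?e" if "Poly_Mapping.lookup s i \<noteq> 0" for s t :: "'a \<Rightarrow>\<^sub>0 nat"
      by (rule poly_mapping_eqI) (use that in \<open>auto simp: lookup_add lookup_minus lookup_single when_def\<close>)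
    have *: "Poly_Mapping.single ((s - ?e) + t) (of_nat (Poly_Mapping.lookup s i) * a * b)
       = Poly_Mapping.single (s + t - ?e) (of_nat (Poly_Mapping.lookup s i) * a * b)" for s t a b
      using shift[of s t] by (cases "Poly_Mapping.lookup s i = 0") auto
    show ?case
      using *[of s t a b] *[of t s b a]
      by (simp add: mult_single partial_single lookup_add ring_distribs single_add mult_ac add_ac)
  qed (simp add: ring_distribs add_ac)
qed (simp add: ring_distribs add_ac)

lemma partial_Const [simp]: "partial i (Const c) = 0"
  by (simp add: Const_def partial_single)

lemma partial_Var: "partial i (Var j) = (if i = j then 1 else 0)"
  by (auto simp: Var_def partial_single lookup_single)

lemma partial_simps2 [simp]:
  "partial i 0 = 0" "partial i 1 = 0" "partial i (numeral n) = 0" "partial i (of_nat k) = 0"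
  using partial_Const[of i] by (simp_all flip: Const_0 Const_1 Const_numeral Const_of_nat)

lemma lookup_partial: "Poly_Mapping.lookup (partial i p) t
    = of_nat (Poly_Mapping.lookup t i + 1) * Poly_Mapping.lookup p (t + Poly_Mapping.single i 1)"
proof (induction p rule: monomial_induct)
  case (1 s c)
  have "s - Poly_Mapping.single i 1 = t \<longleftrightarrow> s = t + Poly_Mapping.single i 1" if "Poly_Mapping.lookup s i \<noteq> 0"
    using that by (auto simp: poly_mapping_eq_iff fun_eq_iff lookup_add lookup_minus lookup_single when_def)
  moreover have "Poly_Mapping.lookup s i \<noteq> 0" if "s = t + Poly_Mapping.single i 1"
    using that by (simp add: lookup_add)
  ultimately show ?case
    by (cases "Poly_Mapping.lookup s i = 0") (auto simp: partial_single lookup_single when_def lookup_add)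
qed (simp add: lookup_add ring_distribs)

lemma eval_has_derivative:
  fixes f :: "('v::finite, complex) mpoly"
  assumes "\<And>i. ((\<lambda>t. \<gamma> t i) has_field_derivative \<gamma>' i) (at z)"
  shows "((\<lambda>t. eval (\<gamma> t) f) has_field_derivative (\<Sum>i\<in>UNIV. \<gamma>' i * eval (\<gamma> z) (partial i f))) (at z)"
proof (induction f rule: mpoly_induct)
  case (Var j)
  have "(\<Sum>i\<in>UNIV. \<gamma>' i * eval (\<gamma> z) (partial i (Var j))) = (\<Sum>i\<in>UNIV. if i = j then \<gamma>' i else 0)"
    by (intro sum.cong) (auto simp: partial_Var)
  then show ?case using assms[of j] by simp
next
  case (add p q)
  show ?case using DERIV_add[OF add] by (simp add: ring_distribs sum.distrib)
next
  case (mult p q)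
  show ?case using DERIV_mult[OF mult]
    by (simp add: ring_distribs sum.distrib sum_distrib_left sum_distrib_right mult_ac add_ac)
qed simp_all

abbreviation mdeg :: "('v::finite \<Rightarrow>\<^sub>0 nat) \<Rightarrow> nat" where
  "mdeg t \<equiv> (\<Sum>i\<in>UNIV. Poly_Mapping.lookup t i)"

text \<open>
  A polynomial that vanishes as a function has partial derivatives that vanish as functions and have
  smaller degree; so they are zero by induction, and a polynomial in characteristic \<open>0\<close> all of whose
  partial derivatives are zero is constant.
\<close>

lemma zero_function_imp_zero:
  fixes p :: "('v::finite, complex) mpoly"
  assumes "\<And>v. eval v p = 0"
  shows "p = 0"
proof -
  have "p = 0" if "\<And>v. eval v p = 0" "\<forall>t\<in>Poly_Mapping.keys p. mdeg t < n" for n and p :: "('v, complex) mpoly"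
    using that
  proof (induction n arbitrary: p)
    case 0
    then show ?case by auto
  next
    case (Suc n)
    have partial0: "partial j p = 0" for j
    proof (rule Suc.IH)
      fix v :: "'v \<Rightarrow> complex"
      have "((\<lambda>t. v i + t * (if i = j then 1 else 0)) has_field_derivative (if i = j then 1 else 0)) (at 0)" for i
        by (cases "i = j") (auto intro!: derivative_eq_intros)
      from eval_has_derivative[where \<gamma> = "\<lambda>t i. v i + t * (if i = j then 1 else 0)", OF this, of p] have "(\<Sum>i\<in>UNIV. (if i = j then 1 else 0) * eval v (partial i p)) = 0"
        by (simp add: Suc.prems(1) DERIV_unique[OF _ DERIV_const])
      moreover have "(\<Sum>i\<in>UNIV. (if i = j then 1 else 0) * eval v (partial i p)) = (\<Sum>i\<in>UNIV. if i = j then eval v (partial i p) else 0)"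
        by (intro sum.cong) auto
      ultimately show "eval v (partial j p) = 0" by simp
    next
      show "\<forall>t\<in>Poly_Mapping.keys (partial j p). mdeg t < n"
      proof
        fix t assume "t \<in> Poly_Mapping.keys (partial j p)"
        then have "t + Poly_Mapping.single j 1 \<in> Poly_Mapping.keys p"
          by (auto simp: in_keys_iff lookup_partial)
        with Suc.prems(2) have "mdeg (t + Poly_Mapping.single j 1) < Suc n" by blast
        moreover have "mdeg (Poly_Mapping.single j 1) = (\<Sum>i\<in>UNIV. if i = j then 1 else 0)"
          by (intro sum.cong) (auto simp: lookup_single when_def)
        ultimately show "mdeg t < n" by (simp add: lookup_add sum.distrib)
      qed
    qed
    have key0: "t = 0" if "t \<in> Poly_Mapping.keys p" for t
    proof (rule poly_mapping_eqI)
      fix i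
      show "Poly_Mapping.lookup t i = Poly_Mapping.lookup 0 i"
      proof (rule ccontr)
        assume "Poly_Mapping.lookup t i \<noteq> Poly_Mapping.lookup 0 i"
        then have ne: "Poly_Mapping.lookup t i \<noteq> 0" by simp
        then have t: "t = (t - Poly_Mapping.single i 1) + Poly_Mapping.single i 1"
          by (auto simp: poly_mapping_eq_iff fun_eq_iff lookup_add lookup_minus lookup_single when_def)
        have "Poly_Mapping.lookup p t = 0"
          using lookup_partial[of i p "t - Poly_Mapping.single i 1"] partial0[of i] t
          by (metis lookup_zero mult_eq_0_iff of_nat_eq_0_iff add_is_0 one_neq_zero)
        with that show False by (simp add: in_keys_iff)
      qed
    qed
    have "p = Const (Poly_Mapping.lookup p 0)"
      unfolding Const_def
      by (rule poly_mapping_eqI) (use key0 in \<open>auto simp: lookup_single when_def in_keys_iff\<close>)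
    with Suc.prems(1)[of "\<lambda>_. 0"] show ?case by (metis eval_simps(3) Const_0)
  qed
  moreover have "\<forall>t\<in>Poly_Mapping.keys p. mdeg t < Suc (\<Sum>t\<in>Poly_Mapping.keys p. mdeg t)"
    unfolding less_Suc_eq_le by (intro ballI member_le_sum[where f = mdeg]) auto
  ultimately show ?thesis using assms by blast
qed

lemma mpoly_eqI:
  fixes p q :: "('v::finite, complex) mpoly"
  assumes "\<And>v. eval v p = eval v q"
  shows "p = q"
  using zero_function_imp_zero[of "p - q"] assms by simp

lemma mult_swap_right: "(a * b) * c = (a * c) * (b :: 'a::comm_monoid_mult)"
  by (simp only: mult_ac)

section \<open>Ideals\<close>

lemma ideal_gen_base: "g \<in> G \<Longrightarrow> g \<in> ideal_generated G"
  by (simp add: ideal_generated_def module.span_base[OF module_mult])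
lemma ideal_gen_0: "0 \<in> ideal_generated G"
  by (simp add: ideal_generated_def module.span_zero[OF module_mult])
lemma ideal_gen_add: "a \<in> ideal_generated G \<Longrightarrow> b \<in> ideal_generated G \<Longrightarrow> a + b \<in> ideal_generated G"
  by (simp add: ideal_generated_def module.span_add[OF module_mult])
lemma ideal_gen_diff: "a \<in> ideal_generated G \<Longrightarrow> b \<in> ideal_generated G \<Longrightarrow> a - b \<in> ideal_generated G"
  by (simp add: ideal_generated_def module.span_diff[OF module_mult])
lemma ideal_gen_mult: "a \<in> ideal_generated G \<Longrightarrow> r * a \<in> ideal_generated G"
  by (simp add: ideal_generated_def module.span_scale[OF module_mult])
lemma ideal_gen_mult2: "a \<in> ideal_generated G \<Longrightarrow> a * r \<in> ideal_generated G"
  using ideal_gen_mult[of a G r] by (simp add: mult.commute)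
lemma ideal_gen_sum: "(\<And>x. x \<in> X \<Longrightarrow> f x \<in> ideal_generated G) \<Longrightarrow> sum f X \<in> ideal_generated G"
  by (simp add: ideal_generated_def module.span_sum[OF module_mult])

lemma ideal_gen_induct [consumes 1, case_names zero step]:
  assumes "x \<in> ideal_generated G" "P 0" "\<And>c g y. g \<in> G \<Longrightarrow> P y \<Longrightarrow> P (c * g + y)"
  shows "P x"
  using assms(1) unfolding ideal_generated_def
  by (rule module.span_induct_alt[OF module_mult]) (use assms in auto)

lemma ideal_gen_subset:
  assumes "\<And>g. g \<in> G \<Longrightarrow> g \<in> ideal_generated H" shows "ideal_generated G \<subseteq> ideal_generated H"
proof
  fix x assume "x \<in> ideal_generated G"
  then show "x \<in> ideal_generated H"
    by (induction rule: ideal_gen_induct) (auto intro: ideal_gen_0 ideal_gen_add ideal_gen_mult assms)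
qed

lemma ideal_gen_empty: "ideal_generated {} = {0}"
  by (simp add: ideal_generated_def module.span_empty[OF module_mult])

lemma ideal_gen_single: "x \<in> ideal_generated {g} \<longleftrightarrow> g dvd x"
proof
  assume "x \<in> ideal_generated {g}"
  then show "g dvd x" by (induction rule: ideal_gen_induct) auto
next
  assume "g dvd x"
  then show "x \<in> ideal_generated {g}" by (auto intro: ideal_gen_mult2 ideal_gen_base)
qed

lemma ideal_gen_pair: "x \<in> ideal_generated {g, h} \<longleftrightarrow> (\<exists>u v. x = u * g + v * h)"
proof
  assume "x \<in> ideal_generated {g, h}"
  then show "\<exists>u v. x = u * g + v * h"
  proof (induction rule: ideal_gen_induct)
    case zero
    show ?case by (rule exI[of _ 0], rule exI[of _ 0]) simp
  next
    case (step c k y)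
    then obtain u v where y: "y = u * g + v * h" by blast
    from step(1) consider "k = g" | "k = h" by blast
    then show ?case
    proof cases
      case 1 show ?thesis by (rule exI[of _ "c + u"], rule exI[of _ v]) (simp add: 1 y algebra_simps)
    next
      case 2 show ?thesis by (rule exI[of _ u], rule exI[of _ "c + v"]) (simp add: 2 y algebra_simps)
    qed
  qed
next
  assume "\<exists>u v. x = u * g + v * h"
  then obtain u v where x: "x = u * g + v * h" by blast
  show "x \<in> ideal_generated {g, h}"
    unfolding x by (intro ideal_gen_add ideal_gen_mult ideal_gen_base) auto
qed

lemma subst_ideal_gen: "x \<in> ideal_generated G \<Longrightarrow> subst h x \<in> ideal_generated (subst h ` G)"
  by (induction rule: ideal_gen_induct) (auto intro: ideal_gen_0 ideal_gen_add ideal_gen_mult ideal_gen_base)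

definition nonzerodivisor_mod :: "'a::comm_ring_1 \<Rightarrow> 'a set \<Rightarrow> bool" where
  "nonzerodivisor_mod a G \<longleftrightarrow> (\<forall>u. u * a \<in> ideal_generated G \<longrightarrow> u \<in> ideal_generated G)"

lemma nonzerodivisor_modI: "(\<And>u. u * a \<in> ideal_generated G \<Longrightarrow> u \<in> ideal_generated G) \<Longrightarrow> nonzerodivisor_mod a G"
  unfolding nonzerodivisor_mod_def by blast
lemma nonzerodivisor_modD: "nonzerodivisor_mod a G \<Longrightarrow> u * a \<in> ideal_generated G \<Longrightarrow> u \<in> ideal_generated G"
  unfolding nonzerodivisor_mod_def by blast

lemma nonzerodivisor_mod_mult:
  assumes "nonzerodivisor_mod a G" "nonzerodivisor_mod b G" shows "nonzerodivisor_mod (a * b) G"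
proof (rule nonzerodivisor_modI)
  fix u assume "u * (a * b) \<in> ideal_generated G"
  then have "(u * a) * b \<in> ideal_generated G" by (simp only: mult.assoc)
  then show "u \<in> ideal_generated G" by (rule nonzerodivisor_modD[OF assms(1) nonzerodivisor_modD[OF assms(2)]])
qed
lemma nonzerodivisor_mod_1: "nonzerodivisor_mod 1 G"
  by (simp add: nonzerodivisor_mod_def)
lemma nonzerodivisor_mod_power: "nonzerodivisor_mod a G \<Longrightarrow> nonzerodivisor_mod (a ^ n) G"
  by (induction n) (simp_all add: nonzerodivisor_mod_1 nonzerodivisor_mod_mult)

lemma nonzerodivisor_mod_single: "nonzerodivisor_mod f {g} \<longleftrightarrow> (\<forall>u. g dvd u * f \<longrightarrow> g dvd u)"
  by (simp add: nonzerodivisor_mod_def ideal_gen_single)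

lemma nonzerodivisor_mod_singleD: "nonzerodivisor_mod f {g} \<Longrightarrow> g dvd u * f \<Longrightarrow> g dvd u"
  unfolding nonzerodivisor_mod_single by (drule spec) (erule mp)

lemma nonzerodivisor_mod_single_mult:
  fixes f :: "'a::idom"
  assumes f: "nonzerodivisor_mod f {g}" "nonzerodivisor_mod f {h}" and "g \<noteq> 0"
  shows "nonzerodivisor_mod f {g * h}"
  unfolding nonzerodivisor_mod_single
proof (intro allI impI)
  fix u assume "g * h dvd u * f"
  then obtain k where k: "u * f = g * h * k" by (rule dvdE)
  then have "g dvd u * f" by (simp only: mult.assoc dvd_triv_left)
  then have "g dvd u" by (rule nonzerodivisor_mod_singleD[OF f(1)])
  then obtain u' where u': "u = g * u'" by (rule dvdE)
  have "g * (u' * f) = g * (h * k)" using k unfolding u' by (simp only: mult.assoc)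
  with \<open>g \<noteq> 0\<close> have "u' * f = h * k" by simp
  then have "h dvd u' * f" by (simp only: dvd_triv_left)
  then have "h dvd u'" by (rule nonzerodivisor_mod_singleD[OF f(2)])
  then show "g * h dvd u" unfolding u' by (rule mult_dvd_mono[OF dvd_refl])
qed

lemma nonzerodivisor_mod_prime:
  fixes g :: "'a::idom"
  assumes "prime_elem g" "\<not> g dvd f" shows "nonzerodivisor_mod f {g}"
  unfolding nonzerodivisor_mod_single
proof (intro allI impI)
  fix u assume "g dvd u * f"
  then have "g dvd u \<or> g dvd f" by (rule prime_elem_dvd_multD[OF assms(1)])
  with assms(2) show "g dvd u" by metis
qed

section \<open>Linear substitutions\<close>

abbreviation elim :: "'v::finite \<Rightarrow> ('v, 'a::comm_ring_1) mpoly \<Rightarrow> ('v, 'a) mpoly \<Rightarrow> ('v, 'a) mpoly" where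
  "elim i h \<equiv> subst (Var(i := h))"

text \<open>
  Modulo \<open>Var i - h\<close> the variable may be replaced by \<open>h\<close>.  Together with the converse for \<open>h\<close> free
  of that variable, this turns divisibility by \<open>Var i - h\<close> into the vanishing of a restriction, and
  makes such linear polynomials prime.
\<close>

lemma elim_cong_mod: "(Var i - h) dvd (f - elim i h f)"
proof (induction f rule: mpoly_induct)
  case (add p q)
  have "p + q - elim i h (p + q) = (p - elim i h p) + (q - elim i h q)" by simp
  with add show ?case by (metis dvd_add)
next
  case (mult p q)
  have "p * q - elim i h (p * q) = (p - elim i h p) * q + elim i h p * (q - elim i h q)" by (simp add: algebra_simps)
  with mult show ?case by (metis dvd_add dvd_mult dvd_mult2)
qed auto

lemma subst_subst: "subst k (subst h p) = subst (\<lambda>i. subst k (h i)) p"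
  by (induction p rule: mpoly_induct) simp_all

lemma subst_Var [simp]: "subst Var p = p"
  by (induction p rule: mpoly_induct) simp_all

text \<open>
  Not mentioning a variable is expressed by a fixed point equation, so that closure under the ring
  operations follows from the homomorphism laws of substitution.
\<close>

definition free_of :: "'v::finite \<Rightarrow> ('v, 'a::comm_ring_1) mpoly \<Rightarrow> bool" where
  "free_of i h \<longleftrightarrow> elim i 0 h = h"

lemma elim_free_of:
  assumes "free_of i h" shows "elim i k h = h"
proof -
  have "elim i k (elim i 0 h) = elim i 0 h"
    unfolding subst_subst by (rule arg_cong[where f = "\<lambda>g. subst g h"]) (auto simp: fun_eq_iff)
  with assms show ?thesis by (simp add: free_of_def)
qed

lemma elim_idem: "free_of i h \<Longrightarrow> elim i h (elim i h p) = elim i h p"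
  unfolding subst_subst by (rule arg_cong[where f = "\<lambda>g. subst g p"]) (auto simp: fun_eq_iff elim_free_of)

lemma free_of_simps [simp]:
  "free_of i (Const c)" "free_of i 0" "free_of i 1" "free_of i (numeral n)"
  "i \<noteq> j \<Longrightarrow> free_of i (Var j)"
  "free_of i p \<Longrightarrow> free_of i q \<Longrightarrow> free_of i (p + q)"
  "free_of i p \<Longrightarrow> free_of i q \<Longrightarrow> free_of i (p - q)"
  "free_of i p \<Longrightarrow> free_of i q \<Longrightarrow> free_of i (p * q)"
  "free_of i p \<Longrightarrow> free_of i (- p)"
  by (simp_all add: free_of_def)

lemma dvd_iff_elim:
  assumes "free_of i h"
  shows "(Var i - h) dvd f \<longleftrightarrow> elim i h f = 0"
proof
  assume "(Var i - h) dvd f"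
  then obtain k where "f = (Var i - h) * k" by blast
  then show "elim i h f = 0" by (simp add: elim_free_of[OF assms])
next
  assume "elim i h f = 0"
  with elim_cong_mod[of i h f] show "(Var i - h) dvd f" by simp
qed

lemma Var_nonzero [simp]: "Var i \<noteq> (0 :: ('v::finite, 'a::comm_ring_1) mpoly)"
proof -
  have "Poly_Mapping.lookup (Var i :: ('v, 'a) mpoly) (Poly_Mapping.single i 1) \<noteq> Poly_Mapping.lookup 0 (Poly_Mapping.single i 1)"
    by (simp add: Var_def)
  then show ?thesis by metis
qed

lemma linear_nonzero:
  assumes "free_of i h" shows "Var i - h \<noteq> 0"
proof
  assume "Var i - h = 0"
  then have h: "h = Var i" by simp
  with assms have "Var i = (0 :: ('a, 'b) mpoly)" by (simp add: free_of_def)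
  then show False by simp
qed

lemma linear_prime:
  fixes h :: "('v::{finite,linorder}, 'a::idom) mpoly"
  assumes "free_of i h" shows "prime_elem (Var i - h)"
proof (rule prime_elemI)
  show "Var i - h \<noteq> 0" by (rule linear_nonzero) fact
  show "\<not> (Var i - h) dvd 1" by (simp add: dvd_iff_elim[OF assms])
qed (auto simp: dvd_iff_elim[OF assms])

lemma linear_dvd_mult_left:
  fixes h :: "('v::{finite,linorder}, 'a::idom) mpoly"
  assumes "free_of i h" "elim i h q \<noteq> 0" "(Var i - h) dvd p * q" shows "(Var i - h) dvd p"
  using assms by (auto simp: dvd_iff_elim)

text \<open>
  If a linear polynomial \<open>l\<close> divides \<open>\<alpha> f + \<beta> g\<close>, then the restrictions of \<open>\<alpha>\<close> and \<open>\<beta>\<close> to \<open>l = 0\<close> form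
  a syzygy of two coprime elements, hence are \<open>\<kappa>\<close> times the trivial syzygy.  Subtracting
  \<open>\<kappa> (g, - f)\<close> makes \<open>\<alpha>\<close> and \<open>\<beta>\<close> divisible by \<open>l\<close> without changing the sum.
\<close>

lemma linear_nonzerodivisor_mod_pair:
  fixes h :: "('v::{finite,linorder}, 'a::idom) mpoly"
  assumes h: "free_of i h" and nz: "elim i h g \<noteq> 0" and coprime: "nonzerodivisor_mod (elim i h f) {elim i h g}"
  shows "nonzerodivisor_mod (Var i - h) {f, g}"
proof (rule nonzerodivisor_modI)
  let ?l = "Var i - h" and ?s = "elim i h"
  fix u assume "u * ?l \<in> ideal_generated {f, g}"
  then obtain \<alpha> \<beta> where rel: "u * ?l = \<alpha> * f + \<beta> * g" unfolding ideal_gen_pair by (elim exE)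
  have "?s (u * ?l) = 0" by (simp add: elim_free_of[OF h])
  then have 0: "?s \<alpha> * ?s f + ?s \<beta> * ?s g = 0" unfolding rel by (simp only: subst_simps)
  have solve: "a * x = y * (- b)" if "a * x + b * y = 0" for a b x y :: "('v, 'a) mpoly"
    using that by (simp add: add_eq_0_iff mult.commute)
  from solve[OF 0] have "?s g dvd ?s \<alpha> * ?s f" by (metis dvd_triv_left)
  then have "?s g dvd ?s \<alpha>" by (rule nonzerodivisor_mod_singleD[OF coprime])
  then obtain \<kappa> where \<kappa>: "?s \<alpha> = ?s g * \<kappa>" by (rule dvdE)
  have "?s g * (?s \<beta> + \<kappa> * ?s f) = 0" using 0 unfolding \<kappa> by (simp only: ring_distribs mult_ac add_ac)
  with nz have "?s \<beta> + \<kappa> * ?s f = 0" by (simp only: mult_eq_0_iff) metis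
  note ss = elim_idem[OF h]
  have "?s g * ?s \<kappa> = ?s g * \<kappa>" using ss[of \<alpha>] unfolding \<kappa> by (simp only: subst_simps ss)
  then have \<kappa>': "?s \<kappa> = \<kappa>" by (rule iffD1[OF mult_left_cancel[OF nz]])
  have "?l dvd (\<alpha> - g * \<kappa>)" "?l dvd (\<beta> + \<kappa> * f)"
    unfolding dvd_iff_elim[OF h] by (simp_all only: subst_simps subst_simps3 \<kappa> \<kappa>' diff_self \<open>?s \<beta> + \<kappa> * ?s f = 0\<close>)
  then obtain \<alpha>' \<beta>' where ab: "\<alpha> - g * \<kappa> = ?l * \<alpha>'" "\<beta> + \<kappa> * f = ?l * \<beta>'" by (elim dvdE)
  have "l * u = l * (a' * f + b' * g)" if "a - g * k = l * a'" "b + k * f = l * b'" "u * l = a * f + b * g"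
    for l u a b a' b' k :: "('v, 'a) mpoly"
  proof -
    have "l * (a' * f + b' * g) = (a - g * k) * f + (b + k * f) * g" unfolding that by (simp only: ring_distribs mult_ac)
    also have "\<dots> = a * f + b * g" by (simp add: ring_distribs)
    finally show ?thesis using that(3) by (simp only: mult.commute)
  qed
  from this[OF ab rel] have "u = \<alpha>' * f + \<beta>' * g" by (rule iffD1[OF mult_left_cancel[OF linear_nonzero[OF h]]])
  then show "u \<in> ideal_generated {f, g}" unfolding ideal_gen_pair by (intro exI)
qed

lemma linear_nonzerodivisor_mod_single:
  fixes h :: "('v::{finite,linorder}, 'a::idom) mpoly"
  assumes h: "free_of i h" and nz: "elim i h g \<noteq> 0"
  shows "nonzerodivisor_mod (Var i - h) {g}"
proof (rule nonzerodivisor_modI)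
  fix u assume "u * (Var i - h) \<in> ideal_generated {g}"
  then have "g dvd u * (Var i - h)" by (simp only: ideal_gen_single)
  then obtain v where "u * (Var i - h) = g * v" by (rule dvdE)
  then have v: "u * (Var i - h) = v * g" by (simp only: mult.commute)
  have "(Var i - h) dvd v * g" unfolding v[symmetric] by (rule dvd_triv_right)
  then have "(Var i - h) dvd v" by (rule linear_dvd_mult_left[OF h nz])
  then obtain w where w: "v = (Var i - h) * w" by (rule dvdE)
  have "(Var i - h) * u = (Var i - h) * (w * g)" using v unfolding w by (simp only: mult_ac)
  then have "u = w * g" by (rule iffD1[OF mult_left_cancel[OF linear_nonzero[OF h]]])
  then show "u \<in> ideal_generated {g}" by (simp only: ideal_gen_single dvd_triv_right)
qed

section \<open>Homogeneous parts\<close>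

lemma mdeg_add: "mdeg (s + t) = mdeg s + mdeg t"
  by (simp add: lookup_add sum.distrib)

definition hom_part :: "nat \<Rightarrow> ('v::finite, 'a::comm_ring_1) mpoly \<Rightarrow> ('v, 'a) mpoly" where
  "hom_part d p = Poly_Mapping.mapp (\<lambda>t c. if mdeg t = d then c else 0) p"

lemma lookup_hom_part: "Poly_Mapping.lookup (hom_part d p) t = (if mdeg t = d then Poly_Mapping.lookup p t else 0)"
  by (auto simp: hom_part_def lookup_mapp when_def in_keys_iff)

lemma hom_part_add [simp]: "hom_part d (p + q) = hom_part d p + hom_part d q"
  by (rule poly_mapping_eqI) (simp add: lookup_hom_part lookup_add)
lemma hom_part_0 [simp]: "hom_part d 0 = 0"
  by (rule poly_mapping_eqI) (simp add: lookup_hom_part)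
lemma hom_part_sum: "hom_part d (sum f X) = (\<Sum>x\<in>X. hom_part d (f x))"
  by (induction X rule: infinite_finite_induct) simp_all
lemma hom_part_single: "hom_part d (Poly_Mapping.single t c) = (if mdeg t = d then Poly_Mapping.single t c else 0)"
  by (rule poly_mapping_eqI) (auto simp: lookup_hom_part lookup_single when_def)

lemma homogeneous_hom_part: "homogeneous d (hom_part d p)"
  by (auto simp: homogeneous_def in_keys_iff lookup_hom_part split: if_splits)
lemma hom_part_homogeneous: "homogeneous d p \<Longrightarrow> hom_part d p = p"
  by (rule poly_mapping_eqI) (auto simp: homogeneous_def lookup_hom_part in_keys_iff)

lemma sum_hom_parts:
  assumes "\<forall>t\<in>Poly_Mapping.keys p. mdeg t \<le> n"
  shows "p = (\<Sum>d\<le>n. hom_part d p)"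
proof (rule poly_mapping_eqI)
  fix t
  have "(\<Sum>d\<le>n. Poly_Mapping.lookup (hom_part d p) t) = (\<Sum>d\<le>n. if d = mdeg t then Poly_Mapping.lookup p t else 0)"
    by (intro sum.cong) (auto simp: lookup_hom_part)
  also have "\<dots> = Poly_Mapping.lookup p t"
    using assms by (auto simp: in_keys_iff)
  finally show "Poly_Mapping.lookup p t = Poly_Mapping.lookup (\<Sum>d\<le>n. hom_part d p) t"
    by (simp add: lookup_sum)
qed

lemma hom_part_mult:
  assumes g: "homogeneous e g"
  shows "hom_part n (f * g) = (if e \<le> n then hom_part (n - e) f * g else 0)"
proof -
  have 1: "hom_part n (f * Poly_Mapping.single t b) = (if e \<le> n then hom_part (n - e) f * Poly_Mapping.single t b else 0)"
    if "mdeg t = e" for t b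
  proof (induction f rule: monomial_induct)
    case (1 s a)
    have "mdeg (s + t) = n \<longleftrightarrow> e \<le> n \<and> mdeg s = n - e" using that mdeg_add[of s t] by linarith
    then show ?case by (auto simp: mult_single hom_part_single)
  qed (auto simp: ring_distribs)
  have "hom_part n (f * g) = (\<Sum>t\<in>Poly_Mapping.keys g. hom_part n (f * Poly_Mapping.single t (Poly_Mapping.lookup g t)))"
    by (subst (1) sum_monomials[of g]) (simp add: sum_distrib_left hom_part_sum)
  also have "\<dots> = (\<Sum>t\<in>Poly_Mapping.keys g. if e \<le> n then hom_part (n - e) f * Poly_Mapping.single t (Poly_Mapping.lookup g t) else 0)"
    by (intro sum.cong refl 1) (use g in \<open>auto simp: homogeneous_def\<close>)
  also have "\<dots> = (if e \<le> n then hom_part (n - e) f * g else 0)"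
    by (subst (3) sum_monomials[of g]) (simp add: sum_distrib_left)
  finally show ?thesis .
qed

lemma hom_part_ideal_gen:
  assumes "\<And>g. g \<in> G \<Longrightarrow> \<exists>e. homogeneous e g" "x \<in> ideal_generated G"
  shows "hom_part n x \<in> ideal_generated G"
  using assms(2)
proof (induction rule: ideal_gen_induct)
  case (step c g y)
  obtain e where e: "homogeneous e g" using assms(1) step(1) by blast
  have "hom_part n (c * g) \<in> ideal_generated G"
    using step(1) by (auto simp: hom_part_mult[OF e] intro: ideal_gen_mult ideal_gen_base ideal_gen_0)
  with step show ?case by (simp add: ideal_gen_add)
qed (simp add: ideal_gen_0)

lemma homogeneous_0: "homogeneous d 0" by (simp add: homogeneous_def)
lemma homogeneous_Const: "homogeneous 0 (Const c)" by (auto simp: homogeneous_def Const_def in_keys_iff lookup_single when_def)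
lemma homogeneous_Var: "homogeneous 1 (Var i)"
proof -
  have "mdeg (Poly_Mapping.single i 1) = (\<Sum>j\<in>UNIV. if j = i then 1 else 0)"
    by (intro sum.cong) (auto simp: lookup_single when_def)
  then show ?thesis by (auto simp: homogeneous_def Var_def)
qed
lemma homogeneous_add: "homogeneous d p \<Longrightarrow> homogeneous d q \<Longrightarrow> homogeneous d (p + q)"
  using keys_add[of p q] by (auto simp: homogeneous_def)
lemma homogeneous_minus: "homogeneous d p \<Longrightarrow> homogeneous d (- p)"
  by (simp add: homogeneous_def in_keys_iff)
lemma homogeneous_diff: "homogeneous d p \<Longrightarrow> homogeneous d q \<Longrightarrow> homogeneous d (p - q)"
  using homogeneous_add[of d p "- q"] homogeneous_minus[of d q] by simp
lemma homogeneous_mult: "homogeneous d p \<Longrightarrow> homogeneous e q \<Longrightarrow> homogeneous (d + e) (p * q)"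
  unfolding homogeneous_def
proof
  fix t assume "\<forall>t\<in>Poly_Mapping.keys p. mdeg t = d" "\<forall>t\<in>Poly_Mapping.keys q. mdeg t = e" "t \<in> Poly_Mapping.keys (p * q)"
  then obtain a b where "t = a + b" "mdeg a = d" "mdeg b = e" using keys_mult[of p q] by blast
  then show "mdeg t = d + e" by (simp add: mdeg_add)
qed
lemma homogeneous_power: "homogeneous d p \<Longrightarrow> homogeneous (n * d) (p ^ n)"
proof (induction n)
  case 0
  show ?case using homogeneous_Const[of 1] by (simp add: Const_1)
qed (simp add: homogeneous_mult)

text \<open>
  Let \<open>u f\<close> lie in the homogeneous ideal \<open>I\<close> generated by \<open>G\<close>.  Restricted to the hyperplane
  \<open>l = 0\<close>, \<open>u\<close> lies in \<open>I\<close>, so \<open>u = y + w l\<close> with \<open>y \<in> I\<close>.  Then \<open>w f l \<in> I\<close>, hence \<open>w f \<in> I\<close>.  For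
  homogeneous \<open>u\<close> the degree of \<open>w\<close> is smaller, which allows induction.
\<close>

lemma nonzerodivisor_lift:
  fixes h :: "('v::{finite,linorder}, 'a::idom) mpoly"
  assumes G: "\<And>g. g \<in> G \<Longrightarrow> \<exists>e. homogeneous e g" and f: "homogeneous e f"
    and h: "free_of i h" "homogeneous 1 h"
    and ell: "nonzerodivisor_mod (Var i - h) G"
    and restricted: "nonzerodivisor_mod (elim i h f) (elim i h ` G)"
  shows "nonzerodivisor_mod f G"
proof (rule nonzerodivisor_modI)
  let ?l = "Var i - h"
  note ss = elim_idem[OF h(1)]
  have hl: "homogeneous 1 ?l" by (intro homogeneous_diff homogeneous_Var h)
  have preimage: "\<exists>y\<in>ideal_generated G. elim i h y = x" if "x \<in> ideal_generated (elim i h ` G)" "elim i h x = x" for x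
  proof -
    have "\<exists>y\<in>ideal_generated G. elim i h y = elim i h x"
      using that(1)
    proof (induction rule: ideal_gen_induct)
      case zero
      show ?case by (rule bexI[of _ 0]) (auto simp: ideal_gen_0)
    next
      case (step c g y)
      then obtain z where z: "z \<in> ideal_generated G" "elim i h z = elim i h y" by blast
      from step(1) obtain g' where g': "g' \<in> G" "g = elim i h g'" by blast
      have "c * g' + z \<in> ideal_generated G"
        by (rule ideal_gen_add[OF ideal_gen_mult[OF ideal_gen_base[OF g'(1)]] z(1)])
      moreover have "elim i h (c * g' + z) = elim i h (c * g + y)"
        by (simp only: subst_simps z(2) g'(2) ss)
      ultimately show ?case by blast
    qed
    with that(2) show ?thesis by simp
  qed
  have hom: "u \<in> ideal_generated G" if "homogeneous n u" "u * f \<in> ideal_generated G" for u n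
    using that
  proof (induction n arbitrary: u)
    case (0 u)
    have *: "elim i h u * elim i h f \<in> ideal_generated (elim i h ` G)"
      using subst_ideal_gen[OF 0(2), of "Var(i := h)"] by simp
    obtain y where y: "y \<in> ideal_generated G" "elim i h y = elim i h u"
      using preimage[OF nonzerodivisor_modD[OF restricted *] ss] by (elim bexE)
    then have "?l dvd (u - y)" by (simp add: dvd_iff_elim[OF h(1)])
    then obtain w where "u - y = ?l * w" by (rule dvdE)
    then have w: "u = y + w * ?l" by (simp only: diff_eq_eq add.commute mult.commute)
    have "u = hom_part 0 (y + w * ?l)" using hom_part_homogeneous[OF 0(1)] by (simp only: w[symmetric])
    also have "\<dots> = hom_part 0 y + hom_part 0 (w * ?l)" by (rule hom_part_add)
    also have "hom_part 0 (w * ?l) = 0" using hom_part_mult[OF hl, of 0 w] by simp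
    finally have "u = hom_part 0 y" by (simp only: add_0_right)
    then show ?case using hom_part_ideal_gen[OF G y(1), of 0] by (simp only:)
  next
    case (Suc n u)
    have *: "elim i h u * elim i h f \<in> ideal_generated (elim i h ` G)"
      using subst_ideal_gen[OF Suc(3), of "Var(i := h)"] by simp
    obtain y where y: "y \<in> ideal_generated G" "elim i h y = elim i h u"
      using preimage[OF nonzerodivisor_modD[OF restricted *] ss] by (elim bexE)
    then have "?l dvd (u - y)" by (simp add: dvd_iff_elim[OF h(1)])
    then obtain w where "u - y = ?l * w" by (rule dvdE)
    then have w: "u = y + w * ?l" by (simp only: diff_eq_eq add.commute mult.commute)
    have "u = hom_part (Suc n) (y + w * ?l)" using hom_part_homogeneous[OF Suc(2)] by (simp only: w[symmetric])
    also have "\<dots> = hom_part (Suc n) y + hom_part (Suc n) (w * ?l)" by (rule hom_part_add)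
    also have "hom_part (Suc n) (w * ?l) = hom_part n w * ?l" using hom_part_mult[OF hl, of "Suc n" w] by simp
    finally have u: "u = hom_part (Suc n) y + hom_part n w * ?l" .
    have yG: "hom_part (Suc n) y \<in> ideal_generated G" by (rule hom_part_ideal_gen[OF G y(1)])
    have "u * f - hom_part (Suc n) y * f = (u - hom_part (Suc n) y) * f" by (rule left_diff_distrib[symmetric])
    also have "u - hom_part (Suc n) y = hom_part n w * ?l" using u by (simp only: add_diff_cancel_left')
    also have "(hom_part n w * ?l) * f = (hom_part n w * f) * ?l" by (rule mult_swap_right)
    finally have "(hom_part n w * f) * ?l = u * f - hom_part (Suc n) y * f" ..
    moreover have "u * f - hom_part (Suc n) y * f \<in> ideal_generated G" by (rule ideal_gen_diff[OF Suc(3) ideal_gen_mult2[OF yG]])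
    ultimately have "(hom_part n w * f) * ?l \<in> ideal_generated G" by (rule ssubst[where P = "\<lambda>x. x \<in> ideal_generated G"])
    then have "hom_part n w * f \<in> ideal_generated G" by (rule nonzerodivisor_modD[OF ell])
    then have "hom_part n w \<in> ideal_generated G" by (rule Suc.IH[OF homogeneous_hom_part])
    then have "hom_part (Suc n) y + hom_part n w * ?l \<in> ideal_generated G" by (rule ideal_gen_add[OF yG ideal_gen_mult2])
    then show ?case by (simp only: u[symmetric])
  qed
  fix u assume u: "u * f \<in> ideal_generated G"
  have hp: "hom_part n u \<in> ideal_generated G" for n
  proof (rule hom[OF homogeneous_hom_part])
    have "hom_part n u * f = hom_part (n + e) (u * f)" by (simp add: hom_part_mult[OF f])
    also have "\<dots> \<in> ideal_generated G" by (rule hom_part_ideal_gen[OF G u])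
    finally show "hom_part n u * f \<in> ideal_generated G" .
  qed
  have parts: "(\<Sum>d\<le>(\<Sum>t\<in>Poly_Mapping.keys u. mdeg t). hom_part d u) \<in> ideal_generated G"
    by (rule ideal_gen_sum[where f = "\<lambda>d. hom_part d u"]) (rule hp)
  have eq: "u = (\<Sum>d\<le>(\<Sum>t\<in>Poly_Mapping.keys u. mdeg t). hom_part d u)"
    by (rule sum_hom_parts, rule ballI, rule member_le_sum[where f = mdeg]) auto
  show "u \<in> ideal_generated G" by (subst eq) (rule parts)
qed

section \<open>Covariants of a binary quintic\<close>

lemma UNIV_6: "UNIV = {0, 1, 2, 3, 4, 5 :: 6}"
proof -
  have "card {0, 1, 2, 3, 4, 5 :: 6} = 6" by simp
  then show ?thesis by (intro card_subset_eq[symmetric]) simp_all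
qed

text \<open>
  The coefficients of half of the quadratic covariant \<open>(F, F)\<^sub>4\<close>; see \<open>theta22_eq\<close> below.  The
  definitions are generic in the ring because they are applied to numbers and to polynomials.
\<close>

definition iA :: "(6 \<Rightarrow> 'a) \<Rightarrow> 'a::comm_ring_1" where
  "iA a = a 0 * a 4 - 4 * a 1 * a 3 + 3 * a 2 ^ 2"
definition iB :: "(6 \<Rightarrow> 'a) \<Rightarrow> 'a::comm_ring_1" where
  "iB a = a 0 * a 5 - 3 * a 1 * a 4 + 2 * a 2 * a 3"
definition iC :: "(6 \<Rightarrow> 'a) \<Rightarrow> 'a::comm_ring_1" where
  "iC a = a 1 * a 5 - 4 * a 2 * a 4 + 3 * a 3 ^ 2"

text \<open>
  The coefficient at the first variable of \<open>(i\<^sup>2, F)\<^sub>4\<close> where \<open>i = X x\<^sup>2 + Y x y + Z y\<^sup>2\<close>.  The coefficient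
  at the second variable is obtained by shifting the coefficients of the quintic, as \<open>th1\<close> does.
\<close>

definition linear_covariant :: "'a \<Rightarrow> 'a \<Rightarrow> 'a \<Rightarrow> 'a \<Rightarrow> 'a \<Rightarrow> 'a \<Rightarrow> 'a \<Rightarrow> 'a \<Rightarrow> 'a::comm_ring_1" where
  "linear_covariant X Y Z b0 b1 b2 b3 b4 = X^2 * b4 - 2 * X * Y * b3 + (2 * X * Z + Y^2) * b2 - 2 * Y * Z * b1 + Z^2 * b0"

definition th0 :: "(6 \<Rightarrow> 'a) \<Rightarrow> 'a::comm_ring_1" where
  "th0 a = linear_covariant (iA a) (iB a) (iC a) (a 0) (a 1) (a 2) (a 3) (a 4)"
definition th1 :: "(6 \<Rightarrow> 'a) \<Rightarrow> 'a::comm_ring_1" where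
  "th1 a = linear_covariant (iA a) (iB a) (iC a) (a 1) (a 2) (a 3) (a 4) (a 5)"

definition form :: "(6 \<Rightarrow> 'a) \<Rightarrow> 'a \<Rightarrow> 'a \<Rightarrow> 'a::comm_ring_1" where
  "form a x y = a 0 * x^5 + 5 * a 1 * x^4 * y + 10 * a 2 * x^3 * y^2 + 10 * a 3 * x^2 * y^3 + 5 * a 4 * x * y^4 + a 5 * y^5"

text \<open>
  The coefficients of \<open>F (p x + q y, r x + s y)\<close>, normalised by binomial coefficients.
\<close>

definition act :: "'a \<Rightarrow> 'a \<Rightarrow> 'a \<Rightarrow> 'a \<Rightarrow> (6 \<Rightarrow> 'a) \<Rightarrow> 6 \<Rightarrow> 'a::comm_ring_1" where
  "act p q r s a j = (
     if j = 0 then p^5 * a 0 + 5 * p^4 * r * a 1 + 10 * p^3 * r^2 * a 2 + 10 * p^2 * r^3 * a 3 + 5 * p * r^4 * a 4 + r^5 * a 5 else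
     if j = 1 then p^4 * q * a 0 + p^4 * s * a 1 + 4 * p^3 * r * q * a 1 + 4 * p^3 * r * s * a 2 + 6 * p^2 * r^2 * q * a 2 + 6 * p^2 * r^2 * s * a 3 + 4 * p * r^3 * q * a 3 + 4 * p * r^3 * s * a 4 + r^4 * q * a 4 + r^4 * s * a 5 else
     if j = 2 then p^3 * q^2 * a 0 + 2 * p^3 * q * s * a 1 + p^3 * s^2 * a 2 + 3 * p^2 * r * q^2 * a 1 + 6 * p^2 * r * q * s * a 2 + 3 * p^2 * r * s^2 * a 3 + 3 * p * r^2 * q^2 * a 2 + 6 * p * r^2 * q * s * a 3 + 3 * p * r^2 * s^2 * a 4 + r^3 * q^2 * a 3 + 2 * r^3 * q * s * a 4 + r^3 * s^2 * a 5 else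
     if j = 3 then p^2 * q^3 * a 0 + 3 * p^2 * q^2 * s * a 1 + 3 * p^2 * q * s^2 * a 2 + p^2 * s^3 * a 3 + 2 * p * r * q^3 * a 1 + 6 * p * r * q^2 * s * a 2 + 6 * p * r * q * s^2 * a 3 + 2 * p * r * s^3 * a 4 + r^2 * q^3 * a 2 + 3 * r^2 * q^2 * s * a 3 + 3 * r^2 * q * s^2 * a 4 + r^2 * s^3 * a 5 else
     if j = 4 then p * q^4 * a 0 + 4 * p * q^3 * s * a 1 + 6 * p * q^2 * s^2 * a 2 + 4 * p * q * s^3 * a 3 + p * s^4 * a 4 + r * q^4 * a 1 + 4 * r * q^3 * s * a 2 + 6 * r * q^2 * s^2 * a 3 + 4 * r * q * s^3 * a 4 + r * s^4 * a 5 else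
     q^5 * a 0 + 5 * q^4 * s * a 1 + 10 * q^3 * s^2 * a 2 + 10 * q^2 * s^3 * a 3 + 5 * q * s^4 * a 4 + s^5 * a 5)"

lemma act_simps:
  "act p q r s a 0 = p^5 * a 0 + 5 * p^4 * r * a 1 + 10 * p^3 * r^2 * a 2 + 10 * p^2 * r^3 * a 3 + 5 * p * r^4 * a 4 + r^5 * a 5"
  "act p q r s a 1 = p^4 * q * a 0 + p^4 * s * a 1 + 4 * p^3 * r * q * a 1 + 4 * p^3 * r * s * a 2 + 6 * p^2 * r^2 * q * a 2 + 6 * p^2 * r^2 * s * a 3 + 4 * p * r^3 * q * a 3 + 4 * p * r^3 * s * a 4 + r^4 * q * a 4 + r^4 * s * a 5"
  "act p q r s a 2 = p^3 * q^2 * a 0 + 2 * p^3 * q * s * a 1 + p^3 * s^2 * a 2 + 3 * p^2 * r * q^2 * a 1 + 6 * p^2 * r * q * s * a 2 + 3 * p^2 * r * s^2 * a 3 + 3 * p * r^2 * q^2 * a 2 + 6 * p * r^2 * q * s * a 3 + 3 * p * r^2 * s^2 * a 4 + r^3 * q^2 * a 3 + 2 * r^3 * q * s * a 4 + r^3 * s^2 * a 5"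
  "act p q r s a 3 = p^2 * q^3 * a 0 + 3 * p^2 * q^2 * s * a 1 + 3 * p^2 * q * s^2 * a 2 + p^2 * s^3 * a 3 + 2 * p * r * q^3 * a 1 + 6 * p * r * q^2 * s * a 2 + 6 * p * r * q * s^2 * a 3 + 2 * p * r * s^3 * a 4 + r^2 * q^3 * a 2 + 3 * r^2 * q^2 * s * a 3 + 3 * r^2 * q * s^2 * a 4 + r^2 * s^3 * a 5"
  "act p q r s a 4 = p * q^4 * a 0 + 4 * p * q^3 * s * a 1 + 6 * p * q^2 * s^2 * a 2 + 4 * p * q * s^3 * a 3 + p * s^4 * a 4 + r * q^4 * a 1 + 4 * r * q^3 * s * a 2 + 6 * r * q^2 * s^2 * a 3 + 4 * r * q * s^3 * a 4 + r * s^4 * a 5"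
  "act p q r s a 5 = q^5 * a 0 + 5 * q^4 * s * a 1 + 10 * q^3 * s^2 * a 2 + 10 * q^2 * s^3 * a 3 + 5 * q * s^4 * a 4 + s^5 * a 5"
  by (simp_all add: act_def)

text \<open>
  Through this lemma and the injectivity of \<open>form\<close>, composition laws of \<open>act\<close> reduce to the
  composition of linear substitutions.
\<close>

lemma form_act:
  fixes a :: "6 \<Rightarrow> complex"
  shows "form (act p q r s a) x y = form a (p * x + q * y) (r * x + s * y)"
  unfolding form_def act_simps by algebra

text \<open>
  The weight \<open>4\<close> of the determinant is that of a fourth transvectant.
\<close>

lemma i_act:
  fixes a :: "6 \<Rightarrow> complex"
  shows "iA (act p q r s a) = (p * s - q * r)^4 * (iA a * p^2 + iB a * p * r + iC a * r^2)"
    and "iB (act p q r s a) = (p * s - q * r)^4 * (2 * iA a * p * q + iB a * (p * s + q * r) + 2 * iC a * r * s)"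
    and "iC (act p q r s a) = (p * s - q * r)^4 * (iA a * q^2 + iB a * q * s + iC a * s^2)"
  unfolding act_simps iA_def iB_def iC_def by algebra+

lemma linear_covariant_act:
  fixes p :: complex
  shows "linear_covariant (A * p^2 + B * p * r + C * r^2) (2 * A * p * q + B * (p * s + q * r) + 2 * C * r * s) (A * q^2 + B * q * s + C * s^2)
     (act p q r s a 0) (act p q r s a 1) (act p q r s a 2) (act p q r s a 3) (act p q r s a 4)
    = (p * s - q * r)^4 * (p * linear_covariant A B C (a 0) (a 1) (a 2) (a 3) (a 4) + r * linear_covariant A B C (a 1) (a 2) (a 3) (a 4) (a 5))"
    and "linear_covariant (A * p^2 + B * p * r + C * r^2) (2 * A * p * q + B * (p * s + q * r) + 2 * C * r * s) (A * q^2 + B * q * s + C * s^2)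
     (act p q r s a 1) (act p q r s a 2) (act p q r s a 3) (act p q r s a 4) (act p q r s a 5)
    = (p * s - q * r)^4 * (q * linear_covariant A B C (a 0) (a 1) (a 2) (a 3) (a 4) + s * linear_covariant A B C (a 1) (a 2) (a 3) (a 4) (a 5))"
  unfolding act_simps linear_covariant_def by algebra+

lemma linear_covariant_scale: "linear_covariant (k * X) (k * Y) (k * Z) b0 b1 b2 b3 b4 = k^2 * linear_covariant X Y Z b0 b1 b2 b3 b4"
  unfolding linear_covariant_def by (simp add: algebra_simps power2_eq_square)

text \<open>
  \<open>(i\<^sup>2, F)\<^sub>4\<close> has weight \<open>2 * 4 + 4\<close>.
\<close>

lemma th_act:
  fixes a :: "6 \<Rightarrow> complex"
  shows "th0 (act p q r s a) = (p * s - q * r)^12 * (p * th0 a + r * th1 a)"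
    and "th1 (act p q r s a) = (p * s - q * r)^12 * (q * th0 a + s * th1 a)"
proof -
  have pow: "(x^4)^2 * (x^4 * y) = x^12 * y" for x y :: complex
    by (simp add: mult.assoc[symmetric] flip: power_mult power_add)
  show "th0 (act p q r s a) = (p * s - q * r)^12 * (p * th0 a + r * th1 a)"
    and "th1 (act p q r s a) = (p * s - q * r)^12 * (q * th0 a + s * th1 a)"
    unfolding th0_def th1_def i_act linear_covariant_scale linear_covariant_act pow by (rule refl)+
qed

lemma poly_of_form: "form a x 1 = poly [:a 5, 5 * a 4, 10 * a 3, 10 * a 2, 5 * a 1, a 0:] x"
  by (simp add: form_def algebra_simps eval_nat_numeral)

lemma all_6: "(\<forall>i::6. P i) \<longleftrightarrow> P 0 \<and> P 1 \<and> P 2 \<and> P 3 \<and> P 4 \<and> P 5"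
proof -
  have "(\<forall>i::6. P i) \<longleftrightarrow> (\<forall>i\<in>{0, 1, 2, 3, 4, 5 :: 6}. P i)" by (simp flip: UNIV_6)
  then show ?thesis by simp
qed

lemma fun_eq_6: "(f :: 6 \<Rightarrow> 'a) = g \<longleftrightarrow> f 0 = g 0 \<and> f 1 = g 1 \<and> f 2 = g 2 \<and> f 3 = g 3 \<and> f 4 = g 4 \<and> f 5 = g 5"
  by (simp add: fun_eq_iff all_6)

lemma sum_6: "(\<Sum>i\<in>(UNIV :: 6 set). f i) = f 0 + f 1 + f 2 + f 3 + f 4 + (f 5 :: 'a::comm_monoid_add)"
  by (subst UNIV_6) (simp add: add.assoc)

lemma form_inj:
  fixes a b :: "6 \<Rightarrow> complex"
  assumes "\<And>x y. form a x y = form b x y" shows "a = b"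
proof -
  have "poly [:a 5, 5 * a 4, 10 * a 3, 10 * a 2, 5 * a 1, a 0:] = poly [:b 5, 5 * b 4, 10 * b 3, 10 * b 2, 5 * b 1, b 0:]"
    by (rule ext) (simp only: assms flip: poly_of_form)
  then have "[:a 5, 5 * a 4, 10 * a 3, 10 * a 2, 5 * a 1, a 0:] = [:b 5, 5 * b 4, 10 * b 3, 10 * b 2, 5 * b 1, b 0:]"
    by (simp only: poly_eq_poly_eq_iff)
  then show ?thesis by (simp add: fun_eq_6)
qed

lemma act_act:
  fixes a :: "6 \<Rightarrow> complex"
  shows "act p' q' r' s' (act p q r s a) = act (p * p' + q * r') (p * q' + q * s') (r * p' + s * r') (r * q' + s * s') a"
  by (rule form_inj) (simp add: form_act algebra_simps)

lemma act_id: "act 1 0 0 1 a = a"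
  by (simp add: fun_eq_6 act_simps)

lemma act_inverse:
  fixes a :: "6 \<Rightarrow> complex"
  assumes "p * s - q * r \<noteq> 0"
  defines "D \<equiv> p * s - q * r"
  shows "act (s / D) (- q / D) (- r / D) (p / D) (act p q r s a) = a"
    and "act p q r s (act (s / D) (- q / D) (- r / D) (p / D) a) = a"
    and "(s / D) * (p / D) - (- q / D) * (- r / D) \<noteq> 0"
proof -
  have D: "D \<noteq> 0" using assms by simp
  have 1: "p * (s / D) + q * (- r / D) = 1" "r * (- q / D) + s * (p / D) = 1"
    "(s / D) * p + (- q / D) * r = 1" "(- r / D) * q + (p / D) * s = 1"
    using D by (simp_all add: field_simps) (simp_all add: D_def algebra_simps)
  have 0: "p * (- q / D) + q * (p / D) = 0" "r * (s / D) + s * (- r / D) = 0"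
    "(s / D) * q + (- q / D) * s = 0" "(- r / D) * p + (p / D) * r = 0"
    using D by (simp_all add: field_simps)
  show "act (s / D) (- q / D) (- r / D) (p / D) (act p q r s a) = a"
    and "act p q r s (act (s / D) (- q / D) (- r / D) (p / D) a) = a"
    unfolding act_act 0 1 act_id by (rule refl)+
  have "(s / D) * (p / D) - (- q / D) * (- r / D) = D / D^2"
    by (simp add: D_def power2_eq_square diff_divide_distrib mult.commute)
  then show "(s / D) * (p / D) - (- q / D) * (- r / D) \<noteq> 0" using D by simp
qed

lemma eval_act: "eval v (act p q r s h j) = act (eval v p) (eval v q) (eval v r) (eval v s) (\<lambda>i. eval v (h i)) j"
  by (simp add: act_def)

lemma eval_covariants:
  "eval v (iA h) = iA (\<lambda>i. eval v (h i))" "eval v (iB h) = iB (\<lambda>i. eval v (h i))" "eval v (iC h) = iC (\<lambda>i. eval v (h i))"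
  "eval v (th0 h) = th0 (\<lambda>i. eval v (h i))" "eval v (th1 h) = th1 (\<lambda>i. eval v (h i))"
  by (simp_all add: iA_def iB_def iC_def th0_def th1_def linear_covariant_def)

section \<open>The transvectants defining the covariants\<close>

text \<open>
  The form \<open>\<Sum> (n choose i) (c i) x\<^sup>n\<^sup>-\<^sup>i y\<^sup>i\<close>.  The recursion makes the rule for partial derivatives uniform
  in the order: each derivative lowers \<open>n\<close>, and the second one also shifts the coefficients.
\<close>

fun binary_form :: "nat \<Rightarrow> (nat \<Rightarrow> 'a) \<Rightarrow> 'a::comm_ring_1 binary_poly" where
  "binary_form 0 c = Const (c 0)"
| "binary_form (Suc n) c = Var 1 * binary_form n c + Var 2 * binary_form n (\<lambda>i. c (Suc i))"

lemma partial_1_binary_form: "partial 1 (binary_form (Suc n) c) = of_nat (Suc n) * binary_form n c"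
proof (induction n arbitrary: c)
  case (Suc n)
  show ?case
    by (subst binary_form.simps(2)) (simp only: partial_add partial_mult Suc, simp add: partial_Var algebra_simps)
qed (simp add: partial_Var)

lemma partial_2_binary_form: "partial 2 (binary_form (Suc n) c) = of_nat (Suc n) * binary_form n (\<lambda>i. c (Suc i))"
proof (induction n arbitrary: c)
  case (Suc n)
  show ?case
    by (subst binary_form.simps(2)) (simp only: partial_add partial_mult Suc, simp add: partial_Var algebra_simps)
qed (simp add: partial_Var)

lemma partial_1_scaled: "partial 1 (of_nat k * binary_form (Suc n) c) = of_nat (k * Suc n) * binary_form n c"
  by (simp only: partial_mult partial_simps2 partial_1_binary_form) (simp add: algebra_simps)
lemma partial_2_scaled: "partial 2 (of_nat k * binary_form (Suc n) c) = of_nat (k * Suc n) * binary_form n (\<lambda>i. c (Suc i))"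
  by (simp only: partial_mult partial_simps2 partial_2_binary_form) (simp add: algebra_simps)

lemma partial_1_iterated: "(partial 1 ^^ k) (of_nat m * binary_form (k + n) c) = of_nat (m * pochhammer (Suc n) k) * binary_form n c"
proof (induction k arbitrary: m)
  case (Suc k)
  have "(partial 1 ^^ Suc k) (of_nat m * binary_form (Suc k + n) c) = (partial 1 ^^ k) (of_nat (m * Suc (k + n)) * binary_form (k + n) c)"
    by (simp only: funpow_Suc_right o_apply add_Suc partial_1_scaled)
  also have "\<dots> = of_nat (m * Suc (k + n) * pochhammer (Suc n) k) * binary_form n c" by (rule Suc)
  also have "m * Suc (k + n) * pochhammer (Suc n) k = m * pochhammer (Suc n) (Suc k)" by (simp add: pochhammer_Suc algebra_simps)
  finally show ?case .
qed simp

lemma partial_2_iterated: "(partial 2 ^^ k) (of_nat m * binary_form (k + n) c) = of_nat (m * pochhammer (Suc n) k) * binary_form n (\<lambda>i. c (i + k))"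
proof (induction k arbitrary: m c)
  case (Suc k)
  have "(partial 2 ^^ Suc k) (of_nat m * binary_form (Suc k + n) c) = (partial 2 ^^ k) (of_nat (m * Suc (k + n)) * binary_form (k + n) (\<lambda>i. c (Suc i)))"
    by (simp only: funpow_Suc_right o_apply add_Suc partial_2_scaled)
  also have "\<dots> = of_nat (m * Suc (k + n) * pochhammer (Suc n) k) * binary_form n (\<lambda>i. c (Suc (i + k)))" by (rule Suc)
  also have "m * Suc (k + n) * pochhammer (Suc n) k = m * pochhammer (Suc n) (Suc k)" by (simp add: pochhammer_Suc algebra_simps)
  finally show ?case by (simp only: add_Suc_right)
qed simp

lemma partials_binary_form:
  "(partial 1 ^^ k) ((partial 2 ^^ l) (binary_form (l + (k + n)) c))
    = of_nat (pochhammer (Suc (k + n)) l * pochhammer (Suc n) k) * binary_form n (\<lambda>i. c (i + l))"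
  using partial_2_iterated[of l 1 "k + n" c] partial_1_iterated[of k "pochhammer (Suc (k + n)) l" n "\<lambda>i. c (i + l)"]
  by (simp only: of_nat_1 mult_1)

lemma quintic_expand: "quintic a = Const (a 0) * Var 1^5 + 5 * Const (a 1) * Var 1^4 * Var 2 + 10 * Const (a 2) * Var 1^3 * Var 2^2
    + 10 * Const (a 3) * Var 1^2 * Var 2^3 + 5 * Const (a 4) * Var 1 * Var 2^4 + Const (a 5) * Var 2^5"
proof -
  have "{..5::nat} = {0, 1, 2, 3, 4, 5}" by auto
  moreover have "(5 choose 2) = (10::nat)" "(5 choose 3) = (10::nat)" "(5 choose 4) = (5::nat)" by (simp_all add: eval_nat_numeral)
  ultimately show ?thesis by (simp add: quintic_def)
qed

lemma eval_quintic: "eval (\<lambda>j. if j = 1 then x else y) (quintic a) = form a x y"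
  by (simp add: quintic_expand form_def)

lemma binary_form_expand:
  fixes c :: "nat \<Rightarrow> 'a::comm_ring_1"
  shows
  "binary_form 5 c = Const (c 0) * Var 1^5 + 5 * Const (c 1) * Var 1^4 * Var 2 + 10 * Const (c 2) * Var 1^3 * Var 2^2
    + 10 * Const (c 3) * Var 1^2 * Var 2^3 + 5 * Const (c 4) * Var 1 * Var 2^4 + Const (c 5) * Var 2^5"
  "binary_form 4 c = Const (c 0) * Var 1^4 + 4 * Const (c 1) * Var 1^3 * Var 2 + 6 * Const (c 2) * Var 1^2 * Var 2^2
    + 4 * Const (c 3) * Var 1 * Var 2^3 + Const (c 4) * Var 2^4"
  "binary_form 2 c = Const (c 0) * Var 1^2 + 2 * Const (c 1) * Var 1 * Var 2 + Const (c 2) * Var 2^2"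
  "binary_form 1 c = Const (c 0) * Var 1 + Const (c 1) * Var 2"
proof -
  have 1: "binary_form 1 c = Const (c 0) * Var 1 + Const (c 1) * Var 2" for c :: "nat \<Rightarrow> 'a"
    by (simp only: binary_form.simps One_nat_def mult.commute)
  have 2: "binary_form 2 c = Var 1 * binary_form 1 c + Var 2 * binary_form 1 (\<lambda>i. c (Suc i))"
    "binary_form 3 c = Var 1 * binary_form 2 c + Var 2 * binary_form 2 (\<lambda>i. c (Suc i))"
    "binary_form 4 c = Var 1 * binary_form 3 c + Var 2 * binary_form 3 (\<lambda>i. c (Suc i))"
    "binary_form 5 c = Var 1 * binary_form 4 c + Var 2 * binary_form 4 (\<lambda>i. c (Suc i))" for c :: "nat \<Rightarrow> 'a"
    by (simp_all add: eval_nat_numeral)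
  have n: "Suc 0 = 1" "Suc 1 = 2" "Suc 2 = 3" "Suc 3 = 4" "Suc 4 = 5" by simp_all
  have r2: "x * (a * x + b * y) + y * (b * x + c * y) = a * x^2 + 2 * b * x * y + c * y^2" for x y a b c :: "'r::comm_ring_1"
    by (simp add: algebra_simps power2_eq_square)
  have r3: "x * (a * x^2 + 2 * b * x * y + c * y^2) + y * (b * x^2 + 2 * c * x * y + d * y^2) = a * x^3 + 3 * b * x^2 * y + 3 * c * x * y^2 + d * y^3" for x y a b c d :: "'r::comm_ring_1"
    by (simp add: algebra_simps power2_eq_square power3_eq_cube)
  have r4: "x * (a * x^3 + 3 * b * x^2 * y + 3 * c * x * y^2 + d * y^3) + y * (b * x^3 + 3 * c * x^2 * y + 3 * d * x * y^2 + e * y^3)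
     = a * x^4 + 4 * b * x^3 * y + 6 * c * x^2 * y^2 + 4 * d * x * y^3 + e * y^4" for x y a b c d e :: "'r::comm_ring_1"
    by (simp add: algebra_simps eval_nat_numeral)
  have r5: "x * (a * x^4 + 4 * b * x^3 * y + 6 * c * x^2 * y^2 + 4 * d * x * y^3 + e * y^4) + y * (b * x^4 + 4 * c * x^3 * y + 6 * d * x^2 * y^2 + 4 * e * x * y^3 + f * y^4)
     = a * x^5 + 5 * b * x^4 * y + 10 * c * x^3 * y^2 + 10 * d * x^2 * y^3 + 5 * e * x * y^4 + f * y^5" for x y a b c d e f :: "'r::comm_ring_1"
    by (simp add: algebra_simps eval_nat_numeral)
  show "binary_form 1 c = Const (c 0) * Var 1 + Const (c 1) * Var 2" by (rule 1)
  have e2: "binary_form 2 c = Const (c 0) * Var 1^2 + 2 * Const (c 1) * Var 1 * Var 2 + Const (c 2) * Var 2^2" for c :: "nat \<Rightarrow> 'a"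
    unfolding 2(1) 1 n r2 by (rule refl)
  have e3: "binary_form 3 c = Const (c 0) * Var 1^3 + 3 * Const (c 1) * Var 1^2 * Var 2 + 3 * Const (c 2) * Var 1 * Var 2^2 + Const (c 3) * Var 2^3" for c :: "nat \<Rightarrow> 'a"
    unfolding 2(2) e2 n r3 by (rule refl)
  have e4: "binary_form 4 c = Const (c 0) * Var 1^4 + 4 * Const (c 1) * Var 1^3 * Var 2 + 6 * Const (c 2) * Var 1^2 * Var 2^2
    + 4 * Const (c 3) * Var 1 * Var 2^3 + Const (c 4) * Var 2^4" for c :: "nat \<Rightarrow> 'a"
    unfolding 2(3) e3 n r4 by (rule refl)
  show "binary_form 2 c = Const (c 0) * Var 1^2 + 2 * Const (c 1) * Var 1 * Var 2 + Const (c 2) * Var 2^2" by (rule e2)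
  show "binary_form 4 c = Const (c 0) * Var 1^4 + 4 * Const (c 1) * Var 1^3 * Var 2 + 6 * Const (c 2) * Var 1^2 * Var 2^2
    + 4 * Const (c 3) * Var 1 * Var 2^3 + Const (c 4) * Var 2^4" by (rule e4)
  show "binary_form 5 c = Const (c 0) * Var 1^5 + 5 * Const (c 1) * Var 1^4 * Var 2 + 10 * Const (c 2) * Var 1^3 * Var 2^2
    + 10 * Const (c 3) * Var 1^2 * Var 2^3 + 5 * Const (c 4) * Var 1 * Var 2^4 + Const (c 5) * Var 2^5"
    unfolding 2(4) e4 n r5 by (rule refl)
qed

lemma generic_quintic_eq: "generic_quintic = binary_form 5 (\<lambda>i. Var (of_nat i))"
  by (simp only: generic_quintic_def quintic_expand binary_form_expand of_nat_0 of_nat_1 of_nat_numeral)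

lemma partials_quintic:
  fixes c :: "nat \<Rightarrow> 'a::comm_ring_1"
  assumes "k + l = 4"
  shows "(partial 1 ^^ k) ((partial 2 ^^ l) (binary_form 5 c)) = 120 * (Const (c l) * Var 1 + Const (c (Suc l)) * Var 2)"
proof -
  consider "k = 0" "l = 4" | "k = 1" "l = 3" | "k = 2" "l = 2" | "k = 3" "l = 1" | "k = 4" "l = 0" using assms by linarith
  then have "pochhammer (Suc (k + 1)) l * pochhammer (Suc 1) k = 120" by cases (simp_all add: eval_nat_numeral pochhammer_Suc)
  moreover have "l + (k + 1) = 5" using assms by simp
  ultimately show ?thesis
    using partials_binary_form[of k l 1 c] by (simp only: of_nat_numeral binary_form_expand(4) add_0 plus_1_eq_Suc)
qed

lemma partials_quartic:
  fixes c :: "nat \<Rightarrow> 'a::comm_ring_1"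
  assumes "k + l = 4"
  shows "(partial 1 ^^ k) ((partial 2 ^^ l) (binary_form 4 c)) = 24 * Const (c l)"
proof -
  consider "k = 0" "l = 4" | "k = 1" "l = 3" | "k = 2" "l = 2" | "k = 3" "l = 1" | "k = 4" "l = 0" using assms by linarith
  then have "pochhammer (Suc (k + 0)) l * pochhammer (Suc 0) k = 24" by cases (simp_all add: eval_nat_numeral pochhammer_Suc)
  moreover have "l + (k + 0) = 4" using assms by simp
  ultimately show ?thesis
    using partials_binary_form[of k l 0 c] by (simp only: of_nat_numeral binary_form.simps add_0)
qed

lemma sum_atMost_4: "(\<Sum>i\<le>4. f i) = f 0 + f 1 + f 2 + f 3 + (f (4::nat) :: 'a::comm_monoid_add)"
proof -
  have "{..4::nat} = {0, 1, 2, 3, 4}" by auto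
  then show ?thesis by (simp add: add.assoc)
qed

lemma choose_4: "(4 choose 0) = (1::nat)" "(4 choose 1) = (4::nat)" "(4 choose 2) = (6::nat)" "(4 choose 3) = (4::nat)" "(4 choose 4) = (1::nat)"
  by (simp_all add: eval_nat_numeral)

text \<open>
  The factorials in the normalisation of the transvectant cancel the constants that come from
  differentiating four times; the remaining forms are linear.
\<close>

lemma transvectant_quintic:
  fixes c d :: "nat \<Rightarrow> R"
  shows "transvectant 5 5 4 (binary_form 5 c) (binary_form 5 d) =
    (\<Sum>i\<le>4. (-1) ^ i * of_nat (4 choose i) * (Const (c i) * Var 1 + Const (c (Suc i)) * Var 2) * (Const (d (4 - i)) * Var 1 + Const (d (Suc (4 - i))) * Var 2))"
proof -
  have k: "Const (Const (fact (5 - 4) * fact (5 - 4) / (fact 5 * fact 5))) * (120 * 120) = (1 :: R binary_poly)"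
    by (simp add: fact_numeral flip: Const_numeral Const_mult Const_1)
  have eq: "(\<Sum>i\<le>4. (-1) ^ i * of_nat (4 choose i) * (partial 1 ^^ (4 - i)) ((partial 2 ^^ i) (binary_form 5 c)) * (partial 1 ^^ i) ((partial 2 ^^ (4 - i)) (binary_form 5 d)))
    = (\<Sum>i\<le>4. (120 * 120) * ((-1) ^ i * of_nat (4 choose i) * (Const (c i) * Var 1 + Const (c (Suc i)) * Var 2) * (Const (d (4 - i)) * Var 1 + Const (d (Suc (4 - i))) * Var 2)))"
    by (intro sum.cong refl) (simp add: partials_quintic algebra_simps)
  have le: "(4 \<le> min 5 (5::nat)) = True" by simp
  have "Const (Const (fact (5 - 4) * fact (5 - 4) / (fact 5 * fact 5))) * ((120 * 120) * z) = z" for z :: "R binary_poly"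
    by (simp only: mult.assoc[symmetric] k[unfolded mult.assoc[symmetric]] mult_1_left)
  then show ?thesis
    unfolding transvectant_def le if_True eq sum_distrib_left[symmetric] .
qed

lemma transvectant_quartic:
  fixes c d :: "nat \<Rightarrow> R"
  shows "transvectant 4 5 4 (binary_form 4 c) (binary_form 5 d) =
    (\<Sum>i\<le>4. (-1) ^ i * of_nat (4 choose i) * Const (c i) * (Const (d (4 - i)) * Var 1 + Const (d (Suc (4 - i))) * Var 2))"
proof -
  have k: "Const (Const (fact (4 - 4) * fact (5 - 4) / (fact 4 * fact 5))) * (24 * 120) = (1 :: R binary_poly)"
    by (simp add: fact_numeral flip: Const_numeral Const_mult Const_1)
  have eq: "(\<Sum>i\<le>4. (-1) ^ i * of_nat (4 choose i) * (partial 1 ^^ (4 - i)) ((partial 2 ^^ i) (binary_form 4 c)) * (partial 1 ^^ i) ((partial 2 ^^ (4 - i)) (binary_form 5 d)))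
    = (\<Sum>i\<le>4. (24 * 120) * ((-1) ^ i * of_nat (4 choose i) * Const (c i) * (Const (d (4 - i)) * Var 1 + Const (d (Suc (4 - i))) * Var 2)))"
    by (intro sum.cong refl) (simp add: partials_quintic partials_quartic algebra_simps)
  have le: "(4 \<le> min 4 (5::nat)) = True" by simp
  have "Const (Const (fact (4 - 4) * fact (5 - 4) / (fact 4 * fact 5))) * ((24 * 120) * z) = z" for z :: "R binary_poly"
    by (simp only: mult.assoc[symmetric] k[unfolded mult.assoc[symmetric]] mult_1_left)
  then show ?thesis
    unfolding transvectant_def le if_True eq sum_distrib_left[symmetric] .
qed

lemma theta22_eq: "theta22 = 2 * (Const (iA Var) * Var 1^2 + Const (iB Var) * Var 1 * Var 2 + Const (iC Var) * Var 2^2)"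
proof -
  have *: "(-1) ^ 0 * 1 * (a0 * x + a1 * y) * (a4 * x + a5 * y) + (-1) ^ 1 * of_nat 4 * (a1 * x + a2 * y) * (a3 * x + a4 * y)
    + (-1) ^ 2 * of_nat 6 * (a2 * x + a3 * y) * (a2 * x + a3 * y) + (-1) ^ 3 * of_nat 4 * (a3 * x + a4 * y) * (a1 * x + a2 * y)
    + (-1) ^ 4 * 1 * (a4 * x + a5 * y) * (a0 * x + a1 * y)
    = 2 * ((a0 * a4 - 4 * a1 * a3 + 3 * a2 ^ 2) * x^2 + (a0 * a5 - 3 * a1 * a4 + 2 * a2 * a3) * x * y + (a1 * a5 - 4 * a2 * a4 + 3 * a3 ^ 2) * y^2)"
    for a0 a1 a2 a3 a4 a5 x y :: "'r::comm_ring_1"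
    by (simp add: algebra_simps power2_eq_square)
  have n: "4 - 0 = (4::nat)" "4 - 1 = (3::nat)" "4 - 2 = (2::nat)" "4 - 3 = (1::nat)" "4 - 4 = (0::nat)"
    "Suc 0 = 1" "Suc 1 = 2" "Suc 2 = 3" "Suc 3 = 4" "Suc 4 = 5" by simp_all
  have c: "Const (iA Var) = Const (Var 0) * Const (Var 4) - 4 * Const (Var 1) * Const (Var 3) + 3 * (Const (Var 2) :: R binary_poly) ^ 2"
    "Const (iB Var) = Const (Var 0) * Const (Var 5) - 3 * Const (Var 1) * Const (Var 4) + 2 * Const (Var 2) * (Const (Var 3) :: R binary_poly)"
    "Const (iC Var) = Const (Var 1) * Const (Var 5) - 4 * Const (Var 2) * Const (Var 4) + 3 * (Const (Var 3) :: R binary_poly) ^ 2"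
    by (simp_all add: iA_def iB_def iC_def Const_add Const_mult Const_diff Const_power Const_numeral)
  show ?thesis
    unfolding theta22_def generic_quintic_eq transvectant_quintic sum_atMost_4 choose_4 n
    unfolding of_nat_0 of_nat_1 of_nat_numeral[where 'a = 6] c
    by (rule *)
qed

text \<open>
  The factor \<open>2/3\<close> arises because the middle coefficient of a quartic is normalised by \<open>6\<close>.
\<close>

lemma theta22_square: "theta22\<^sup>2 = binary_form 4 (\<lambda>i. if i = 0 then 4 * iA Var ^ 2 else if i = 1 then 2 * iA Var * iB Var
    else if i = 2 then Const (2/3) * (2 * iA Var * iC Var + iB Var ^ 2) else if i = 3 then 2 * iB Var * iC Var else 4 * iC Var ^ 2)"
proof -
  have *: "(2 * (a * x^2 + b * x * y + c * y^2))^2 = (4 * a^2) * x^4 + 4 * (2 * a * b) * x^3 * y + 6 * (k * (2 * a * c + b^2)) * x^2 * y^2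
     + 4 * (2 * b * c) * x * y^3 + (4 * c^2) * y^4" if "6 * k = 4" for a b c k x y :: "'r::comm_ring_1"
  proof -
    have "6 * (k * z) = 4 * z" for z using that by (simp only: mult.assoc[symmetric])
    then show ?thesis by (simp only:) (simp add: algebra_simps eval_nat_numeral)
  qed
  have k: "6 * Const (Const (2/3)) = (4 :: R binary_poly)"
    by (simp flip: Const_numeral Const_mult)
  show ?thesis
    unfolding theta22_eq *[OF k] binary_form_expand
    by (simp add: Const_add Const_mult Const_power Const_numeral)
qed

lemma theta51_eq: "theta51 = Const (4 * th0 Var) * Var 1 + Const (4 * th1 Var) * Var 2"
proof -
  have k: "6 * (Const (Const (2/3)) * z) = 4 * (z :: R binary_poly)" for z
    by (simp add: mult.assoc[symmetric] flip: Const_numeral Const_mult)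
  have n: "4 - 0 = (4::nat)" "4 - 1 = (3::nat)" "4 - 2 = (2::nat)" "4 - 3 = (1::nat)" "4 - 4 = (0::nat)"
    "Suc 0 = 1" "Suc 1 = 2" "Suc 2 = 3" "Suc 3 = 4" "Suc 4 = 5" by simp_all
  have *: "(4 * A^2) * (a4 * x + a5 * y) + - 1 * 4 * (2 * A * B) * (a3 * x + a4 * y) + 6 * (k * (2 * A * C + B^2)) * (a2 * x + a3 * y)
      + - 1 * 4 * (2 * B * C) * (a1 * x + a2 * y) + (4 * C^2) * (a0 * x + a1 * y)
    = 4 * (A^2 * a4 - 2 * A * B * a3 + (2 * A * C + B^2) * a2 - 2 * B * C * a1 + C^2 * a0) * x
      + 4 * (A^2 * a5 - 2 * A * B * a4 + (2 * A * C + B^2) * a3 - 2 * B * C * a2 + C^2 * a1) * y"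
    if "\<And>z. 6 * (k * z) = 4 * z" for A B C a0 a1 a2 a3 a4 a5 k x y :: "'r::comm_ring_1"
    unfolding that by (simp add: algebra_simps)
  show ?thesis
    unfolding theta51_def theta22_square generic_quintic_eq transvectant_quartic sum_atMost_4 choose_4 n
    unfolding of_nat_0 of_nat_1 of_nat_numeral
    using *[OF k, of "Const (iA Var)" "Const (Var 4)" "Var 1" "Const (Var 5)" "Var 2" "Const (iB Var)" "Const (Var 3)" "Const (iC Var)" "Const (Var 2)" "Const (Var 1)" "Const (Var 0)"]
    by (simp add: th0_def th1_def linear_covariant_def Const_add Const_mult Const_diff Const_power Const_numeral)
qed

lemma theta51_coeff_eq: "theta51_coeff 1 = 4 * th0 Var" "theta51_coeff 2 = 4 * th1 Var"
proof -
  have *: "Poly_Mapping.lookup (Const c * Var i) (Poly_Mapping.single j 1) = (if i = j then c else 0)" for c :: R and i j :: 2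
    by (auto simp: Const_def Var_def mult_single lookup_single when_def dest: arg_cong[where f = "\<lambda>p. Poly_Mapping.lookup p i"])
  show "theta51_coeff 1 = 4 * th0 Var" "theta51_coeff 2 = 4 * th1 Var"
    unfolding theta51_coeff_def theta51_eq lookup_add * by simp_all
qed

lemma homogeneous_theta51: "homogeneous 1 theta51"
  unfolding theta51_eq
  using homogeneous_mult[OF homogeneous_Const homogeneous_Var] by (intro homogeneous_add) auto

lemma homogeneous_numeral_mult: "homogeneous d p \<Longrightarrow> homogeneous d (numeral n * p)"
  using homogeneous_mult[OF homogeneous_Const, of d p "numeral n"] by (simp add: Const_numeral)

lemma homogeneous_i:
  fixes h :: "6 \<Rightarrow> ('v::finite, 'a::comm_ring_1) mpoly"
  assumes h: "\<And>i. homogeneous 1 (h i)"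
  shows "homogeneous 2 (iA h)" "homogeneous 2 (iB h)" "homogeneous 2 (iC h)"
proof -
  have v: "homogeneous 2 (h i * h j)" "homogeneous 2 (h i ^ 2)" for i j
    using homogeneous_mult[OF h[of i] h[of j]] homogeneous_power[OF h[of i], of 2] by (simp_all add: numeral_2_eq_2)
  show "homogeneous 2 (iA h)" "homogeneous 2 (iB h)" "homogeneous 2 (iC h)"
    unfolding iA_def iB_def iC_def mult.assoc
    by (intro homogeneous_add homogeneous_diff homogeneous_numeral_mult v)+
qed

lemma homogeneous_th:
  fixes h :: "6 \<Rightarrow> ('v::finite, 'a::comm_ring_1) mpoly"
  assumes h: "\<And>i. homogeneous 1 (h i)"
  shows "homogeneous 5 (th0 h)" "homogeneous 5 (th1 h)"
proof -
  have 1: "homogeneous 5 (x * y * h i)" if "homogeneous 2 x" "homogeneous 2 y" for x y i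
    using homogeneous_mult[OF homogeneous_mult[OF that] h[of i]] by simp
  have 2: "homogeneous 5 (x^2 * h i)" if "homogeneous 2 x" for x i
    using homogeneous_mult[OF homogeneous_power[OF that, of 2] h[of i]] by simp
  show "homogeneous 5 (th0 h)" "homogeneous 5 (th1 h)"
    unfolding th0_def th1_def linear_covariant_def mult.assoc[of 2] distrib_right
    by (intro homogeneous_add homogeneous_diff homogeneous_numeral_mult 1 2 homogeneous_i h)+
qed

section \<open>Regularity of the two coefficients\<close>

lemma subst_act: "subst k (act p q r s h j) = act (subst k p) (subst k q) (subst k r) (subst k s) (\<lambda>i. subst k (h i)) j"
  by (simp add: act_def)

lemma subst_covariants:
  "subst k (iA h) = iA (\<lambda>i. subst k (h i))" "subst k (iB h) = iB (\<lambda>i. subst k (h i))" "subst k (iC h) = iC (\<lambda>i. subst k (h i))"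
  "subst k (th0 h) = th0 (\<lambda>i. subst k (h i))" "subst k (th1 h) = th1 (\<lambda>i. subst k (h i))"
  by (simp_all add: iA_def iB_def iC_def th0_def th1_def linear_covariant_def)

lemma nonzerodivisor_mod_sym:
  fixes f g :: "'a::idom"
  assumes fg: "nonzerodivisor_mod f {g}" and "g \<noteq> 0" shows "nonzerodivisor_mod g {f}"
  unfolding nonzerodivisor_mod_single
proof (intro allI impI)
  fix u assume "f dvd u * g"
  then obtain v where v: "u * g = f * v" by (rule dvdE)
  then have "v * f = g * u" by (simp only: mult.commute)
  then have "g dvd v * f" by (rule dvdI)
  then have "g dvd v" by (rule nonzerodivisor_mod_singleD[OF fg])
  then obtain w where w: "v = g * w" by (rule dvdE)
  have "g * u = g * (f * w)" using v unfolding w by (simp only: mult_ac)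
  then have "u = f * w" by (rule iffD1[OF mult_left_cancel[OF \<open>g \<noteq> 0\<close>]])
  then show "f dvd u" by (rule dvdI)
qed

lemma nonzerodivisor_mod_unit:
  assumes "h * c = (1 :: 'a::comm_ring_1)" shows "nonzerodivisor_mod f {c}"
  unfolding nonzerodivisor_mod_single
proof (intro allI impI)
  fix u
  have "u = (h * c) * u" by (simp only: assms mult_1_left)
  then have "u = c * (h * u)" by (simp only: mult_ac)
  then show "c dvd u" by (rule dvdI)
qed

text \<open>
  One step from a linear section to the space containing it.  The linear form that cuts out the
  section is a nonzerodivisor modulo the two coefficients, because these are coprime on the section;
  this is the hypothesis under which regularity lifts.
\<close>

lemma th_lift:
  fixes v :: "6 \<Rightarrow> R" and h :: R
  assumes h: "free_of i h" "homogeneous 1 h" and v: "\<And>j. homogeneous 1 (v j)"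
    and v': "\<And>j. elim i h (v j) = v' j"
    and nz: "th1 v' \<noteq> 0" and K: "nonzerodivisor_mod (th0 v') {th1 v'}"
  shows "nonzerodivisor_mod (th0 v) {th1 v}"
    and "nonzerodivisor_mod (iA v') {th0 v', th1 v'} \<Longrightarrow> nonzerodivisor_mod (iA v) {th0 v, th1 v}"
    and "nonzerodivisor_mod (Var i - h) {th0 v, th1 v}"
proof -
  have s: "elim i h (th0 v) = th0 v'" "elim i h (th1 v) = th1 v'" "elim i h (iA v) = iA v'"
    unfolding subst_covariants v' by (rule refl)+
  show "nonzerodivisor_mod (th0 v) {th1 v}"
  proof (rule nonzerodivisor_lift[OF _ homogeneous_th(1)[of v, OF v] h])
    show "\<exists>e. homogeneous e g" if "g \<in> {th1 v}" for g using homogeneous_th(2)[of v, OF v] that by blast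
    show "nonzerodivisor_mod (Var i - h) {th1 v}" by (rule linear_nonzerodivisor_mod_single[OF h(1)]) (simp only: s nz not_False_eq_True)
    show "nonzerodivisor_mod (elim i h (th0 v)) (elim i h ` {th1 v})" using K by (simp only: s image_insert image_empty)
  qed
  show ell: "nonzerodivisor_mod (Var i - h) {th0 v, th1 v}"
    by (rule linear_nonzerodivisor_mod_pair[OF h(1)]) (simp_all only: s nz K not_False_eq_True)
  show "nonzerodivisor_mod (iA v) {th0 v, th1 v}" if "nonzerodivisor_mod (iA v') {th0 v', th1 v'}"
  proof (rule nonzerodivisor_lift[OF _ homogeneous_i(1)[of v, OF v] h])
    show "\<exists>e. homogeneous e g" if "g \<in> {th0 v, th1 v}" for g using homogeneous_th[of v, OF v] that by blast
    show "nonzerodivisor_mod (Var i - h) {th0 v, th1 v}" by (rule ell)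
    show "nonzerodivisor_mod (elim i h (iA v)) (elim i h ` {th0 v, th1 v})" using that by (simp only: s image_insert image_empty)
  qed
qed

text \<open>
  A flag of linear sections.  The third section is chosen so that \<open>iA\<close> becomes \<open>3 (a\<^sub>2 + a\<^sub>4)\<^sup>2\<close>, and the fourth
  one is the hyperplane \<open>a\<^sub>2 + a\<^sub>4 = 0\<close> in it: there only \<open>a\<^sub>4\<close> and \<open>a\<^sub>5\<close> remain, and coprimality can
  be seen from the linear factors.
\<close>

definition sec1 :: "6 \<Rightarrow> R" where "sec1 = Var(3 := 0)"
definition sec2 :: "6 \<Rightarrow> R" where "sec2 = Var(3 := 0, 1 := - 3 * Var 5)"
definition sec3 :: "6 \<Rightarrow> R" where "sec3 = Var(3 := 0, 1 := - 3 * Var 5, 0 := 6 * Var 2 + 3 * Var 4)"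
definition sec4 :: "6 \<Rightarrow> R" where "sec4 = Var(3 := 0, 1 := - 3 * Var 5, 0 := - 3 * Var 4, 2 := - Var 4)"

lemma th_sec4:
  "th0 sec4 = - 3 * Var 4 * (16 * Var 4 ^ 4 - 60 * Var 4 ^ 2 * Var 5 ^ 2 + 45 * Var 5 ^ 4)"
  "th1 sec4 = 9 * Var 5 ^ 3 * (4 * Var 4 ^ 2 - 3 * Var 5 ^ 2)"
proof -
  note defs = eval_covariants th0_def th1_def linear_covariant_def iA_def iB_def iC_def sec4_def
  show "th0 sec4 = - 3 * Var 4 * (16 * Var 4 ^ 4 - 60 * Var 4 ^ 2 * Var 5 ^ 2 + 45 * Var 5 ^ 4)"
    by (rule mpoly_eqI) (simp add: defs algebra_simps eval_nat_numeral)
  show "th1 sec4 = 9 * Var 5 ^ 3 * (4 * Var 4 ^ 2 - 3 * Var 5 ^ 2)"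
    by (rule mpoly_eqI) (simp add: defs algebra_simps eval_nat_numeral)
qed

text \<open>
  Over the complex numbers \<open>th1\<close> splits into linear factors on this section, and none of them
  divides \<open>th0\<close>.
\<close>

lemma th_sec4_coprime: "th1 sec4 \<noteq> 0" "nonzerodivisor_mod (th0 sec4) {th1 sec4}"
proof -
  have nonzero: "f \<noteq> 0" if "eval v f \<noteq> 0" for v and f :: R using that by auto
  show "th1 sec4 \<noteq> 0" by (rule nonzero[of "\<lambda>_. 1"]) (simp add: th_sec4)
  define \<kappa> :: complex where "\<kappa> = complex_of_real (sqrt 3) / 2"
  have \<kappa>2: "\<kappa>^2 = 3/4" by (simp add: \<kappa>_def power_divide flip: of_real_power)
  have \<kappa>4: "\<kappa>^4 = 9/16" using arg_cong[OF \<kappa>2, of "\<lambda>x. x^2"] by (simp add: power_divide flip: power_mult)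
  have "\<kappa> \<noteq> 0" using \<kappa>2 by auto
  have fac: "th1 sec4 = Const 36 * ((Var 5 - 0) * ((Var 5 - 0) * ((Var 5 - 0) * ((Var 4 - Const \<kappa> * Var 5) * (Var 4 - Const (- \<kappa>) * Var 5)))))"
    unfolding th_sec4 by (rule mpoly_eqI, simp, use \<kappa>2 in algebra)
  have free: "free_of 5 (0 :: R)" "free_of 4 (Const c * Var 5 :: R)" for c by simp_all
  have nd: "\<not> (Var 5 - 0) dvd th0 sec4" "\<not> (Var 4 - Const \<kappa> * Var 5) dvd th0 sec4" "\<not> (Var 4 - Const (- \<kappa>) * Var 5) dvd th0 sec4"
    unfolding dvd_iff_elim[OF free(1)] dvd_iff_elim[OF free(2)]
    by (rule nonzero[of "\<lambda>_. 1"], simp add: th_sec4 \<kappa>2 \<kappa>4 \<open>\<kappa> \<noteq> 0\<close>)+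
  note pr = nonzerodivisor_mod_prime[OF linear_prime[OF free(1)] nd(1)]
    nonzerodivisor_mod_prime[OF linear_prime[OF free(2)] nd(2)] nonzerodivisor_mod_prime[OF linear_prime[OF free(2)] nd(3)]
  have unit: "nonzerodivisor_mod (th0 sec4) {Const 36 :: R}"
    by (rule nonzerodivisor_mod_unit[of "Const (1/36)"]) (simp flip: Const_mult add: Const_1)
  show "nonzerodivisor_mod (th0 sec4) {th1 sec4}"
    unfolding fac
    by (intro nonzerodivisor_mod_single_mult unit pr linear_nonzero free) (simp add: Const_eq_0_iff)
qed

lemma homogeneous_sec: "homogeneous 1 (Var i :: R)" "homogeneous 1 (sec1 i)" "homogeneous 1 (sec2 i)" "homogeneous 1 (sec3 i)"
proof -
  have m: "homogeneous 1 (- 3 * Var i :: R)" for i using homogeneous_minus[OF homogeneous_numeral_mult[OF homogeneous_Var[of i], of "Num.Bit1 Num.One"]] by simp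
  show "homogeneous 1 (Var i :: R)" "homogeneous 1 (sec1 i)" "homogeneous 1 (sec2 i)" "homogeneous 1 (sec3 i)"
    by (auto simp: sec1_def sec2_def sec3_def simp del: One_nat_def intro!: homogeneous_Var homogeneous_0 homogeneous_minus homogeneous_add homogeneous_numeral_mult)
qed

text \<open>
  Both statements climb up the flag of sections.  The one about \<open>iA\<close> starts on the third section, where
  \<open>iA\<close> is a constant times the square of the linear form that cuts out the fourth section, and
  this form is a nonzerodivisor there.
\<close>

theorem th_regular:
  "nonzerodivisor_mod (th1 Var) {th0 Var :: R}" "nonzerodivisor_mod (iA Var) {th0 Var :: R, th1 Var}" "th0 Var \<noteq> (0 :: R)" "th1 Var \<noteq> (0 :: R)"
proof -
  have nonzero: "f \<noteq> 0" if "eval v f \<noteq> 0" for v and f :: R using that by auto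
  have nz: "th1 sec3 \<noteq> 0" "th1 sec2 \<noteq> 0" "th1 sec1 \<noteq> 0" "th1 Var \<noteq> (0 :: R)" "th0 Var \<noteq> (0 :: R)"
    \<comment> \<open>A point of the fourth section, hence of all of them.\<close>
    by (rule nonzero[of "\<lambda>i. if i = 0 then - 3 else if i = 1 then - 3 else if i = 2 then - 1 else if i = 3 then 0 else 1"],
        simp add: eval_covariants th0_def th1_def linear_covariant_def iA_def iB_def iC_def sec1_def sec2_def sec3_def)+
  have m: "homogeneous 1 (- 3 * Var i :: R)" "homogeneous 1 (- Var i :: R)" for i
    using homogeneous_minus[OF homogeneous_numeral_mult[OF homogeneous_Var[of i], of "Num.Bit1 Num.One"]] homogeneous_minus[OF homogeneous_Var[of i]] by simp_all
  have h: "free_of 2 (- Var 4 :: R)" "free_of 0 (6 * Var 2 + 3 * Var 4 :: R)" "free_of 1 (- 3 * Var 5 :: R)" "free_of 3 (0 :: R)"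
    by simp_all
  have h': "homogeneous 1 (- Var 4 :: R)" "homogeneous 1 (6 * Var 2 + 3 * Var 4 :: R)" "homogeneous 1 (- 3 * Var 5 :: R)" "homogeneous 1 (0 :: R)"
    by (intro m homogeneous_0 homogeneous_add homogeneous_numeral_mult homogeneous_Var)+
  have e: "elim 2 (- Var 4) (sec3 j) = sec4 j" "elim 0 (6 * Var 2 + 3 * Var 4) (sec2 j) = sec3 j"
    "elim 1 (- 3 * Var 5) (sec1 j) = sec2 j" "elim 3 0 (Var j) = sec1 j" for j
    by (auto simp: sec1_def sec2_def sec3_def sec4_def)
  note l3 = th_lift[OF h(1) h'(1) homogeneous_sec(4) e(1) th_sec4_coprime]
  note l2 = th_lift[OF h(2) h'(2) homogeneous_sec(3) e(2) nz(1) l3(1)]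
  note l1 = th_lift[OF h(3) h'(3) homogeneous_sec(2) e(3) nz(2) l2(1)]
  note l0 = th_lift[OF h(4) h'(4) homogeneous_sec(1) e(4) nz(3) l1(1)]
  have A3: "iA sec3 = Const 3 * (Var 2 - - Var 4)^2"
    by (rule mpoly_eqI) (simp add: eval_covariants iA_def sec3_def, algebra)
  have "nonzerodivisor_mod (Const 3 :: R) G" for G
  proof (rule nonzerodivisor_modI)
    fix u :: R assume "u * Const 3 \<in> ideal_generated G"
    then have "u * Const 3 * Const (1/3) \<in> ideal_generated G" by (rule ideal_gen_mult2)
    then show "u \<in> ideal_generated G" by (simp add: mult.assoc Const_1 flip: Const_mult)
  qed
  then have "nonzerodivisor_mod (iA sec3) {th0 sec3, th1 sec3}"
    unfolding A3 by (intro nonzerodivisor_mod_mult nonzerodivisor_mod_power l3(3))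
  from l0(2)[OF l1(2)[OF l2(2)[OF this]]] show "nonzerodivisor_mod (iA Var) {th0 Var :: R, th1 Var}" .
  show "nonzerodivisor_mod (th1 Var) {th0 Var :: R}" by (rule nonzerodivisor_mod_sym[OF l0(1) nz(4)])
  show "th0 Var \<noteq> (0 :: R)" "th1 Var \<noteq> (0 :: R)" by (rule nz)+
qed

section \<open>The zero set of the linear covariant\<close>

definition coeffs :: "'a \<Rightarrow> 'a \<Rightarrow> 'a \<Rightarrow> 'a \<Rightarrow> 'a \<Rightarrow> 'a \<Rightarrow> 6 \<Rightarrow> 'a" where
  "coeffs c0 c1 c2 c3 c4 c5 i = (if i = 0 then c0 else if i = 1 then c1 else if i = 2 then c2 else if i = 3 then c3 else if i = 4 then c4 else c5)"

lemma coeffs_simps [simp]: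
  "coeffs c0 c1 c2 c3 c4 c5 0 = c0" "coeffs c0 c1 c2 c3 c4 c5 1 = c1" "coeffs c0 c1 c2 c3 c4 c5 2 = c2"
  "coeffs c0 c1 c2 c3 c4 c5 3 = c3" "coeffs c0 c1 c2 c3 c4 c5 4 = c4" "coeffs c0 c1 c2 c3 c4 c5 5 = c5"
  by (simp_all add: coeffs_def)

definition gl_equivalent :: "(6 \<Rightarrow> complex) \<Rightarrow> (6 \<Rightarrow> complex) \<Rightarrow> bool" where
  "gl_equivalent a b \<longleftrightarrow> (\<exists>p q r s. p * s - q * r \<noteq> 0 \<and> a = act p q r s b)"

lemma gl_equivalentI: "p * s - q * r \<noteq> 0 \<Longrightarrow> a = act p q r s b \<Longrightarrow> gl_equivalent a b"
  unfolding gl_equivalent_def by blast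

lemma gl_equivalent_sym: assumes "gl_equivalent a b" shows "gl_equivalent b a"
proof -
  obtain p q r s where D: "p * s - q * r \<noteq> 0" and a: "a = act p q r s b" using assms unfolding gl_equivalent_def by blast
  show ?thesis by (rule gl_equivalentI[OF act_inverse(3)[OF D]]) (simp only: a act_inverse(1)[OF D])
qed

lemma gl_equivalent_trans: assumes "gl_equivalent a b" "gl_equivalent b c" shows "gl_equivalent a c"
proof -
  obtain p q r s where 1: "p * s - q * r \<noteq> 0" "a = act p q r s b" using assms unfolding gl_equivalent_def by blast
  obtain p' q' r' s' where 2: "p' * s' - q' * r' \<noteq> 0" "b = act p' q' r' s' c" using assms unfolding gl_equivalent_def by blast
  have "(p' * p + q' * r) * (r' * q + s' * s) - (p' * q + q' * s) * (r' * p + s' * r) = (p' * s' - q' * r') * (p * s - q * r)"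
    by algebra
  with 1 2 show ?thesis by (intro gl_equivalentI) (auto simp: act_act)
qed

lemma act_0: "act p q r s (\<lambda>_. 0) = (\<lambda>_. 0)"
  by (simp add: fun_eq_6 act_simps)

lemma gl_equivalent_0: "gl_equivalent a (\<lambda>_. 0) \<longleftrightarrow> a = (\<lambda>_. 0)"
proof
  show "gl_equivalent a (\<lambda>_. 0) \<Longrightarrow> a = (\<lambda>_. 0)" by (auto simp: gl_equivalent_def act_0)
  show "a = (\<lambda>_. 0) \<Longrightarrow> gl_equivalent a (\<lambda>_. 0)" by (rule gl_equivalentI[of 1 1 0 0]) (simp_all only: act_id, simp)
qed

lemma th_gl_equivalent:
  assumes "gl_equivalent a b" "th0 b = 0" "th1 b = 0" shows "th0 a = 0" "th1 a = 0"
  using assms by (auto simp: gl_equivalent_def th_act)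

text \<open>
  The divisors by \<open>5\<close> and \<open>10\<close> undo the binomial normalisation: the first form is \<open>x\<^sup>5 + y\<^sup>5\<close>, the
  second \<open>x\<^sup>4 y - x y\<^sup>4\<close>, and so on.
\<close>

definition orbit_representatives :: "(6 \<Rightarrow> complex) set" where
  "orbit_representatives = {coeffs 1 0 0 0 0 1, coeffs 0 (1/5) 0 0 (-1/5) 0, coeffs 0 (1/5) (1/10) 0 0 0,
     coeffs 0 0 (1/10) 0 0 0, coeffs 0 (1/5) 0 0 0 0, coeffs 1 0 0 0 0 0}"

lemma th_representatives:
  assumes "b \<in> orbit_representatives" shows "th0 b = 0" "th1 b = 0" "b \<noteq> (\<lambda>_. 0)"
  using assms by (auto simp: orbit_representatives_def th0_def th1_def linear_covariant_def iA_def iB_def iC_def fun_eq_6)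

lemma complex_root: obtains w :: complex where "w ^ Suc n = z"
  using exists_complex_root[of "Suc n" z] by (metis nat.distinct(1))

lemma form_root: obtains q s where "form a q s = (0::complex)" "q \<noteq> 0 \<or> s \<noteq> 0"
proof (cases "a 0 = 0")
  case True
  then show ?thesis by (intro that[of 1 0]) (simp_all add: form_def)
next
  case False
  have "\<exists>x. poly [:a 5, 5 * a 4, 10 * a 3, 10 * a 2, 5 * a 1, a 0:] x = 0"
    by (rule fundamental_theorem_of_algebra_alt) (use False in auto)
  then show ?thesis using that[of _ 1] by (auto simp: poly_of_form)
qed

text \<open>
  If \<open>i = 0\<close> and \<open>F\<close> is written in coordinates in which one of its roots is \<open>(0, 1)\<close>, the three
  equations can be solved one after the other: either \<open>F\<close> has at least a fourfold root at \<open>(0, 1)\<close>, or the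
  other four roots coincide.
\<close>

lemma classification_i_zero:
  assumes i: "iA a = 0" "iB a = 0" "iC a = 0" and a: "a \<noteq> (\<lambda>_. 0)"
  shows "gl_equivalent a (coeffs 0 (1/5) 0 0 0 0) \<or> gl_equivalent a (coeffs 1 0 0 0 0 0)"
proof -
  obtain q s where root: "form a q s = 0" "q \<noteq> 0 \<or> s \<noteq> 0" by (rule form_root)
  obtain p r where D: "p * s - q * r \<noteq> 0"
  proof (cases "s = 0")
    case True then show ?thesis using root(2) by (intro that[of 0 1]) simp
  next
    case False then show ?thesis by (intro that[of 1 0]) simp
  qed
  define b where "b = act p q r s a"
  have eq: "gl_equivalent a b" by (rule gl_equivalent_sym, rule gl_equivalentI[OF D b_def])
  have b0: "b \<noteq> (\<lambda>_. 0)" using eq a by (auto simp: gl_equivalent_0)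
  have "b 5 = form b 0 1" by (simp add: form_def)
  then have b5: "b 5 = 0" by (simp add: b_def form_act root)
  have ib: "iA b = 0" "iB b = 0" "iC b = 0" by (simp_all add: b_def i_act i)
  show ?thesis
  proof (cases "b 4 = 0")
    case True
    then have b3: "b 3 = 0" using ib(3) b5 by (simp add: iC_def)
    with True have b2: "b 2 = 0" using ib(1) by (simp add: iA_def)
    show ?thesis
    proof (cases "b 1 = 0")
      case b1: True
      obtain k where k: "k ^ 5 = b 0" using complex_root[of 4] by auto
      have "b 0 \<noteq> 0" using b0 b1 b2 b3 True b5 by (auto simp: fun_eq_6)
      with k have "k \<noteq> 0" by auto
      have "gl_equivalent b (coeffs 1 0 0 0 0 0)"
        by (rule gl_equivalentI[of k 1 0 0]) (use \<open>k \<noteq> 0\<close> in \<open>simp_all add: fun_eq_6 act_simps k True b1 b2 b3 b5\<close>)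
      then show ?thesis using eq gl_equivalent_trans by blast
    next
      case b1: False
      have "gl_equivalent b (coeffs 0 (1/5) 0 0 0 0)"
        by (rule gl_equivalentI[of 1 "5 * b 1" 0 "b 0"]) (use b1 in \<open>simp_all add: fun_eq_6 act_simps True b2 b3 b5\<close>)
      then show ?thesis using eq gl_equivalent_trans by blast
    qed
  next
    case b4: False
    define t where "t = b 3 / b 4"
    have b3: "b 3 = t * b 4" using b4 by (simp add: t_def)
    have "b 4 * (4 * b 2) = b 4 * (3 * t^2 * b 4)" using ib(3)[unfolded iC_def b3 b5] by algebra
    then have b2': "4 * b 2 = 3 * t^2 * b 4" by (rule iffD1[OF mult_left_cancel[OF b4]])
    then have b2: "b 2 = 3 * t^2 * b 4 / 4" by (simp add: field_simps)
    have "b 4 * (2 * b 1) = b 4 * (t^3 * b 4)" using ib(2)[unfolded iB_def b3 b5] b2' by algebra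
    then have b1': "2 * b 1 = t^3 * b 4" by (rule iffD1[OF mult_left_cancel[OF b4]])
    then have b1: "b 1 = t^3 * b 4 / 2" by (simp add: field_simps)
    have "b 4 * (16 * b 0) = b 4 * (5 * t^4 * b 4)" using ib(1)[unfolded iA_def b3] b2' b1' by algebra
    then have "16 * b 0 = 5 * t^4 * b 4" by (rule iffD1[OF mult_left_cancel[OF b4]])
    then have b0: "b 0 = 5 * t^4 * b 4 / 16" by (simp add: field_simps)
    have "gl_equivalent b (coeffs 0 (1/5) 0 0 0 0)"
      by (rule gl_equivalentI[of "t/2" 0 1 "5 * b 4"])
        (use b4 in \<open>simp_all add: fun_eq_6 act_simps b0 b1 b2 b3 b5 field_simps eval_nat_numeral\<close>)
    then show ?thesis using eq gl_equivalent_trans by blast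
  qed
qed

lemma i_zero_act:
  assumes "p * s - q * r \<noteq> 0" "iA (act p q r s a) = 0" "iB (act p q r s a) = 0" "iC (act p q r s a) = 0"
  shows "iA a = 0" "iB a = 0" "iC (a :: 6 \<Rightarrow> complex) = 0"
proof -
  have "iA (act (s / (p * s - q * r)) (- q / (p * s - q * r)) (- r / (p * s - q * r)) (p / (p * s - q * r)) (act p q r s a)) = 0"
    "iB (act (s / (p * s - q * r)) (- q / (p * s - q * r)) (- r / (p * s - q * r)) (p / (p * s - q * r)) (act p q r s a)) = 0"
    "iC (act (s / (p * s - q * r)) (- q / (p * s - q * r)) (- r / (p * s - q * r)) (p / (p * s - q * r)) (act p q r s a)) = 0"
    by (simp_all only: i_act[of "s / (p * s - q * r)"] assms(2-4)) simp_all
  then show "iA a = 0" "iB a = 0" "iC a = 0" by (simp_all only: act_inverse(1)[OF assms(1)])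
qed

text \<open>
  In coordinates in which \<open>i\<close> is a multiple of \<open>x y\<close>, \<open>L = 0\<close> says that the two middle coefficients
  vanish.  The vanishing of \<open>A\<close> and \<open>C\<close> then leaves \<open>b\<^sub>0 x\<^sup>5 + b\<^sub>5 y\<^sup>5\<close> or \<open>5 x y (b\<^sub>1 x\<^sup>3 + b\<^sub>4 y\<^sup>3)\<close>, which
  are normalised by rescaling the variables.
\<close>

lemma classification_disc_nonzero:
  assumes th: "th0 a = 0" "th1 a = 0" and disc: "iB a ^ 2 - 4 * iA a * iC a \<noteq> 0"
  shows "gl_equivalent a (coeffs 1 0 0 0 0 1) \<or> gl_equivalent a (coeffs 0 (1/5) 0 0 (-1/5) 0)"
proof -
  obtain p q r s where D: "p * s - q * r \<noteq> 0" and pr: "iA a * p^2 + iB a * p * r + iC a * r^2 = 0"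
    and qs: "iA a * q^2 + iB a * q * s + iC a * s^2 = 0"
  proof (cases "iA a = 0")
    case True
    then have "iB a \<noteq> 0" using disc by auto
    with True show ?thesis by (intro that[of 1 "iB a" "- iC a" 0]) (simp_all add: power2_eq_square)
  next
    case False
    define \<delta> where "\<delta> = csqrt (iB a ^ 2 - 4 * iA a * iC a)"
    have d2: "\<delta>^2 = iB a ^ 2 - 4 * iA a * iC a" by (simp add: \<delta>_def)
    then have "\<delta> \<noteq> 0" using disc by auto
    show ?thesis
    proof (rule that[of "- iB a + \<delta>" "2 * iA a" "- iB a - \<delta>" "2 * iA a"])
      show "(- iB a + \<delta>) * (2 * iA a) - (- iB a - \<delta>) * (2 * iA a) \<noteq> 0" using False \<open>\<delta> \<noteq> 0\<close> by (simp add: algebra_simps)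
    qed (use d2 in algebra)+
  qed
  define b where "b = act p q r s a"
  have eq: "gl_equivalent a b" by (rule gl_equivalent_sym, rule gl_equivalentI[OF D b_def])
  have thb: "th0 b = 0" "th1 b = 0" by (simp_all add: b_def th_act th)
  have AC: "iA b = 0" "iC b = 0" using pr qs by (simp_all add: b_def i_act)
  have B: "iB b \<noteq> 0" using i_zero_act[OF D] AC disc by (auto simp: b_def)
  from thb B AC have b23: "b 2 = 0" "b 3 = 0" by (simp_all add: th0_def th1_def linear_covariant_def)
  have A: "b 0 * b 4 = 0" "b 1 * b 5 = 0" using AC by (simp_all add: iA_def iC_def b23)
  have B': "b 0 * b 5 - 3 * b 1 * b 4 \<noteq> 0" using B by (simp add: iB_def b23)
  show ?thesis
  proof (cases "b 0 * b 5 = 0")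
    case False
    then have b14: "b 1 = 0" "b 4 = 0" using A by auto
    obtain k where k: "k ^ 5 = b 0" using complex_root[of 4] by auto
    obtain l where l: "l ^ 5 = b 5" using complex_root[of 4] by auto
    have "k \<noteq> 0" "l \<noteq> 0" using False k l by auto
    then have "gl_equivalent b (coeffs 1 0 0 0 0 1)"
      by (intro gl_equivalentI[of k l 0 0]) (simp_all add: fun_eq_6 act_simps k l b14 b23)
    then show ?thesis using eq gl_equivalent_trans by blast
  next
    case True
    with B' have "b 1 \<noteq> 0" "b 4 \<noteq> 0" by auto
    with A have b05: "b 0 = 0" "b 5 = 0" by auto
    obtain \<rho> where \<rho>: "\<rho> ^ 3 = - b 1 / b 4" using complex_root[of 2] by auto
    have "\<rho> \<noteq> 0" using \<rho> \<open>b 1 \<noteq> 0\<close> \<open>b 4 \<noteq> 0\<close> by auto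
    obtain l where l: "l ^ 5 = 5 * b 1 / \<rho> ^ 4" using complex_root[of 4] by auto
    have "l \<noteq> 0" using l \<open>b 1 \<noteq> 0\<close> \<open>\<rho> \<noteq> 0\<close> by auto
    have 1: "\<rho>^4 * l^5 = 5 * b 1" using l \<open>\<rho> \<noteq> 0\<close> by simp
    have "\<rho> * (l^5 * \<rho>^3) = 5 * b 1" using 1 by algebra
    moreover have "\<rho>^3 * b 4 = - b 1" unfolding \<rho> using \<open>b 4 \<noteq> 0\<close> by simp
    ultimately have "b 1 * (\<rho> * l^5) = b 1 * (- 5 * b 4)" by algebra
    then have 2: "\<rho> * l^5 = - 5 * b 4" by (rule iffD1[OF mult_left_cancel[OF \<open>b 1 \<noteq> 0\<close>]])
    have "gl_equivalent b (coeffs 0 (1/5) 0 0 (-1/5) 0)"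
    proof (rule gl_equivalentI[of "\<rho> * l" l 0 0])
      show "\<rho> * l * l - 0 * 0 \<noteq> 0" using \<open>\<rho> \<noteq> 0\<close> \<open>l \<noteq> 0\<close> by simp
      have "(\<rho> * l)^4 * l = 5 * b 1" "\<rho> * l * l^4 = - 5 * b 4"
        using 1 2 by algebra+
      then show "b = act (\<rho> * l) 0 0 l (coeffs 0 (1/5) 0 0 (-1/5) 0)"
        by (simp add: fun_eq_6 act_simps b05 b23)
    qed
    then show ?thesis using eq gl_equivalent_trans by blast
  qed
qed

lemma act_triple_root: "act p 0 r s (coeffs 0 (1/5) (1/10) 0 0 0) =
    coeffs (p^4 * r + p^3 * r^2) ((s * p^4 + 2 * s * p^3 * r) / 5) (s^2 * p^3 / 10) 0 0 (0 :: complex)"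
  by (simp add: fun_eq_6 act_simps add_divide_distrib mult_ac)

lemma act_triple_double_root: "act 1 0 r s (coeffs 0 0 (1/10) 0 0 0) = coeffs (r^2) (4 * r * s / 10) (s^2 / 10) 0 0 (0 :: complex)"
  by (simp add: fun_eq_6 act_simps mult_ac)

text \<open>
  In coordinates in which \<open>i\<close> is a nonzero multiple of \<open>x\<^sup>2\<close>, \<open>L = 0\<close> says that the last two
  coefficients vanish, and \<open>C = 0\<close> that the one before vanishes as well.  So \<open>F\<close> is \<open>x\<^sup>3\<close> times a
  quadratic form, and the two cases are those of distinct and of equal roots of that form.
\<close>

lemma classification_disc_zero:
  assumes th: "th0 a = 0" "th1 a = 0" and disc: "iB a ^ 2 - 4 * iA a * iC a = 0" and ne: "\<not> (iA a = 0 \<and> iB a = 0 \<and> iC a = 0)"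
  shows "gl_equivalent a (coeffs 0 (1/5) (1/10) 0 0 0) \<or> gl_equivalent a (coeffs 0 0 (1/10) 0 0 0)"
proof -
  obtain p q r s where D: "p * s - q * r \<noteq> 0" and pr: "2 * iA a * p * q + iB a * (p * s + q * r) + 2 * iC a * r * s = 0"
    and qs: "iA a * q^2 + iB a * q * s + iC a * s^2 = 0"
  proof (cases "iA a = 0")
    case True
    then have "iB a = 0" using disc by auto
    with True show ?thesis by (intro that[of 0 0 1 1]) simp_all
  next
    case False
    show ?thesis
    proof (rule that[of 1 "2 * iA a" "- iB a" 0])
      show "1 * (2 * iA a) - (- iB a) * 0 \<noteq> 0" using False by simp
      show "iA a * (- iB a)^2 + iB a * - iB a * (2 * iA a) + iC a * (2 * iA a)^2 = 0" using disc by algebra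
    qed simp
  qed
  define b where "b = act p q r s a"
  have eq: "gl_equivalent a b" by (rule gl_equivalent_sym, rule gl_equivalentI[OF D b_def])
  have thb: "th0 b = 0" "th1 b = 0" by (simp_all add: b_def th_act th)
  have BC: "iB b = 0" "iC b = 0" using pr qs by (simp_all add: b_def i_act)
  have A: "iA b \<noteq> 0" using i_zero_act[OF D] BC ne by (auto simp: b_def)
  from thb A BC have b45: "b 4 = 0" "b 5 = 0" by (simp_all add: th0_def th1_def linear_covariant_def)
  have b3: "b 3 = 0" using BC(2) by (simp add: iC_def b45)
  have b2: "b 2 \<noteq> 0" using A by (simp add: iA_def b45 b3)
  define e where "e = csqrt (25 * b 1 ^ 2 - 40 * b 0 * b 2)"
  have e2: "e^2 = 25 * b 1 ^ 2 - 40 * b 0 * b 2" by (simp add: e_def)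
  \<comment> \<open>The quadratic cofactor is \<open>10 b\<^sub>2 (y - \<rho> x) (y - \<sigma> x)\<close>.\<close>
  define \<rho> \<sigma> where "\<rho> = (- 5 * b 1 + e) / (20 * b 2)" and "\<sigma> = (- 5 * b 1 - e) / (20 * b 2)"
  have "\<rho> + \<sigma> = - b 1 / (2 * b 2)" using b2 by (simp add: \<rho>_def \<sigma>_def field_simps)
  then have sum: "b 1 = - 2 * b 2 * (\<rho> + \<sigma>)" using b2 by (simp add: field_simps)
  have "(- 5 * b 1 + e) * (- 5 * b 1 - e) = 40 * b 0 * b 2" using e2 by algebra
  then have "\<rho> * \<sigma> = 40 * b 0 * b 2 / (20 * b 2)^2" using b2 by (simp add: \<rho>_def \<sigma>_def power2_eq_square)
  then have prod: "b 0 = 10 * b 2 * \<rho> * \<sigma>" using b2 by (simp add: field_simps power2_eq_square)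
  show ?thesis
  proof (cases "\<rho> = \<sigma>")
    case True
    obtain n where n: "n ^ 2 = 10 * b 2" using complex_root[of 1] by (auto simp: numeral_2_eq_2)
    have "n \<noteq> 0" using n b2 by auto
    have "gl_equivalent b (coeffs 0 0 (1/10) 0 0 0)"
    proof (rule gl_equivalentI[of 1 n 0 "- n * \<rho>"])
      show "1 * n - 0 * (- n * \<rho>) \<noteq> 0" using \<open>n \<noteq> 0\<close> by simp
      have "10 * (b 2 * \<rho> * \<rho>) = (n * \<rho>)^2" "10 * (- 2 * b 2 * (\<rho> + \<rho>)) = - 4 * (n * (n * \<rho>))" "10 * b 2 = n^2"
        using n by algebra+
      then show "b = act 1 0 (- n * \<rho>) n (coeffs 0 0 (1/10) 0 0 0)"
        unfolding fun_eq_6 act_triple_double_root by (simp add: b45 b3 prod sum True[symmetric] field_simps)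
    qed
    then show ?thesis using eq gl_equivalent_trans by blast
  next
    case False
    obtain n where n: "n ^ 5 = 10 * b 2 / (\<rho> - \<sigma>)^3" using complex_root[of 4] by auto
    have "n \<noteq> 0" using n b2 False by auto
    have n': "n^5 * (\<rho> - \<sigma>)^3 = 10 * b 2" using n False by simp
    have "gl_equivalent b (coeffs 0 (1/5) (1/10) 0 0 0)"
    proof (rule gl_equivalentI[of "n * (\<rho> - \<sigma>)" n 0 "- n * \<rho>"])
      show "n * (\<rho> - \<sigma>) * n - 0 * (- n * \<rho>) \<noteq> 0" using \<open>n \<noteq> 0\<close> False by simp
      have "10 * b 2 * \<rho> * \<sigma> = (n * (\<rho> - \<sigma>))^4 * (- n * \<rho>) + (n * (\<rho> - \<sigma>))^3 * (- n * \<rho>)^2"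
        "5 * (- 2 * b 2 * (\<rho> + \<sigma>)) = n * (n * (\<rho> - \<sigma>))^4 + 2 * n * (n * (\<rho> - \<sigma>))^3 * (- n * \<rho>)"
        "10 * b 2 = n^2 * (n * (\<rho> - \<sigma>))^3"
        using n' by algebra+
      note e = this
      have "b 1 = (n * (n * (\<rho> - \<sigma>))^4 + 2 * n * (n * (\<rho> - \<sigma>))^3 * (- n * \<rho>)) / 5"
        "b 2 = n^2 * (n * (\<rho> - \<sigma>))^3 / 10"
        unfolding e(2,3)[symmetric] sum by simp_all
      with trans[OF prod e(1)] show "b = act (n * (\<rho> - \<sigma>)) 0 (- n * \<rho>) n (coeffs 0 (1/5) (1/10) 0 0 0)"
        unfolding fun_eq_6 act_triple_root coeffs_simps using b3 b45 by (intro conjI)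
    qed
    then show ?thesis using eq gl_equivalent_trans by blast
  qed
qed

theorem th_zero_iff:
  "th0 a = 0 \<and> th1 a = 0 \<and> a \<noteq> (\<lambda>_. 0) \<longleftrightarrow> (\<exists>b\<in>orbit_representatives. gl_equivalent a b)"
proof
  assume a: "th0 a = 0 \<and> th1 a = 0 \<and> a \<noteq> (\<lambda>_. 0)"
  then show "\<exists>b\<in>orbit_representatives. gl_equivalent a b"
    using classification_i_zero[of a] classification_disc_nonzero[of a] classification_disc_zero[of a]
    unfolding orbit_representatives_def by blast
next
  assume "\<exists>b\<in>orbit_representatives. gl_equivalent a b"
  then obtain b where b: "b \<in> orbit_representatives" "gl_equivalent a b" by blast
  have "a \<noteq> (\<lambda>_. 0)" using th_representatives(3)[OF b(1)] gl_equivalent_sym[OF b(2)] gl_equivalent_0 by auto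
  with th_gl_equivalent[OF b(2)] th_representatives[OF b(1)] show "th0 a = 0 \<and> th1 a = 0 \<and> a \<noteq> (\<lambda>_. 0)" by blast
qed

lemma eval_binary_eq: "eval u A = eval (\<lambda>j. if j = 1 then u 1 else u 2) (A :: complex binary_poly)"
proof -
  have "u = (\<lambda>j. if j = 1 then u 1 else u (2 :: 2))" by (rule ext) (metis exhaust_2)
  then show ?thesis by metis
qed

lemma eval_quintic': "eval u (quintic a) = form a (u 1) (u 2 :: complex)"
  by (subst eval_binary_eq) (rule eval_quintic)

lemma quintic_inj: "quintic a = quintic b \<Longrightarrow> a = (b :: 6 \<Rightarrow> complex)"
  by (rule form_inj) (metis eval_quintic)

lemma SL2_act_quintic: "SL2_act g (quintic a) = quintic (act (g $ 1 $ 1) (g $ 1 $ 2) (g $ 2 $ 1) (g $ 2 $ 2) a)"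
  by (rule mpoly_eqI) (simp add: SL2_act_def eval_subst eval_quintic' form_act)

lemma quintic_scale: "Const k * quintic a = quintic (\<lambda>i. k * (a i :: complex))"
  by (rule mpoly_eqI) (simp add: eval_quintic' form_def algebra_simps)

lemma act_scale: "act (k * p) (k * q) (k * r) (k * s) a = (\<lambda>i. k^5 * (act p q r s a i :: complex))"
proof (rule form_inj)
  fix x y
  have "form (\<lambda>i. k^5 * c i) x y = form c (k * x) (k * y)" for c :: "6 \<Rightarrow> complex"
    unfolding form_def by algebra
  note this[of "act p q r s a"]
  then show "form (act (k * p) (k * q) (k * r) (k * s) a) x y = form (\<lambda>i. k^5 * act p q r s a i) x y"
    unfolding form_act by (simp only: ring_distribs mult_ac)
qed

lemma vec_eq_zero_iff: "(\<forall>i. (v :: complex^6) $ i = 0) \<longleftrightarrow> v = 0"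
  by (simp add: vec_eq_iff)

text \<open>
  The orbit of a point of projective space under the special linear group is the orbit of its
  coordinate vectors under the general linear group: a scalar \<open>k\<close> is absorbed by scaling both
  variables with a fifth root of \<open>k\<close>, a determinant by dividing by one of its square roots.
\<close>

lemma SL2_orbit_quintic:
  assumes "b \<noteq> (\<lambda>_. 0)"
  shows "v \<in> SL2_orbit (quintic b) \<longleftrightarrow> gl_equivalent (($) v) b"
proof
  assume "v \<in> SL2_orbit (quintic b)"
  then obtain g k where g: "det g = 1" "k \<noteq> 0" "quintic (($) v) = Const k * SL2_act g (quintic b)"
    by (auto simp: SL2_orbit_def proportional_def)
  obtain \<kappa> where \<kappa>: "\<kappa> ^ 5 = k" using complex_root[of 4] by auto
  have "($) v = act (\<kappa> * g $ 1 $ 1) (\<kappa> * g $ 1 $ 2) (\<kappa> * g $ 2 $ 1) (\<kappa> * g $ 2 $ 2) b"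
    by (rule quintic_inj) (simp add: g(3) SL2_act_quintic quintic_scale act_scale \<kappa>)
  moreover have "\<kappa> * g $ 1 $ 1 * (\<kappa> * g $ 2 $ 2) - \<kappa> * g $ 1 $ 2 * (\<kappa> * g $ 2 $ 1) = \<kappa>^2 * det g"
    by (simp add: det_2 algebra_simps power2_eq_square)
  moreover have "\<kappa> \<noteq> 0" using \<kappa> g(2) by auto
  ultimately show "gl_equivalent (($) v) b" using g(1) by (intro gl_equivalentI) auto
next
  assume eq: "gl_equivalent (($) v) b"
  then obtain p q r s where D: "p * s - q * r \<noteq> 0" and v: "($) v = act p q r s b" by (auto simp: gl_equivalent_def)
  define d where "d = csqrt (p * s - q * r)"
  have d2: "d * d = p * s - q * r" by (simp add: d_def flip: power2_eq_square)
  have d0: "d \<noteq> 0" using d2 D by auto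
  define g :: "complex^2^2" where "g = vector [vector [p / d, q / d], vector [r / d, s / d]]"
  have "det g = (p * s - q * r) / (d * d)" by (simp add: det_2 g_def diff_divide_distrib)
  then have g1: "det g = 1" using d2 D by simp
  have M: "g $ 1 $ 1 = p / d" "g $ 1 $ 2 = q / d" "g $ 2 $ 1 = r / d" "g $ 2 $ 2 = s / d" by (simp_all add: g_def)
  have "Const (d^5) * SL2_act g (quintic b) = quintic (act (d * (p / d)) (d * (q / d)) (d * (r / d)) (d * (s / d)) b)"
    by (simp only: SL2_act_quintic quintic_scale act_scale M)
  also have "\<dots> = quintic (($) v)" using d0 by (simp add: v)
  finally have "quintic (($) v) = Const (d^5) * SL2_act g (quintic b)" ..
  then have "proportional (quintic (($) v)) (SL2_act g (quintic b))" unfolding proportional_def using d0 by (intro exI[of _ "d^5"] conjI) simp_all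
  moreover have "v \<noteq> 0" 
  proof
    assume "v = 0"
    then have "($) v = (\<lambda>_. 0)" by (simp add: fun_eq_iff)
    with gl_equivalent_sym[OF eq] assms show False by (simp add: gl_equivalent_0)
  qed
  ultimately show "v \<in> SL2_orbit (quintic b)" using g1 by (auto simp: SL2_orbit_def)
qed

theorem calB_eq: "calB = {v. v \<noteq> 0 \<and> th0 (($) v) = 0 \<and> th1 (($) v) = 0}"
proof -
  have q: "Var 1 ^ 5 + Var 2 ^ 5 = quintic (coeffs 1 0 0 0 0 (1 :: complex))"
    "Var 1 * Var 2 * (Var 1 - Var 2) * ((Var 1)\<^sup>2 + Var 1 * Var 2 + (Var 2)\<^sup>2) = quintic (coeffs 0 (1/5) 0 0 (-1/5) (0 :: complex))"
    "Var 1 ^ 3 * Var 2 * (Var 1 + Var 2) = quintic (coeffs 0 (1/5) (1/10) 0 0 (0 :: complex))"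
    "Var 1 ^ 3 * (Var 2)\<^sup>2 = quintic (coeffs 0 0 (1/10) 0 0 (0 :: complex))"
    "Var 1 ^ 4 * Var 2 = quintic (coeffs 0 (1/5) 0 0 0 (0 :: complex))"
    "Var 1 ^ 5 = quintic (coeffs 1 0 0 0 0 (0 :: complex))"
    by (rule mpoly_eqI, simp add: eval_quintic' form_def algebra_simps eval_nat_numeral)+
  have "v \<in> calB \<longleftrightarrow> (\<exists>b\<in>orbit_representatives. gl_equivalent (($) v) b)" for v
    unfolding calB_def Let_def q(1-5) unfolding q(6) using th_representatives(3)
    by (simp add: SL2_orbit_quintic orbit_representatives_def)
  then show ?thesis
    by (auto simp: th_zero_iff[symmetric] fun_eq_iff vec_eq_zero_iff)
qed

section \<open>Radicality of the ideal of the two coefficients\<close>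

text \<open>
  Quintics whose covariant \<open>i\<close> is a multiple of \<open>x\<^sup>2 + \<Delta> y\<^sup>2\<close> and whose covariant \<open>L\<close> vanishes.  The variables
  \<open>u\<^sub>0, \<dots>, u\<^sub>3\<close> are the first four coefficients, and \<open>u\<^sub>4\<close> stands for \<open>\<Delta>\<close>.  Then \<open>L = 0\<close> determines the last
  two coefficients, as in \<open>diag_quintic\<close>, and the assumption on \<open>i\<close> becomes \<open>E1 = E2 = 0\<close>, as
  \<open>i_diag_quintic\<close> shows; \<open>EA\<close> is the coefficient of \<open>x\<^sup>2\<close> in \<open>i\<close>.  The variables \<open>u\<^sub>5\<close>, \<open>u\<^sub>6\<close> serve below as
  entries of a substitution.
\<close>

definition E1 :: "(7 \<Rightarrow> 'a) \<Rightarrow> 'a::comm_ring_1" where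
  "E1 u = u 2 * u 3 + u 4 * (3 * u 1 * u 2 - u 0 * u 3) + u 4 ^ 2 * u 0 * u 1"
definition E2 :: "(7 \<Rightarrow> 'a) \<Rightarrow> 'a::comm_ring_1" where
  "E2 u = 3 * u 3 ^ 2 + 2 * u 4 * u 1 * u 3 - u 4 ^ 2 * u 1 ^ 2 + 5 * u 4 * u 2 ^ 2 + 6 * u 4 ^ 2 * u 0 * u 2 + u 4 ^ 3 * u 0 ^ 2"
definition EA :: "(7 \<Rightarrow> 'a) \<Rightarrow> 'a::comm_ring_1" where
  "EA u = 3 * u 2 ^ 2 - 4 * u 1 * u 3 - 2 * u 4 * u 0 * u 2 - u 4 ^ 2 * u 0 ^ 2"
definition Ed :: "(7 \<Rightarrow> 'a) \<Rightarrow> 'a::comm_ring_1" where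
  "Ed u = u 2 - u 4 * u 0"
definition EQ :: "(7 \<Rightarrow> 'a) \<Rightarrow> 'a::comm_ring_1" where
  "EQ u = Ed u ^ 2 + 4 * u 4 * u 1 ^ 2"
definition diag_quintic :: "(7 \<Rightarrow> 'a) \<Rightarrow> 6 \<Rightarrow> 'a::comm_ring_1" where
  "diag_quintic u = coeffs (u 0) (u 1) (u 2) (u 3) (- 2 * u 4 * u 2 - u 4 ^ 2 * u 0) (- 2 * u 4 * u 3 - u 4 ^ 2 * u 1)"

lemma i_diag_quintic:
  "iA (diag_quintic u) = EA u" "iB (diag_quintic u) = 2 * E1 u" "iC (diag_quintic u) = E2 u + u 4 * EA u"
  by (simp_all add: iA_def iB_def iC_def diag_quintic_def E1_def E2_def EA_def algebra_simps eval_nat_numeral)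

lemma th_diag_quintic:
  assumes "E1 u = 0" "E2 u = 0" shows "th0 (diag_quintic u) = 0" "th1 (diag_quintic u) = 0"
  unfolding th0_def th1_def i_diag_quintic assms
  by (simp_all add: diag_quintic_def linear_covariant_def algebra_simps power2_eq_square)

text \<open>
  Multiplied by \<open>Ed\<close>, the variable \<open>u\<^sub>3\<close> is congruent modulo \<open>E1\<close> to a polynomial in the other variables.
  With this replacement \<open>E2\<close> factors: three distinct factors of degree \<open>1\<close> in \<open>u\<^sub>2\<close> or \<open>u\<^sub>4\<close>, and the
  factor \<open>EQ\<close>.  The latter is absorbed by \<open>EA\<close>, since modulo \<open>E1\<close> it divides \<open>EA Ed\<close>.
\<close>

lemma elimination_identities:
  fixes u :: "7 \<Rightarrow> 'a::comm_ring_1"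
  shows "Ed u * u 3 = E1 u - u 4 * u 1 * (3 * u 2 + u 4 * u 0)"
    and "Ed u ^ 2 * E2 u = u 4 * (5 * u 2 + u 4 * u 0) * (u 2 + u 4 * u 0) * EQ u
      + E1 u * (3 * E1 u - 6 * (u 4 * u 1 * (3 * u 2 + u 4 * u 0)) + 2 * u 4 * u 1 * Ed u)"
    and "EA u * Ed u = (3 * u 2 + u 4 * u 0) * EQ u - 4 * u 1 * E1 u"
  by (simp_all add: E1_def E2_def EA_def Ed_def EQ_def algebra_simps eval_nat_numeral)

lemma eval_E: "eval v (E1 h) = E1 (\<lambda>i. eval v (h i))" "eval v (E2 h) = E2 (\<lambda>i. eval v (h i))"
  "eval v (EA h) = EA (\<lambda>i. eval v (h i))" "eval v (Ed h) = Ed (\<lambda>i. eval v (h i))"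
  by (simp_all add: E1_def E2_def EA_def Ed_def)
lemma subst_E: "subst v (E1 h) = E1 (\<lambda>i. subst v (h i))" "subst v (E2 h) = E2 (\<lambda>i. subst v (h i))"
  "subst v (EA h) = EA (\<lambda>i. subst v (h i))" "subst v (Ed h) = Ed (\<lambda>i. subst v (h i))"
  by (simp_all add: E1_def E2_def EA_def Ed_def)

type_synonym P = "(7, complex) mpoly"

text \<open>
  On the hypersurface \<open>Ed = 0\<close>, that is \<open>u\<^sub>2 = u\<^sub>4 u\<^sub>0\<close>, the polynomial \<open>E1\<close> becomes a monomial, so coprimality
  with \<open>E2\<close> can be read off.
\<close>

lemma Ed_nonzerodivisor: "nonzerodivisor_mod (Ed Var) {E1 Var :: P, E2 Var}"
proof -
  have nonzero: "f \<noteq> 0" if "eval v f \<noteq> 0" for v and f :: P using that by auto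
  have free: "free_of 2 (Var 4 * Var 0 :: P)" "free_of i (0 :: P)" for i by simp_all
  have e1: "elim 2 (Var 4 * Var 0) (E1 Var) = Const 4 * ((Var 4 - 0) * ((Var 4 - 0) * ((Var 0 - 0) * (Var 1 - 0 :: P))))"
    by (rule mpoly_eqI) (simp add: subst_E eval_E E1_def algebra_simps power2_eq_square)
  have e2: "elim 2 (Var 4 * Var 0) (E2 Var) = (3 * Var 3 ^ 2 + 2 * Var 4 * Var 1 * Var 3 - Var 4 ^ 2 * Var 1 ^ 2 + 12 * Var 4 ^ 3 * Var 0 ^ 2 :: P)"
    by (rule mpoly_eqI) (simp add: subst_E eval_E E2_def algebra_simps eval_nat_numeral)
  have nd: "\<not> (Var 4 - 0) dvd elim 2 (Var 4 * Var 0) (E2 Var :: P)" "\<not> (Var 0 - 0) dvd elim 2 (Var 4 * Var 0) (E2 Var :: P)"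
    "\<not> (Var 1 - 0) dvd elim 2 (Var 4 * Var 0) (E2 Var :: P)"
    unfolding dvd_iff_elim[OF free(2)] e2 by (rule nonzero[of "\<lambda>_. 1"], simp)+
  have unit: "nonzerodivisor_mod (elim 2 (Var 4 * Var 0) (E2 Var)) {Const 4 :: P}"
    by (rule nonzerodivisor_mod_unit[of "Const (1/4)"]) (simp flip: Const_mult add: Const_1)
  have "nonzerodivisor_mod (elim 2 (Var 4 * Var 0) (E2 Var)) {elim 2 (Var 4 * Var 0) (E1 Var) :: P}"
    unfolding e1
    by (intro nonzerodivisor_mod_single_mult unit nonzerodivisor_mod_prime[OF linear_prime[OF free(2)]] nd linear_nonzero free)
      (simp add: Const_eq_0_iff)
  moreover have "elim 2 (Var 4 * Var 0) (E1 Var :: P) \<noteq> 0"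
    unfolding e1 by (rule nonzero[of "\<lambda>_. 1"]) simp
  ultimately have "nonzerodivisor_mod (Var 2 - Var 4 * Var 0) {E2 Var :: P, E1 Var}"
    by (intro linear_nonzerodivisor_mod_pair free)
  then show ?thesis by (simp only: Ed_def insert_commute)
qed

lemma free_of_power [simp]: "free_of i p \<Longrightarrow> free_of i (p ^ n)"
  by (simp add: free_of_def)

lemma eval_free_of: "free_of i p \<Longrightarrow> eval (v(i := x)) p = eval v p"
proof -
  assume "free_of i p"
  then have p: "elim i 0 p = p" by (simp add: free_of_def)
  have "eval w (elim i 0 p) = eval (w(i := 0)) p" for w
    unfolding eval_subst by (rule arg_cong[where f = "\<lambda>w. eval w p"]) auto
  from this[of "v(i := x)"] this[of v] show ?thesis by (simp add: p)
qed

lemma reduce_mod_E1: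
  fixes F :: P
  shows "\<exists>N r. free_of 3 r \<and> E1 Var dvd (Ed Var ^ N * F - r)"
proof (induction F rule: mpoly_induct)
  case (Const c)
  show ?case by (intro exI[of _ 0] exI[of _ "Const c"]) simp
next
  case (Var i)
  show ?case
  proof (cases "i = 3")
    case False
    then show ?thesis by (intro exI[of _ 0] exI[of _ "Var i"]) simp
  next
    case True
    have "Ed Var ^ 1 * Var i - (- (Var 4 * Var 1 * (3 * Var 2 + Var 4 * Var 0))) = (E1 Var :: P)"
      using elimination_identities(1)[of "Var :: 7 \<Rightarrow> P"] by (simp add: True)
    then show ?thesis by (intro exI[of _ 1] exI[of _ "- (Var 4 * Var 1 * (3 * Var 2 + Var 4 * Var 0))"]) simp
  qed
next
  case (add p q)
  then obtain N1 r1 N2 r2 where r: "free_of 3 r1" "free_of 3 r2" and dvd: "E1 Var dvd (Ed Var ^ N1 * p - r1)" "E1 Var dvd (Ed Var ^ N2 * q - r2)"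
    by blast
  have "Ed Var ^ (N1 + N2) * (p + q) - (Ed Var ^ N2 * r1 + Ed Var ^ N1 * r2)
      = Ed Var ^ N2 * (Ed Var ^ N1 * p - r1) + Ed Var ^ N1 * (Ed Var ^ N2 * q - r2)"
    by (simp add: power_add algebra_simps)
  then have "E1 Var dvd (Ed Var ^ (N1 + N2) * (p + q) - (Ed Var ^ N2 * r1 + Ed Var ^ N1 * r2))"
    using dvd by simp
  then show ?case using r
    by (intro exI[of _ "N1 + N2"] exI[of _ "Ed Var ^ N2 * r1 + Ed Var ^ N1 * r2"]) (simp add: Ed_def)
next
  case (mult p q)
  then obtain N1 r1 N2 r2 where r: "free_of 3 r1" "free_of 3 r2" and dvd: "E1 Var dvd (Ed Var ^ N1 * p - r1)" "E1 Var dvd (Ed Var ^ N2 * q - r2)"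
    by blast
  have "Ed Var ^ (N1 + N2) * (p * q) - r1 * r2
      = (Ed Var ^ N1 * p) * (Ed Var ^ N2 * q - r2) + r2 * (Ed Var ^ N1 * p - r1)"
    by (simp add: power_add algebra_simps)
  then have "E1 Var dvd (Ed Var ^ (N1 + N2) * (p * q) - r1 * r2)"
    using dvd by simp
  then show ?case using r by (intro exI[of _ "N1 + N2"] exI[of _ "r1 * r2"]) simp
qed

text \<open>
  After multiplication by a power of \<open>Ed\<close>, \<open>F\<close> is congruent modulo \<open>E1\<close> to a polynomial \<open>r\<close> without
  \<open>u\<^sub>3\<close>.  Over every zero of the squarefree product \<open>g = u\<^sub>4 (5 u\<^sub>2 + u\<^sub>4 u\<^sub>0) (u\<^sub>2 + u\<^sub>4 u\<^sub>0)\<close> with \<open>Ed \<noteq> 0\<close> lies a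
  common zero of \<open>E1\<close> and \<open>E2\<close>; so \<open>r Ed\<close> vanishes on the zeros of \<open>g\<close>, and \<open>g\<close> divides \<open>r Ed\<close>.
  The elimination identities express \<open>g EQ\<close> by \<open>E1\<close> and \<open>E2\<close>, and \<open>EA\<close> supplies the factor \<open>EQ\<close>.  Finally
  the power of \<open>Ed\<close> is cancelled.
\<close>

lemma diag_vanishing:
  fixes F :: P
  assumes F: "\<And>u. E1 u = 0 \<Longrightarrow> E2 u = 0 \<Longrightarrow> eval u F = 0"
  shows "F * EA Var \<in> ideal_generated {E1 Var, E2 Var}"
proof -
  let ?d = "Ed Var :: P"
  obtain N r where r: "free_of 3 r" and red: "E1 Var dvd (?d ^ N * F - r)" using reduce_mod_E1 by blast
  have van: "eval u (r * ?d) = 0" if u: "u 4 * (5 * u 2 + u 4 * u 0) * (u 2 + u 4 * u 0) = 0" for u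
  proof (cases "Ed u = 0")
    case True
    then show ?thesis by (simp add: eval_E)
  next
    case False
    define w where "w = u(3 := - (u 4 * u 1 * (3 * u 2 + u 4 * u 0)) / Ed u)"
    have w: "w 0 = u 0" "w 1 = u 1" "w 2 = u 2" "w 4 = u 4" "Ed w = Ed u" by (simp_all add: w_def Ed_def)
    have "Ed w * w 3 = - (u 4 * u 1 * (3 * u 2 + u 4 * u 0))" using False by (simp add: w) (simp add: w_def)
    then have e1: "E1 w = 0" using elimination_identities(1)[of w] by (simp add: w)
    have "Ed w ^ 2 * E2 w = 0" unfolding elimination_identities(2) e1 by (simp add: w u)
    then have e2: "E2 w = 0" using False by (simp add: w)
    from red obtain k where "?d ^ N * F - r = E1 Var * k" by (rule dvdE)
    then have "eval w (?d ^ N * F - r) = eval w (E1 Var * k)" by simp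
    then have "eval w r = 0" using F[OF e1 e2] by (simp add: eval_E e1)
    then show ?thesis using eval_free_of[OF r, of u] by (simp add: w_def)
  qed
  have free: "free_of 4 (0 :: P)" "free_of 2 (Const k * Var 4 * Var 0 :: P)" for k by simp_all
  have ev: "eval u (elim i h f) = eval (u(i := eval u h)) f" for u i and h f :: P
    unfolding eval_subst by (rule arg_cong[where f = "\<lambda>w. eval w f"]) auto
  have nonzero: "f \<noteq> 0" if "eval v f \<noteq> 0" for v and f :: P using that by auto
  have "elim 4 0 (r * ?d) = 0" by (rule mpoly_eqI) (simp only: ev, subst van, simp_all)
  then have "(Var 4 - 0) dvd r * ?d" by (simp only: dvd_iff_elim[OF free(1)])
  then obtain G1 where G1: "r * ?d = Var 4 * G1" by (auto elim: dvdE)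
  have "elim 2 (Const (-1/5) * Var 4 * Var 0) (r * ?d) = 0" by (rule mpoly_eqI) (simp only: ev, subst van, simp_all)
  then have "elim 2 (Const (-1/5) * Var 4 * Var 0) G1 = 0" unfolding G1 by simp
  then have "(Var 2 - Const (-1/5) * Var 4 * Var 0) dvd G1" by (simp only: dvd_iff_elim[OF free(2)])
  then obtain G2 where G2: "G1 = (Var 2 - Const (-1/5) * Var 4 * Var 0) * G2" by (rule dvdE)
  have "elim 2 (Const (-1) * Var 4 * Var 0) (r * ?d) = 0" by (rule mpoly_eqI) (simp only: ev, subst van, simp_all)
  moreover have "elim 2 (Const (-1) * Var 4 * Var 0) (Var 2 - Const (-1/5) * Var 4 * Var 0) \<noteq> (0 :: P)"
    by (rule nonzero[of "\<lambda>_. 1"]) simp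
  ultimately have "elim 2 (Const (-1) * Var 4 * Var 0) G2 = 0" unfolding G1 G2 by simp
  then have "(Var 2 - Const (-1) * Var 4 * Var 0) dvd G2" by (simp only: dvd_iff_elim[OF free(2)])
  then obtain G3 where G3: "G2 = (Var 2 - Const (-1) * Var 4 * Var 0) * G3" by (rule dvdE)
  have g3: "r * ?d = Var 4 * (5 * Var 2 + Var 4 * Var 0) * (Var 2 + Var 4 * Var 0) * (Const (1/5) * G3)"
    unfolding G1 G2 G3 by (rule mpoly_eqI) (simp add: field_simps)
  from red obtain k where k: "?d ^ N * F - r = E1 Var * k" by (rule dvdE)
  have lin: "\<exists>a b. (F * A) * d ^ (N + 2) = a * e1 + b * e2"
    if "d ^ N * F - r = e1 * k" "r * d = g * s" "d^2 * e2 = g * Q + e1 * W" "A * d = m * Q - W' * e1"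
    for A d e1 e2 g s Q W m W' :: P
  proof -
    have "(F * A) * d ^ (N + 2) = (d ^ N * F) * d * (A * d)" by (simp add: power_add power2_eq_square mult_ac)
    also have "d ^ N * F = r + e1 * k" using that(1) by (simp add: algebra_simps)
    also have "(r + e1 * k) * d = g * s + e1 * (k * d)" using that(2) by (simp add: algebra_simps)
    also have "(g * s + e1 * (k * d)) * (A * d) = (m * s) * (g * Q) + e1 * (k * d * (A * d) - g * s * W')"
      unfolding that(4) by (simp add: algebra_simps)
    also have "g * Q = d^2 * e2 - e1 * W" using that(3) by (simp add: algebra_simps)
    also have "(m * s) * (d^2 * e2 - e1 * W) + e1 * (k * d * (A * d) - g * s * W')
      = (k * d * (A * d) - g * s * W' - m * s * W) * e1 + (m * s * d^2) * e2" by (simp add: algebra_simps)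
    finally show ?thesis by blast
  qed
  have "(F * EA Var) * ?d ^ (N + 2) \<in> ideal_generated {E1 Var, E2 Var}"
    unfolding ideal_gen_pair by (rule lin[OF k g3 elimination_identities(2,3)])
  then show ?thesis by (rule nonzerodivisor_modD[OF nonzerodivisor_mod_power[OF Ed_nonzerodivisor]])
qed

context coefficient_hom begin

lemma gen_eval_scale:
  assumes "homogeneous d f"
  shows "gen_eval \<phi> (\<lambda>i. k * h i) f = k ^ d * gen_eval \<phi> h f"
  unfolding gen_eval_def sum_distrib_left
proof (intro sum.cong refl)
  fix t assume "t \<in> Poly_Mapping.keys f"
  then have "mdeg t = d" using assms by (simp add: homogeneous_def)
  then have "(\<Prod>i\<in>UNIV. k ^ Poly_Mapping.lookup t i) = k ^ d" by (simp flip: power_sum)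
  then show "\<phi> (Poly_Mapping.lookup f t) * (\<Prod>i\<in>UNIV. (k * h i) ^ Poly_Mapping.lookup t i) =
    k ^ d * (\<phi> (Poly_Mapping.lookup f t) * (\<Prod>i\<in>UNIV. h i ^ Poly_Mapping.lookup t i))"
    by (simp add: power_mult_distrib prod.distrib mult_ac)
qed

end

lemma eval_scale: "homogeneous d f \<Longrightarrow> eval (\<lambda>i. k * v i) f = k ^ d * eval v f"
  unfolding eval_gen by (rule id_hom.gen_eval_scale)
lemma subst_scale: "homogeneous d f \<Longrightarrow> subst (\<lambda>i. k * h i) f = k ^ d * subst h f"
  unfolding subst_gen by (rule Const_hom.gen_eval_scale)

lemma subst_cong_mod:
  assumes "\<And>i. h i - h' i \<in> ideal_generated G"
  shows "subst h f - subst h' f \<in> ideal_generated G"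
proof (induction f rule: mpoly_induct)
  case (add p q)
  have "subst h (p + q) - subst h' (p + q) = (subst h p - subst h' p) + (subst h q - subst h' q)" by simp
  then show ?case using add by (simp only: ideal_gen_add)
next
  case (mult p q)
  have "subst h (p * q) - subst h' (p * q) = subst h p * (subst h q - subst h' q) + subst h' q * (subst h p - subst h' p)"
    by (simp add: algebra_simps)
  then show ?case using mult by (simp only: ideal_gen_add ideal_gen_mult)
qed (simp_all add: assms ideal_gen_0)

lemma act_cong_mod:
  assumes "\<And>i. h i - h' i \<in> ideal_generated G"
  shows "act p q r s h j - act p q r s h' j \<in> ideal_generated G"
proof -
  have "act p q r s h j - act p q r s h' j = act p q r s (\<lambda>i. h i - h' i) j"
    by (simp add: act_def algebra_simps)
  moreover have "act p q r s (\<lambda>i. h i - h' i) j \<in> ideal_generated G"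
    unfolding act_def by (simp only: split: if_split) (intro conjI impI ideal_gen_add ideal_gen_mult assms)
  ultimately show ?thesis by simp
qed

text \<open>
  Completing the square in \<open>i\<close> without denominators: \<open>x \<mapsto> x - B y\<close>, \<open>y \<mapsto> 2 A y\<close> turns \<open>i\<close> into
  \<open>16 A\<^sup>5 (x\<^sup>2 + \<Delta> y\<^sup>2)\<close>.  The adjugate substitution recovers the quintic up to a power of \<open>2 A\<close>.
\<close>

lemma diagonalise:
  fixes a :: "6 \<Rightarrow> complex"
  defines "b \<equiv> act 1 (- iB a) 0 (2 * iA a) a" and "\<Delta> \<equiv> 4 * iA a * iC a - iB a ^ 2"
  shows "b 4 + 2 * \<Delta> * b 2 + \<Delta> ^ 2 * b 0 = 16 * iA a ^ 2 * th0 a"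
    and "b 5 + 2 * \<Delta> * b 3 + \<Delta> ^ 2 * b 1 = 16 * iA a ^ 2 * (2 * iA a * th1 a - iB a * th0 a)"
    and "iA b = 16 * iA a ^ 5" "iB b = 0" "iC b = \<Delta> * iA b"
    and "act (2 * iA a) (iB a) 0 1 b = (\<lambda>i. (2 * iA a) ^ 5 * a i)"
proof -
  show "b 4 + 2 * \<Delta> * b 2 + \<Delta> ^ 2 * b 0 = 16 * iA a ^ 2 * th0 a"
    "b 5 + 2 * \<Delta> * b 3 + \<Delta> ^ 2 * b 1 = 16 * iA a ^ 2 * (2 * iA a * th1 a - iB a * th0 a)"
    unfolding b_def \<Delta>_def act_simps th0_def th1_def linear_covariant_def
    by (simp only: power_one mult_1_left mult_1_right mult_zero_left mult_zero_right add_0_left add_0_right power_zero_numeral, algebra)+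
  show "iA b = 16 * iA a ^ 5" "iB b = 0" "iC b = \<Delta> * iA b"
    unfolding b_def \<Delta>_def i_act
    by (simp only: power_one mult_1_left mult_1_right mult_zero_left mult_zero_right add_0_left add_0_right power_zero_numeral, algebra)+
  have "act (2 * iA a) (iB a) 0 1 b = act (2 * iA a * 1) (2 * iA a * 0) (2 * iA a * 0) (2 * iA a * 1) a"
    unfolding b_def act_act by simp
  then show "act (2 * iA a) (iB a) 0 1 b = (\<lambda>i. (2 * iA a) ^ 5 * a i)" by (simp only: act_scale act_id)
qed

lemma vec_nth_lambda: "($) (vec_lambda a) = a"
  by (rule ext) simp

lemma calB_nonempty: "calB \<noteq> {}"
proof -
  have "vec_lambda (coeffs 1 0 0 0 0 0) \<in> calB"
    using th_representatives[of "coeffs 1 0 0 0 0 0"]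
    by (auto simp: calB_eq orbit_representatives_def vec_eq_iff fun_eq_iff vec_nth_lambda)
  then show ?thesis by blast
qed

text \<open>
  Let \<open>f\<close> vanish on the common zeros of \<open>th0\<close> and \<open>th1\<close>, and let \<open>b\<close> be the generic quintic after
  completing the square.  Modulo \<open>(th0, th1)\<close>, \<open>b\<close> is the diagonal quintic with parameters \<open>g\<close>, and
  \<open>E1\<close>, \<open>E2\<close> vanish at \<open>g\<close>; so the relation from \<open>diag_vanishing\<close>, applied to \<open>f\<close> after the
  substitution that undoes the completion of the square, specialises to a multiple of \<open>f\<close> by a power of
  \<open>iA\<close> in the ideal.  As \<open>iA\<close> is a nonzerodivisor modulo the ideal, it can be cancelled.
\<close>

lemma radical:
  fixes f :: R
  assumes hom: "homogeneous d f" and van: "\<And>v. v \<in> calB \<Longrightarrow> eval (($) v) f = 0"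
  shows "f \<in> ideal_generated {th0 Var, th1 Var}"
proof -
  let ?I = "ideal_generated {th0 Var, th1 Var :: R}"
  have zero: "eval a f = 0" if "th0 a = 0" "th1 a = 0" for a
  proof (cases "a = (\<lambda>_. 0)")
    case False
    then have "vec_lambda a \<in> calB" using that by (auto simp: calB_eq vec_nth_lambda vec_eq_iff fun_eq_iff)
    from van[OF this] show ?thesis by (simp add: vec_nth_lambda)
  next
    case True
    \<comment> \<open>The zero vector represents no point; there a homogeneous \<open>f\<close> vanishes because it vanishes on a cone that is nonempty.\<close>
    obtain v where "v \<in> calB" using calB_nonempty by blast
    then show ?thesis using eval_scale[OF hom, of 0 "($) v"] van by (simp add: True)
  qed
  define F :: P where "F = subst (act (Var 5) (Var 6) 0 1 (diag_quintic Var)) f"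
  have "F * EA Var \<in> ideal_generated {E1 Var, E2 Var}"
  proof (rule diag_vanishing)
    fix u :: "7 \<Rightarrow> complex" assume u: "E1 u = 0" "E2 u = 0"
    have "(\<lambda>i. eval u (diag_quintic Var i)) = diag_quintic u" by (simp add: fun_eq_6 diag_quintic_def)
    then have "eval u F = eval (act (u 5) (u 6) 0 1 (diag_quintic u)) f"
      unfolding F_def eval_subst eval_act by simp
    also have "\<dots> = 0" by (rule zero) (simp_all add: th_act th_diag_quintic[OF u])
    finally show "eval u F = 0" .
  qed
  then obtain x y where xy: "F * EA Var = x * E1 Var + y * E2 Var" unfolding ideal_gen_pair by blast
  define b :: "6 \<Rightarrow> R" where "b = act 1 (- iB Var) 0 (2 * iA Var) Var"
  define \<Delta> :: R where "\<Delta> = 4 * iA Var * iC Var - iB Var ^ 2"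
  define g :: "7 \<Rightarrow> R" where "g = (\<lambda>i. if i = 4 then \<Delta> else if i = 5 then 2 * iA Var else if i = 6 then iB Var
    else if i = 0 then b 0 else if i = 1 then b 1 else if i = 2 then b 2 else b 3)"
  have evb: "(\<lambda>i. eval v (b i)) = act 1 (- iB v) 0 (2 * iA v) v" for v
    by (simp add: b_def eval_act eval_covariants)
  have evb': "eval v (b i) = act 1 (- iB v) 0 (2 * iA v) v i" for v i
    using fun_cong[OF evb] .
  have b4: "b 4 + 2 * \<Delta> * b 2 + \<Delta> ^ 2 * b 0 = 16 * iA Var ^ 2 * th0 Var"
    by (rule mpoly_eqI) (simp only: eval_simps eval_simps2 eval_simps3 \<Delta>_def eval_covariants evb' diagonalise)
  have b5: "b 5 + 2 * \<Delta> * b 3 + \<Delta> ^ 2 * b 1 = 16 * iA Var ^ 2 * (2 * iA Var * th1 Var - iB Var * th0 Var)"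
    by (rule mpoly_eqI) (simp only: eval_simps eval_simps2 eval_simps3 \<Delta>_def eval_covariants evb' diagonalise)
  have ib: "iA b = 16 * iA Var ^ 5" "iB b = 0" "iC b = \<Delta> * iA b"
    by (rule mpoly_eqI, simp only: eval_simps eval_simps2 eval_simps3 \<Delta>_def eval_covariants evb diagonalise)+
  have recover: "act (2 * iA Var) (iB Var) 0 1 b j = (2 * iA Var) ^ 5 * Var j" for j
    by (rule mpoly_eqI) (simp only: eval_simps eval_simps2 eval_simps3 eval_act eval_covariants evb diagonalise)
  have thI: "th0 Var \<in> ?I" "th1 Var \<in> ?I" by (intro ideal_gen_base; simp)+
  have I4: "b 4 + 2 * \<Delta> * b 2 + \<Delta> ^ 2 * b 0 \<in> ?I" unfolding b4 by (intro ideal_gen_mult thI)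
  have I5: "b 5 + 2 * \<Delta> * b 3 + \<Delta> ^ 2 * b 1 \<in> ?I" unfolding b5 by (intro ideal_gen_mult ideal_gen_diff thI)
  have diag: "diag_quintic g = coeffs (b 0) (b 1) (b 2) (b 3) (- 2 * \<Delta> * b 2 - \<Delta> ^ 2 * b 0) (- 2 * \<Delta> * b 3 - \<Delta> ^ 2 * b 1)"
    by (simp add: diag_quintic_def g_def)
  have cong: "b i - diag_quintic g i \<in> ?I" for i
  proof -
    have "\<forall>i. b i - diag_quintic g i \<in> ?I"
      unfolding all_6 diag using I4 I5 by (simp add: ideal_gen_0 algebra_simps)
    then show ?thesis by blast
  qed
  have half: "z \<in> ?I" if "2 * z \<in> ?I" for z
    using ideal_gen_mult[OF that, of "Const (1/2)"] by (simp add: mult.assoc[symmetric] Const_1 flip: Const_numeral Const_mult)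
  have d: "x - (x - y) \<in> ?I" if "y \<in> ?I" for x y :: R using that by simp
  have "2 * E1 g = iB b - (b 0 * (b 5 - diag_quintic g 5) - 3 * b 1 * (b 4 - diag_quintic g 4))"
    unfolding i_diag_quintic(2)[symmetric] by (simp add: iB_def diag algebra_simps)
  also have "\<dots> \<in> ?I" unfolding ib by (rule ideal_gen_diff[OF ideal_gen_0 ideal_gen_diff[OF ideal_gen_mult[OF cong] ideal_gen_mult[OF cong]]])
  finally have e1: "E1 g \<in> ?I" by (rule half)
  have g4: "g 4 = \<Delta>" by (simp add: g_def)
  have "E2 g = iC (diag_quintic g) - \<Delta> * iA (diag_quintic g)" unfolding i_diag_quintic g4 by simp
  also have "\<dots> = (iC b - \<Delta> * iA b) - (b 1 * (b 5 - diag_quintic g 5) - 4 * b 2 * (b 4 - diag_quintic g 4) - \<Delta> * b 0 * (b 4 - diag_quintic g 4))"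
    by (simp add: iA_def iC_def diag algebra_simps)
  also have "\<dots> \<in> ?I" unfolding ib(3) diff_self
    by (rule ideal_gen_diff[OF ideal_gen_0 ideal_gen_diff[OF ideal_gen_diff[OF ideal_gen_mult[OF cong] ideal_gen_mult[OF cong]] ideal_gen_mult[OF cong]]])
  finally have e2: "E2 g \<in> ?I" .
  have ea: "EA g = 16 * iA Var ^ 5 - b 0 * (b 4 - diag_quintic g 4)"
    unfolding i_diag_quintic(1)[symmetric] ib(1)[symmetric] by (simp add: iA_def diag algebra_simps)
  have "subst g F * EA g = subst g x * E1 g + subst g y * E2 g"
    using arg_cong[OF xy, of "subst g"] by (simp add: subst_E)
  also have "\<dots> \<in> ?I" by (intro ideal_gen_add ideal_gen_mult e1 e2)
  finally have prod: "subst g F * EA g \<in> ?I" .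
  have "(\<lambda>i. subst g (diag_quintic Var i)) = diag_quintic g" by (simp add: fun_eq_6 diag_quintic_def)
  then have sF: "subst g F = subst (act (2 * iA Var) (iB Var) 0 1 (diag_quintic g)) f"
    unfolding F_def subst_subst subst_act by (simp add: g_def)
  have "subst (act (2 * iA Var) (iB Var) 0 1 b) f - subst g F \<in> ?I"
    unfolding sF by (intro subst_cong_mod act_cong_mod cong)
  also have "subst (act (2 * iA Var) (iB Var) 0 1 b) f = ((2 * iA Var) ^ 5) ^ d * f"
    unfolding recover using subst_scale[OF hom, of "(2 * iA Var) ^ 5" Var] by (simp add: fun_eq_iff recover)
  finally have diff: "((2 * iA Var) ^ 5) ^ d * f - subst g F \<in> ?I" .
  have split: "(K * f) * M = (K * f - s) * M + (s * (M - z) + s * z)" for K M s z :: R by (simp add: algebra_simps)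
  have scaled: "(((2 * iA Var) ^ 5) ^ d * f) * (16 * iA Var ^ 5) \<in> ?I"
    by (subst split[of _ _ "subst g F" "b 0 * (b 4 - diag_quintic g 4)"], fold ea)
      (intro ideal_gen_add ideal_gen_mult2[OF diff] prod ideal_gen_mult cong)
  have two: "32 ^ d = (2 :: R) ^ (d * 5)" by (simp add: mult.commute[of d] power_mult)
  have "(((2 * iA Var) ^ 5) ^ d * f) * (16 * iA Var ^ 5) = Const (2 ^ (5 * d) * 16) * (f * (iA Var ^ (5 * d) * iA Var ^ 5))"
    using two by (simp add: power_mult_distrib mult_ac Const_mult Const_power Const_numeral flip: power_mult)
  with scaled have "Const (inverse (2 ^ (5 * d) * 16)) * (Const (2 ^ (5 * d) * 16) * (f * (iA Var ^ (5 * d) * iA Var ^ 5))) \<in> ?I"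
    by (simp only: ideal_gen_mult)
  then have "f * (iA Var ^ (5 * d) * iA Var ^ 5) \<in> ?I"
    by (simp add: mult.assoc[symmetric] Const_1 flip: Const_mult)
  then show ?thesis
    by (rule nonzerodivisor_modD[OF nonzerodivisor_mod_mult[OF nonzerodivisor_mod_power nonzerodivisor_mod_power, OF th_regular(2) th_regular(2)]])
qed

theorem vanishing_ideal_calB: "vanishing_ideal calB = ideal_generated {th0 Var, th1 Var}"
proof
  show "vanishing_ideal calB \<subseteq> ideal_generated {th0 Var, th1 Var}"
    unfolding vanishing_ideal_def by (rule ideal_gen_subset) (auto intro: radical)
  have "th0 Var \<in> vanishing_ideal calB" "th1 Var \<in> vanishing_ideal calB"
    unfolding vanishing_ideal_def
    by (intro ideal_gen_base CollectI conjI exI[of _ 5] homogeneous_th homogeneous_Var ballI; simp add: eval_covariants vec_nth_lambda calB_eq)+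
  then show "ideal_generated {th0 Var, th1 Var} \<subseteq> vanishing_ideal calB"
    unfolding vanishing_ideal_def by (intro ideal_gen_subset) auto
qed

section \<open>Quintics in involution\<close>

abbreviation linear_form :: "complex \<Rightarrow> complex \<Rightarrow> complex binary_poly" where
  "linear_form p q \<equiv> Const p * Var 1 + Const q * Var 2"

lemma homogeneous_linear_form: "linear_form p q \<in> S 1"
  using homogeneous_mult[OF homogeneous_Const[of p] homogeneous_Var[of "1 :: 2"]]
    homogeneous_mult[OF homogeneous_Const[of q] homogeneous_Var[of "2 :: 2"]]
  unfolding S_def by (intro CollectI homogeneous_add) simp_all

lemma S_1_obtain:
  assumes "l \<in> S 1" obtains p q where "l = linear_form p q"
proof
  let ?e = "\<lambda>i :: 2. Poly_Mapping.single i (1 :: nat)"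
  show "l = linear_form (Poly_Mapping.lookup l (?e 1)) (Poly_Mapping.lookup l (?e 2))"
  proof (rule poly_mapping_eqI)
    fix t
    have ne: "?e 1 \<noteq> ?e 2" by (metis lookup_single_eq lookup_single_not_eq zero_neq_one exhaust_2 one_neq_zero zero_neq_one)
    have *: "Const c * Var i = Poly_Mapping.single (?e i) c" for c :: complex and i
      by (simp add: Const_def Var_def mult_single)
    show "Poly_Mapping.lookup l t = Poly_Mapping.lookup (linear_form (Poly_Mapping.lookup l (?e 1)) (Poly_Mapping.lookup l (?e 2))) t"
    proof (cases "Poly_Mapping.lookup l t = 0")
      case False
      then have "(\<Sum>i\<in>UNIV. Poly_Mapping.lookup t i) = 1"
        using assms by (simp add: S_def homogeneous_def in_keys_iff)
      then have "Poly_Mapping.lookup t 1 + Poly_Mapping.lookup t 2 = 1" by (simp add: UNIV_2)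
      then consider "Poly_Mapping.lookup t 1 = 1" "Poly_Mapping.lookup t 2 = 0" | "Poly_Mapping.lookup t 1 = 0" "Poly_Mapping.lookup t 2 = 1"
        by linarith
      then have "t = ?e 1 \<or> t = ?e 2"
      proof cases
        case 1
        then have "t = ?e 1" by (intro poly_mapping_eqI) (metis exhaust_2 lookup_single_eq lookup_single_not_eq zero_neq_one)
        then show ?thesis ..
      next
        case 2
        then have "t = ?e 2" by (intro poly_mapping_eqI) (metis exhaust_2 lookup_single_eq lookup_single_not_eq zero_neq_one)
        then show ?thesis ..
      qed
      then show ?thesis unfolding * using ne by (auto simp: lookup_add lookup_single when_def)
    next
      case True
      then show ?thesis unfolding * by (auto simp: lookup_add lookup_single when_def)
    qed
  qed
qed

lemma linear_coordinates:
  assumes "p * s - q * r \<noteq> (0 :: complex)"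
  obtains u :: "2 \<Rightarrow> complex" where "eval u (linear_form p q) = x" "eval u (linear_form r s) = y"
proof
  define D where "D = p * s - q * r"
  have D: "D \<noteq> 0" using assms by (simp add: D_def)
  let ?u = "\<lambda>j :: 2. if j = 1 then (s * x - q * y) / D else (p * y - r * x) / D"
  have "p * (s * x - q * y) + q * (p * y - r * x) = D * x" "r * (s * x - q * y) + s * (p * y - r * x) = D * y"
    unfolding D_def by algebra+
  then show "eval ?u (linear_form p q) = x" "eval ?u (linear_form r s) = y"
    using D by (simp_all add: field_simps)
qed

lemma quadric_coefficients:
  assumes D: "p * s - q * r \<noteq> (0 :: complex)"
    and "\<And>u. X * (eval u (linear_form p q))^2 + Y * eval u (linear_form p q) * eval u (linear_form r s) + Z * (eval u (linear_form r s))^2 = 0"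
  shows "X = 0" "Y = 0" "Z = 0"
proof -
  have *: "X * x^2 + Y * x * y + Z * y^2 = 0" for x y
  proof -
    obtain u where u: "eval u (linear_form p q) = x" "eval u (linear_form r s) = y" by (rule linear_coordinates[OF D])
    show ?thesis using assms(2)[of u] unfolding u .
  qed
  show "X = 0" "Z = 0" using *[of 1 0] *[of 0 1] by simp_all
  then show "Y = 0" using *[of 1 1] by simp
qed

lemma quadratic_relation_trivial:
  assumes D: "p * s - q * r \<noteq> 0" and "Const X * (linear_form p q)\<^sup>2 + Const Y * (linear_form p q * linear_form r s) + Const Z * (linear_form r s)\<^sup>2 = 0"
  shows "X = 0" "Y = 0" "Z = 0"
proof -
  have "X * (eval u (linear_form p q))^2 + Y * eval u (linear_form p q) * eval u (linear_form r s) + Z * (eval u (linear_form r s))^2 = 0" for u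
    using arg_cong[OF assms(2), of "eval u"] by (simp add: mult.assoc)
  from quadric_coefficients[OF D this] show "X = 0" "Y = 0" "Z = 0" by blast+
qed

lemma in_basis:
  assumes D: "p * s - q * r \<noteq> (0 :: complex)"
  obtains \<alpha> \<beta> where "linear_form e f = Const \<alpha> * linear_form p q + Const \<beta> * linear_form r s"
proof
  define D where "D = p * s - q * r"
  have D: "D \<noteq> 0" using assms by (simp add: D_def)
  have "(e * s - f * r) * p + (f * p - e * q) * r = D * e" "(e * s - f * r) * q + (f * p - e * q) * s = D * f"
    unfolding D_def by algebra+
  then have *: "(e * s - f * r) / D * p + (f * p - e * q) / D * r = e" "(e * s - f * r) / D * q + (f * p - e * q) / D * s = f"
    using D by (simp_all add: field_simps)
  show "linear_form e f = Const ((e * s - f * r) / D) * linear_form p q + Const ((f * p - e * q) / D) * linear_form r s"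
  proof (rule mpoly_eqI)
    fix v :: "2 \<Rightarrow> complex"
    have "e * v 1 + f * v 2 = ((e * s - f * r) / D * p + (f * p - e * q) / D * r) * v 1 + ((e * s - f * r) / D * q + (f * p - e * q) / D * s) * v 2"
      unfolding * ..
    then show "eval v (linear_form e f) = eval v (Const ((e * s - f * r) / D) * linear_form p q + Const ((f * p - e * q) / D) * linear_form r s)"
      by (simp add: algebra_simps)
  qed
qed

lemma linear_form_eq_0: "linear_form p q = 0 \<longleftrightarrow> p = 0 \<and> q = 0"
proof
  assume l: "linear_form p q = 0"
  have "p * u 1 + q * u 2 = 0" for u :: "2 \<Rightarrow> complex" using arg_cong[OF l, of "eval u"] by simp
  from this[of "\<lambda>j. if j = 1 then 1 else 0"] this[of "\<lambda>j. if j = 1 then 0 else 1"] show "p = 0 \<and> q = 0" by simp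
qed (simp add: Const_0)

text \<open>
  Two independent elements of a line span it, by Cramer's rule.
\<close>

lemma line_combination:
  assumes L: "line L" and xyz: "x \<in> L" "y \<in> L" "z \<in> L"
    and indep: "\<And>\<sigma> \<tau>. Const \<sigma> * x + Const \<tau> * y = 0 \<Longrightarrow> \<sigma> = 0 \<and> \<tau> = 0"
  obtains \<sigma> \<tau> where "z = Const \<sigma> * x + Const \<tau> * y"
proof -
  obtain A B where AB: "L = {Const s * A + Const t * B | s t. True}" using L by (auto simp: line_def)
  from xyz obtain s1 t1 s2 t2 s3 t3 where
    x: "x = Const s1 * A + Const t1 * B" and y: "y = Const s2 * A + Const t2 * B" and z: "z = Const s3 * A + Const t3 * B"
    unfolding AB by blast
  define d where "d = s1 * t2 - s2 * t1"
  have "d \<noteq> 0"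
  proof
    assume "d = 0"
    have "Const t2 * x + Const (- t1) * y = Const d * A" "Const s2 * x + Const (- s1) * y = Const (- d) * B"
      unfolding x y d_def by (simp_all add: Const_diff Const_mult Const_minus algebra_simps)
    with \<open>d = 0\<close> have "t2 = 0 \<and> - t1 = 0" "s2 = 0 \<and> - s1 = 0"
      by (intro indep; simp add: Const_0)+
    then have "x = 0" by (simp add: x Const_0)
    then have "Const 1 * x + Const 0 * y = 0" by (simp add: Const_0)
    then show False using indep by fastforce
  qed
  define k1 k2 where "k1 = s3 * t2 - s2 * t3" and "k2 = s1 * t3 - s3 * t1"
  have "Const d * z = Const k1 * x + Const k2 * y"
    unfolding x y z d_def k1_def k2_def by (simp add: Const_diff Const_mult algebra_simps)
  then have "Const (1 / d) * (Const d * z) = Const (1 / d) * (Const k1 * x + Const k2 * y)" by simp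
  moreover have "Const (1 / d) * (Const d * z) = z"
    using \<open>d \<noteq> 0\<close> by (simp add: mult.assoc[symmetric] Const_1 flip: Const_mult)
  ultimately have "z = Const (1 / d * k1) * x + Const (1 / d * k2) * y"
    by (simp only: Const_mult ring_distribs mult.assoc)
  then show ?thesis by (rule that)
qed

lemma line_closed: assumes "line L" "x \<in> L" "y \<in> L" shows "Const \<sigma> * x + Const \<tau> * y \<in> L"
proof -
  obtain A B where AB: "L = {Const s * A + Const t * B | s t. True}" using assms(1) by (auto simp: line_def)
  from assms obtain s1 t1 s2 t2 where
    x: "x = Const s1 * A + Const t1 * B" and y: "y = Const s2 * A + Const t2 * B"
    unfolding AB by blast
  have "Const \<sigma> * x + Const \<tau> * y = Const (\<sigma> * s1 + \<tau> * s2) * A + Const (\<sigma> * t1 + \<tau> * t2) * B"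
    unfolding x y by (simp add: Const_add Const_mult algebra_simps)
  then show ?thesis unfolding AB by blast
qed

text \<open>
  Let \<open>a = \<alpha> c + \<beta> m\<close> and \<open>b = \<gamma> c + \<delta> m\<close>.  If the line contains \<open>a\<^sup>2\<close>, \<open>b\<^sup>2\<close> and \<open>c m\<close>, these are dependent,
  which means \<open>\<alpha> \<delta> + \<beta> \<gamma> = 0\<close> unless \<open>a\<close> and \<open>b\<close> are proportional; so \<open>a b\<close> has no term in \<open>c m\<close>.  In other
  words, the chords through \<open>c m\<close> join the pairs of points that are exchanged by \<open>m \<mapsto> - m\<close>.
\<close>

lemma chord:
  assumes D: "p * s - q * r \<noteq> 0" and c: "c = linear_form p q" and m: "m = linear_form r s"
    and L: "line L" "c * m \<in> L" and ab: "a \<in> S 1 - {0}" "b \<in> S 1 - {0}" "meets_conic_in L a b"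
  obtains u w where "a * b = Const u * c\<^sup>2 + Const w * m\<^sup>2"
proof -
  obtain a1 a2 b1 b2 where "a = linear_form a1 a2" "b = linear_form b1 b2" using ab by (metis DiffD1 S_1_obtain)
  then obtain \<alpha> \<beta> \<gamma> \<delta> where a: "a = Const \<alpha> * c + Const \<beta> * m" and b: "b = Const \<gamma> * c + Const \<delta> * m"
    unfolding c m using in_basis[OF D] by metis
  have quad0: "X = 0 \<and> Y = 0 \<and> Z = 0" if "Const X * c\<^sup>2 + Const Y * (c * m) + Const Z * m\<^sup>2 = 0" for X Y Z
    using quadratic_relation_trivial[OF D that[unfolded c m]] by blast
  have a2: "a\<^sup>2 = Const (\<alpha>^2) * c\<^sup>2 + Const (2 * \<alpha> * \<beta>) * (c * m) + Const (\<beta>^2) * m\<^sup>2"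
    unfolding a by (simp add: Const_mult Const_power Const_numeral power2_eq_square algebra_simps)
  have b2: "b\<^sup>2 = Const (\<gamma>^2) * c\<^sup>2 + Const (2 * \<gamma> * \<delta>) * (c * m) + Const (\<delta>^2) * m\<^sup>2"
    unfolding b by (simp add: Const_mult Const_power Const_numeral power2_eq_square algebra_simps)
  have prop_refl: "proportional x x" for x unfolding proportional_def by (intro exI[of _ 1]) (simp add: Const_1)
  have "a\<^sup>2 \<in> L" "b\<^sup>2 \<in> L" using ab(3) prop_refl unfolding meets_conic_in_def by blast+
  have zero: "\<alpha> * \<delta> + \<beta> * \<gamma> = 0"
  proof (rule ccontr)
    assume nz: "\<alpha> * \<delta> + \<beta> * \<gamma> \<noteq> 0"
    show False
    proof (cases "\<alpha> * \<delta> - \<beta> * \<gamma> = 0")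
      case False
      have indep: "\<sigma> = 0 \<and> \<tau> = 0" if "Const \<sigma> * a\<^sup>2 + Const \<tau> * b\<^sup>2 = 0" for \<sigma> \<tau>
      proof -
        have "Const (\<sigma> * \<alpha>^2 + \<tau> * \<gamma>^2) * c\<^sup>2 + Const (2 * (\<sigma> * \<alpha> * \<beta> + \<tau> * \<gamma> * \<delta>)) * (c * m) + Const (\<sigma> * \<beta>^2 + \<tau> * \<delta>^2) * m\<^sup>2 = 0"
          using that unfolding a2 b2 by (simp add: Const_add Const_mult Const_numeral algebra_simps)
        from quad0[OF this] have "\<sigma> * \<alpha>^2 + \<tau> * \<gamma>^2 = 0" "\<sigma> * \<beta>^2 + \<tau> * \<delta>^2 = 0" by blast+
        then have "\<sigma> * ((\<alpha> * \<delta> - \<beta> * \<gamma>) * (\<alpha> * \<delta> + \<beta> * \<gamma>)) = 0" "\<tau> * ((\<alpha> * \<delta> - \<beta> * \<gamma>) * (\<alpha> * \<delta> + \<beta> * \<gamma>)) = 0"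
          by algebra+
        with False nz show ?thesis by simp
      qed
      obtain \<sigma> \<tau> where z: "c * m = Const \<sigma> * a\<^sup>2 + Const \<tau> * b\<^sup>2"
        by (rule line_combination[OF L(1) \<open>a\<^sup>2 \<in> L\<close> \<open>b\<^sup>2 \<in> L\<close> L(2)]) (use indep in blast)
      have "Const (\<sigma> * \<alpha>^2 + \<tau> * \<gamma>^2) * c\<^sup>2 + Const (2 * (\<sigma> * \<alpha> * \<beta> + \<tau> * \<gamma> * \<delta>) - 1) * (c * m) + Const (\<sigma> * \<beta>^2 + \<tau> * \<delta>^2) * m\<^sup>2
        = (Const \<sigma> * a\<^sup>2 + Const \<tau> * b\<^sup>2) - c * m"
        unfolding a2 b2 by (simp add: Const_add Const_diff Const_mult Const_numeral Const_1 algebra_simps)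
      also have "\<dots> = 0" using z by simp
      finally have "\<sigma> * \<alpha>^2 + \<tau> * \<gamma>^2 = 0" "\<sigma> * \<beta>^2 + \<tau> * \<delta>^2 = 0" "2 * (\<sigma> * \<alpha> * \<beta> + \<tau> * \<gamma> * \<delta>) - 1 = 0" using quad0 by blast+
      then have "\<sigma> * ((\<alpha> * \<delta> - \<beta> * \<gamma>) * (\<alpha> * \<delta> + \<beta> * \<gamma>)) = 0" "\<tau> * ((\<alpha> * \<delta> - \<beta> * \<gamma>) * (\<alpha> * \<delta> + \<beta> * \<gamma>)) = 0"
        by algebra+
      with False nz have "\<sigma> = 0" "\<tau> = 0" by simp_all
      with \<open>2 * (\<sigma> * \<alpha> * \<beta> + \<tau> * \<gamma> * \<delta>) - 1 = 0\<close> show False by simp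
    next
      case True
      then have ab0: "\<alpha> \<noteq> 0" "\<beta> \<noteq> 0" "\<gamma> \<noteq> 0" "\<delta> \<noteq> 0" using nz by auto
      \<comment> \<open>If \<open>a\<close> and \<open>b\<close> are proportional, but not to \<open>c\<close> or \<open>m\<close>, the line also contains the square of the mirror image of \<open>a\<close> and so meets the conic in a point other than \<open>a = b\<close>.\<close>
      let ?n = "Const \<alpha> * c + Const (- \<beta>) * m"
      have n2: "?n\<^sup>2 = Const (\<alpha>^2) * c\<^sup>2 + Const (- 2 * \<alpha> * \<beta>) * (c * m) + Const (\<beta>^2) * m\<^sup>2"
        by (simp add: Const_mult Const_power Const_numeral Const_minus power2_eq_square algebra_simps)
      have "?n\<^sup>2 = Const 1 * a\<^sup>2 + Const (- 4 * \<alpha> * \<beta>) * (c * m)"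
        unfolding n2 a2 by (simp add: Const_1 Const_mult Const_numeral Const_minus algebra_simps)
      also have "\<dots> \<in> L" by (intro line_closed L \<open>a\<^sup>2 \<in> L\<close>)
      finally have nL: "?n\<^sup>2 \<in> L" .
      have n0: "?n \<noteq> 0"
      proof
        assume "?n = 0"
        then have "Const (\<alpha>^2) * c\<^sup>2 + Const (- 2 * \<alpha> * \<beta>) * (c * m) + Const (\<beta>^2) * m\<^sup>2 = 0" unfolding n2[symmetric] by simp
        from quad0[OF this] show False using ab0 by simp
      qed
      have "?n = linear_form (\<alpha> * p - \<beta> * r) (\<alpha> * q - \<beta> * s)"
        unfolding c m by (simp add: Const_diff Const_mult Const_minus algebra_simps)
      then have "?n \<in> S 1 - {0}" using homogeneous_linear_form n0 by (metis DiffI singletonD)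
      then have "on_conic (?n\<^sup>2)" unfolding on_conic_def using prop_refl by blast
      then have "proportional (?n\<^sup>2) (a\<^sup>2) \<or> proportional (?n\<^sup>2) (b\<^sup>2)"
        using ab(3) nL n0 unfolding meets_conic_in_def by fastforce
      moreover have "\<not> proportional (?n\<^sup>2) (Const (x^2) * c\<^sup>2 + Const (2 * x * y) * (c * m) + Const (y^2) * m\<^sup>2)"
        if xy: "\<alpha> * y - \<beta> * x = 0" "x \<noteq> 0" "y \<noteq> 0" for x y
      proof
        assume "proportional (?n\<^sup>2) (Const (x^2) * c\<^sup>2 + Const (2 * x * y) * (c * m) + Const (y^2) * m\<^sup>2)"
        then obtain k where k: "?n\<^sup>2 = Const k * (Const (x^2) * c\<^sup>2 + Const (2 * x * y) * (c * m) + Const (y^2) * m\<^sup>2)"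
          unfolding proportional_def by blast
        have "Const (\<alpha>^2 - k * x^2) * c\<^sup>2 + Const (- 2 * \<alpha> * \<beta> - k * (2 * x * y)) * (c * m) + Const (\<beta>^2 - k * y^2) * m\<^sup>2
          = ?n\<^sup>2 - Const k * (Const (x^2) * c\<^sup>2 + Const (2 * x * y) * (c * m) + Const (y^2) * m\<^sup>2)"
          unfolding n2 by (simp add: Const_diff Const_mult algebra_simps)
        also have "\<dots> = 0" using k by simp
        finally have "\<alpha>^2 - k * x^2 = 0" "- 2 * \<alpha> * \<beta> - k * (2 * x * y) = 0" using quad0 by blast+
        then have "4 * \<alpha>^2 * x * y = 0" using xy(1) by algebra
        with ab0 xy show False by simp
      qed
      ultimately show False using ab0 True unfolding a2 b2
        by (metis (no_types, lifting) diff_self mult.commute)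
    qed
  qed
  have "a * b = Const (\<alpha> * \<gamma>) * c\<^sup>2 + Const (\<alpha> * \<delta> + \<beta> * \<gamma>) * (c * m) + Const (\<beta> * \<delta>) * m\<^sup>2"
    unfolding a b by (simp add: Const_add Const_mult power2_eq_square algebra_simps)
  then show ?thesis by (intro that[of "\<alpha> * \<gamma>" "\<beta> * \<delta>"]) (simp add: zero Const_0)
qed

text \<open>
  The tangent at \<open>c\<close> contains the point \<open>z\<close>, so \<open>z = c m\<close>, and \<open>c\<close>, \<open>m\<close> are independent because \<open>z\<close> is
  not on the conic.  Both chords contribute forms in \<open>c\<^sup>2\<close> and \<open>m\<^sup>2\<close>.
\<close>

lemma involution_divisors_even:
  assumes "v \<in> involution_divisors"
  shows "\<exists>a b c. gl_equivalent (($) v) (coeffs a 0 b 0 c 0)"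
proof -
  obtain a1 b1 a2 b2 c z L1 L2 where S: "a1 \<in> S 1 - {0}" "b1 \<in> S 1 - {0}" "a2 \<in> S 1 - {0}" "b2 \<in> S 1 - {0}" "c \<in> S 1 - {0}"
    and v: "quintic (($) v) = a1 * b1 * a2 * b2 * c" and z: "z \<in> S 2 - {0}" "\<not> on_conic z"
    and L: "line L1" "line L2" "z \<in> L1" "z \<in> L2" "meets_conic_in L1 a1 b1" "meets_conic_in L2 a2 b2" and zc: "z \<in> conic_tangent c"
    using assms unfolding involution_divisors_def by blast
  obtain m where m: "z = c * m" "m \<in> S 1" using zc unfolding conic_tangent_def by blast
  obtain p q where c: "c = linear_form p q" using S(5) S_1_obtain by blast
  obtain r s where m': "m = linear_form r s" using m(2) S_1_obtain by blast
  have D: "p * s - q * r \<noteq> 0"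
  proof
    assume D0: "p * s - q * r = 0"
    have "p \<noteq> 0 \<or> q \<noteq> 0" using S(5) c by (auto simp: Const_0)
    then obtain k where k: "r = k * p" "s = k * q"
    proof
      assume "p \<noteq> 0" with D0 show ?thesis by (intro that[of "r / p"]) (simp_all add: field_simps)
    next
      assume "q \<noteq> 0" with D0 show ?thesis by (intro that[of "s / q"]) (simp_all add: field_simps)
    qed
    have zk: "z = Const k * c\<^sup>2" unfolding m m' c k by (simp add: Const_mult power2_eq_square algebra_simps)
    then have "k \<noteq> 0" using z(1) by (auto simp: Const_0)
    with zk have "on_conic z" using S(5) unfolding on_conic_def proportional_def by blast
    with z(2) show False by blast
  qed
  obtain u w where 1: "a1 * b1 = Const u * c\<^sup>2 + Const w * m\<^sup>2"
    by (rule chord[OF D c m' L(1) _ S(1,2) L(5)]) (use L(3) m in auto)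
  obtain u' w' where 2: "a2 * b2 = Const u' * c\<^sup>2 + Const w' * m\<^sup>2"
    by (rule chord[OF D c m' L(2) _ S(3,4) L(6)]) (use L(4) m in auto)
  have "($) v = act p q r s (coeffs (u * u') 0 ((u * w' + w * u') / 10) 0 (w * w' / 5) 0)"
  proof (rule quintic_inj, rule mpoly_eqI)
    fix x :: "2 \<Rightarrow> complex"
    have e: "eval x c = p * x 1 + q * x 2" "eval x m = r * x 1 + s * x 2" by (simp_all add: c m')
    have "eval x (quintic (($) v)) = eval x ((a1 * b1) * (a2 * b2) * c)" by (simp only: v mult.assoc)
    also have "\<dots> = (u * (eval x c)^2 + w * (eval x m)^2) * (u' * (eval x c)^2 + w' * (eval x m)^2) * eval x c"
      unfolding 1 2 by simp
    also have "\<dots> = form (coeffs (u * u') 0 ((u * w' + w * u') / 10) 0 (w * w' / 5) 0) (eval x c) (eval x m)"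
      by (simp add: form_def algebra_simps eval_nat_numeral)
    also have "\<dots> = eval x (quintic (act p q r s (coeffs (u * u') 0 ((u * w' + w * u') / 10) 0 (w * w' / 5) 0)))"
      by (simp add: eval_quintic' form_act e)
    finally show "eval x (quintic (($) v)) = eval x (quintic (act p q r s (coeffs (u * u') 0 ((u * w' + w * u') / 10) 0 (w * w' / 5) 0)))" .
  qed
  then have "gl_equivalent (($) v) (coeffs (u * u') 0 ((u * w' + w * u') / 10) 0 (w * w' / 5) 0)" by (rule gl_equivalentI[OF D])
  then show ?thesis by blast
qed

lemma square_in_S2: "l \<in> S 1 \<Longrightarrow> l\<^sup>2 \<in> S 2"
  using homogeneous_power[of 1 l 2] by (simp add: S_def)

text \<open>
  The converse of \<open>chord\<close>: the span of \<open>(l - k m)\<^sup>2\<close> and \<open>(l + k m)\<^sup>2\<close> contains their difference, a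
  multiple of \<open>l m\<close>, and a combination of two squares of independent linear forms is a square only
  if one coefficient vanishes.
\<close>

lemma chord_exists:
  assumes D: "p * s - q * r \<noteq> 0" and l: "l = linear_form p q" and m: "m = linear_form r s" and k: "k \<noteq> 0"
  shows "\<exists>L. line L \<and> l * m \<in> L \<and> meets_conic_in L (l - Const k * m) (l + Const k * m)"
    and "l - Const k * m \<in> S 1 - {0}" "l + Const k * m \<in> S 1 - {0}"
proof -
  let ?a = "l - Const k * m" and ?b = "l + Const k * m"
  let ?L = "{Const \<sigma> * ?a\<^sup>2 + Const \<tau> * ?b\<^sup>2 | \<sigma> \<tau>. True}"
  have comb: "Const \<sigma> * ?a\<^sup>2 + Const \<tau> * ?b\<^sup>2 = Const (\<sigma> + \<tau>) * l\<^sup>2 + Const (2 * k * (\<tau> - \<sigma>)) * (l * m) + Const (k^2 * (\<sigma> + \<tau>)) * m\<^sup>2" for \<sigma> \<tau>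
    by (simp add: Const_add Const_diff Const_mult Const_numeral Const_power power2_eq_square algebra_simps)
  note q0 = quadratic_relation_trivial[OF D, folded l m]
  have indep: "\<sigma> = 0 \<and> \<tau> = 0" if "Const \<sigma> * ?a\<^sup>2 + Const \<tau> * ?b\<^sup>2 = 0" for \<sigma> \<tau>
    using q0(1,2)[of "\<sigma> + \<tau>" "2 * k * (\<tau> - \<sigma>)" "k^2 * (\<sigma> + \<tau>)"] that k unfolding comb by (simp add: add_eq_0_iff)
  have lin: "?a = linear_form (p - k * r) (q - k * s)" "?b = linear_form (p + k * r) (q + k * s)"
    unfolding l m by (simp_all add: Const_add Const_diff Const_mult algebra_simps)
  have S1: "?a \<in> S 1" "?b \<in> S 1" unfolding lin by (rule homogeneous_linear_form)+
  have nz: "?a \<noteq> 0" "?b \<noteq> 0"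
  proof -
    show "?a \<noteq> 0"
    proof
      assume "?a = 0"
      then have "Const 1 * ?a\<^sup>2 + Const 0 * ?b\<^sup>2 = 0" by (simp add: Const_0)
      from indep[OF this] show False by simp
    qed
    show "?b \<noteq> 0"
    proof
      assume "?b = 0"
      then have "Const 0 * ?a\<^sup>2 + Const 1 * ?b\<^sup>2 = 0" by (simp add: Const_0)
      from indep[OF this] show False by simp
    qed
  qed
  show "?a \<in> S 1 - {0}" "?b \<in> S 1 - {0}" using S1 nz by auto
  have "line ?L"
    unfolding line_def by (rule bexI[OF bexI[OF _ square_in_S2[OF S1(2)]] square_in_S2[OF S1(1)]]) (use indep in blast)
  moreover have "l * m \<in> ?L"
  proof -
    have "Const (- 1 / (4 * k)) * ?a\<^sup>2 + Const (1 / (4 * k)) * ?b\<^sup>2 = l * m"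
      unfolding comb using k by (simp add: Const_0 Const_1)
    then show ?thesis by (metis (mono_tags, lifting) mem_Collect_eq)
  qed
  moreover have "meets_conic_in ?L ?a ?b"
    unfolding meets_conic_in_def
  proof (intro set_eqI iffI)
    fix A assume "A \<in> {A \<in> ?L - {0}. on_conic A}"
    then obtain \<sigma> \<tau> where A: "A = Const \<sigma> * ?a\<^sup>2 + Const \<tau> * ?b\<^sup>2" and nz: "A \<noteq> 0" and conic: "on_conic A" by blast
    obtain n h where n: "n \<in> S 1 - {0}" and An: "A = Const h * n\<^sup>2" using conic unfolding on_conic_def proportional_def by blast
    obtain e f where "n = linear_form e f" using n S_1_obtain by blast
    then obtain \<alpha> \<beta> where n': "n = Const \<alpha> * l + Const \<beta> * m" unfolding l m using in_basis[OF D] by metis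
    have "Const (\<sigma> + \<tau> - h * \<alpha>^2) * l\<^sup>2 + Const (2 * k * (\<tau> - \<sigma>) - 2 * h * \<alpha> * \<beta>) * (l * m) + Const (k^2 * (\<sigma> + \<tau>) - h * \<beta>^2) * m\<^sup>2
       = (Const \<sigma> * ?a\<^sup>2 + Const \<tau> * ?b\<^sup>2) - Const h * n\<^sup>2"
      unfolding comb n' by (simp add: Const_add Const_diff Const_mult Const_numeral Const_power power2_eq_square algebra_simps)
    also have "\<dots> = 0" using A An by simp
    finally have "\<sigma> + \<tau> - h * \<alpha>^2 = 0" "2 * k * (\<tau> - \<sigma>) - 2 * h * \<alpha> * \<beta> = 0" "k^2 * (\<sigma> + \<tau>) - h * \<beta>^2 = 0" using q0 by blast+
    then have "k^2 * (16 * \<sigma> * \<tau>) = 0" by algebra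
    with k have "\<sigma> = 0 \<or> \<tau> = 0" by simp
    then show "A \<in> {A. proportional A (?a\<^sup>2) \<or> proportional A (?b\<^sup>2)}"
    proof
      assume "\<sigma> = 0"
      then have "A = Const \<tau> * ?b\<^sup>2" "\<tau> \<noteq> 0" using A nz by (auto simp: Const_0)
      then show ?thesis unfolding proportional_def by blast
    next
      assume "\<tau> = 0"
      then have "A = Const \<sigma> * ?a\<^sup>2" "\<sigma> \<noteq> 0" using A nz by (auto simp: Const_0)
      then show ?thesis unfolding proportional_def by blast
    qed
  next
    fix A assume "A \<in> {A. proportional A (?a\<^sup>2) \<or> proportional A (?b\<^sup>2)}"
    then have pr: "proportional A (?a\<^sup>2) \<or> proportional A (?b\<^sup>2)" by simp
    then have "on_conic A" unfolding on_conic_def using S1 nz by blast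
    moreover have "A \<in> ?L - {0}"
      using pr
    proof
      assume "proportional A (?a\<^sup>2)"
      then obtain h where h: "h \<noteq> 0" "A = Const h * ?a\<^sup>2" unfolding proportional_def by blast
      then have "A = Const h * ?a\<^sup>2 + Const 0 * ?b\<^sup>2" by (simp add: Const_0)
      moreover have "A \<noteq> 0" using h nz by (simp add: Const_eq_0_iff)
      ultimately show ?thesis by blast
    next
      assume "proportional A (?b\<^sup>2)"
      then obtain h where h: "h \<noteq> 0" "A = Const h * ?b\<^sup>2" unfolding proportional_def by blast
      then have "A = Const 0 * ?a\<^sup>2 + Const h * ?b\<^sup>2" by (simp add: Const_0)
      moreover have "A \<noteq> 0" using h nz by (simp add: Const_eq_0_iff)
      ultimately show ?thesis by blast
    qed
    ultimately show "A \<in> {A \<in> ?L - {0}. on_conic A}" by blast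
  qed
  ultimately show "\<exists>L. line L \<and> l * m \<in> L \<and> meets_conic_in L ?a ?b" by blast
qed

text \<open>
  The quartic cofactor of \<open>l\<close> is \<open>a (l\<^sup>2 - k\<^sup>2 m\<^sup>2) (l\<^sup>2 - h\<^sup>2 m\<^sup>2)\<close>, and each factor gives a chord through
  \<open>l m\<close>.  Nonzero \<open>a\<close> and \<open>c\<close> make \<open>k\<close> and \<open>h\<close> finite and nonzero, so that the chords are not tangents.
\<close>

lemma even_involution:
  assumes D: "p * s - q * r \<noteq> 0" and a: "a \<noteq> 0" and c: "c \<noteq> 0"
  shows "vec_lambda (act p q r s (coeffs a 0 b 0 c 0)) \<in> involution_divisors"
proof -
  define l m where l: "l = linear_form p q" and m: "m = linear_form r s"
  define \<delta> where "\<delta> = csqrt ((10 * b)^2 - 20 * a * c)"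
  have d2: "\<delta>^2 = (10 * b)^2 - 20 * a * c" by (simp add: \<delta>_def)
  define k h where "k = csqrt ((- 10 * b + \<delta>) / (2 * a))" and "h = csqrt ((- 10 * b - \<delta>) / (2 * a))"
  have "k^2 = (- 10 * b + \<delta>) / (2 * a)" "h^2 = (- 10 * b - \<delta>) / (2 * a)" by (simp_all add: k_def h_def)
  then have kh: "2 * a * k^2 = - 10 * b + \<delta>" "2 * a * h^2 = - 10 * b - \<delta>" using a by simp_all
  have a4: "4 * a \<noteq> 0" using a by simp
  have "4 * a * (a * (k^2 + h^2)) = 4 * a * (- 10 * b)" using kh by algebra
  then have sum: "a * (k^2 + h^2) = - 10 * b" by (rule iffD1[OF mult_left_cancel[OF a4]])
  have "4 * a * (a * (k^2 * h^2)) = 4 * a * (5 * c)" using kh d2 by algebra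
  then have prod: "a * (k^2 * h^2) = 5 * c" by (rule iffD1[OF mult_left_cancel[OF a4]])
  have "k \<noteq> 0" "h \<noteq> 0" using prod c by auto
  note c1 = chord_exists[OF D l m \<open>k \<noteq> 0\<close>] and c2 = chord_exists[OF D l m \<open>h \<noteq> 0\<close>]
  have "quintic (act p q r s (coeffs a 0 b 0 c 0)) = (l - Const k * m) * (l + Const k * m) * (l - Const h * m) * (l + Const h * m) * (Const a * l)"
  proof (rule mpoly_eqI)
    fix u :: "2 \<Rightarrow> complex"
    have e: "eval u l = p * u 1 + q * u 2" "eval u m = r * u 1 + s * u 2" by (simp_all add: l m)
    have "eval u (quintic (act p q r s (coeffs a 0 b 0 c 0))) = form (coeffs a 0 b 0 c 0) (eval u l) (eval u m)"
      by (simp add: eval_quintic' form_act e)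
    also have "\<dots> = a * (eval u l)^5 - (- 10 * b) * (eval u l)^3 * (eval u m)^2 + (5 * c) * eval u l * (eval u m)^4"
      by (simp add: form_def)
    also have "\<dots> = (eval u l - k * eval u m) * (eval u l + k * eval u m) * (eval u l - h * eval u m) * (eval u l + h * eval u m) * (a * eval u l)"
      unfolding sum[symmetric] prod[symmetric] by algebra
    finally show "eval u (quintic (act p q r s (coeffs a 0 b 0 c 0))) = eval u ((l - Const k * m) * (l + Const k * m) * (l - Const h * m) * (l + Const h * m) * (Const a * l))"
      by simp
  qed
  moreover have "Const a * l \<in> S 1 - {0}"
  proof -
    have al: "Const a * l = linear_form (a * p) (a * q)" unfolding l by (simp add: Const_mult algebra_simps)
    have "Const a * l \<in> S 1" unfolding al by (rule homogeneous_linear_form)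
    moreover have "Const a * l \<noteq> 0" unfolding al linear_form_eq_0 using D a by auto
    ultimately show ?thesis by blast
  qed
  moreover have "l * m \<in> S 2 - {0} \<and> \<not> on_conic (l * m) \<and> l * m \<in> conic_tangent (Const a * l)"
  proof (intro conjI)
    have lm: "l \<in> S 1" "m \<in> S 1" unfolding l m by (rule homogeneous_linear_form)+
    have "l * m \<in> S 2" using homogeneous_mult[of 1 l 1 m] lm by (simp add: S_def numeral_2_eq_2)
    moreover have "l * m \<noteq> 0"
    proof
      assume "l * m = 0"
      then have "Const 0 * l\<^sup>2 + Const 1 * (l * m) + Const 0 * m\<^sup>2 = 0" by (simp add: Const_0)
      from quadratic_relation_trivial(2)[OF D this[unfolded l m]] show False by simp
    qed
    ultimately show "l * m \<in> S 2 - {0}" by blast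
    show "\<not> on_conic (l * m)"
    proof
      assume "on_conic (l * m)"
      then obtain n g where n: "n \<in> S 1 - {0}" and An: "l * m = Const g * n\<^sup>2" unfolding on_conic_def proportional_def by blast
      obtain e f where "n = linear_form e f" using n S_1_obtain by blast
      then obtain \<alpha> \<beta> where n': "n = Const \<alpha> * l + Const \<beta> * m" unfolding l m using in_basis[OF D] by metis
      have "Const (g * \<alpha>^2) * l\<^sup>2 + Const (2 * g * \<alpha> * \<beta> - 1) * (l * m) + Const (g * \<beta>^2) * m\<^sup>2 = Const g * n\<^sup>2 - l * m"
        unfolding n' by (simp add: Const_diff Const_mult Const_numeral Const_power Const_1 power2_eq_square algebra_simps)
      also have "\<dots> = 0" using An by simp
      finally have "g * \<alpha>^2 = 0" "2 * g * \<alpha> * \<beta> - 1 = 0" using quadratic_relation_trivial(1,2)[OF D, folded l m] by blast+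
      then show False by auto
    qed
    have "(Const a * l) * (Const (1 / a) * m) = Const (a * (1 / a)) * (l * m)" by (simp only: Const_mult mult_ac)
    also have "\<dots> = l * m" using a by (simp add: Const_1)
    finally have "l * m = (Const a * l) * (Const (1 / a) * m)" ..
    moreover have "Const (1 / a) * m = linear_form (1 / a * r) (1 / a * s)"
      unfolding m by (simp only: Const_mult ring_distribs mult.assoc)
    then have "Const (1 / a) * m \<in> S 1" using homogeneous_linear_form by metis
    ultimately show "l * m \<in> conic_tangent (Const a * l)" unfolding conic_tangent_def by blast
  qed
  ultimately show ?thesis
    unfolding involution_divisors_def vec_nth_lambda mem_Collect_eq using c1 c2 by blast
qed

section \<open>The hypersurface and its tangent vectors\<close>

text \<open>
  The quintics \<open>l (\<alpha> l\<^sup>4 + 10 \<beta> l\<^sup>2 m\<^sup>2 + 5 \<gamma> m\<^sup>4)\<close>, with degenerate values of \<open>\<alpha>\<close>, \<open>\<gamma>\<close> included.  They are a dense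
  subset of the cone over the hypersurface, and are used in place of the divisors in involution
  because they carry explicit parameters.
\<close>

definition even_quintics :: "(6 \<Rightarrow> complex) set" where
  "even_quintics = {a. \<exists>\<alpha> \<beta> \<gamma>. gl_equivalent a (coeffs \<alpha> 0 \<beta> 0 \<gamma> 0)}"

definition vanishes_on_H :: "R \<Rightarrow> bool" where
  "vanishes_on_H f \<longleftrightarrow> (\<forall>a\<in>even_quintics. eval a f = 0)"

lemma even_quinticsI: "p * s - q * r \<noteq> 0 \<Longrightarrow> act p q r s (coeffs \<alpha> 0 \<beta> 0 \<gamma> 0) \<in> even_quintics"
  unfolding even_quintics_def using gl_equivalentI by blast

lemma even_quintics_act:
  assumes "a \<in> even_quintics" "p * s - q * r \<noteq> 0" shows "act p q r s a \<in> even_quintics"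
  using assms gl_equivalentI[OF assms(2) refl, of a] gl_equivalent_trans unfolding even_quintics_def by blast

lemma act_linear: "act p q r s (\<lambda>i. x * a i + y * b i) = (\<lambda>i. x * act p q r s a i + y * act p q r s b i)"
  by (simp add: fun_eq_iff act_def algebra_simps)

lemma even_quintics_scale:
  assumes "a \<in> even_quintics" shows "(\<lambda>i. k * a i) \<in> even_quintics"
proof -
  obtain p q r s \<alpha> \<beta> \<gamma> where D: "p * s - q * r \<noteq> 0" and a: "a = act p q r s (coeffs \<alpha> 0 \<beta> 0 \<gamma> 0)"
    using assms unfolding even_quintics_def gl_equivalent_def by blast
  have "(\<lambda>i. k * a i) = act p q r s (coeffs (k * \<alpha>) 0 (k * \<beta>) 0 (k * \<gamma>) 0)"
    unfolding a by (simp add: fun_eq_6 act_simps algebra_simps)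
  then show ?thesis using even_quinticsI[OF D] by metis
qed

lemma zero_even: "(\<lambda>_. 0) \<in> even_quintics"
proof -
  have "(\<lambda>_. 0) = act 1 0 0 1 (coeffs 0 0 0 0 0 (0::complex))" unfolding act_id by (simp add: fun_eq_6)
  then show ?thesis using even_quinticsI[of 1 1 0 0 0 0 0] by simp
qed

lemma isCont_eval: "(\<And>i. isCont (\<lambda>t. \<gamma> t i) z) \<Longrightarrow> isCont (\<lambda>t. eval (\<gamma> t) (f :: ('v::finite, complex) mpoly)) (z :: complex)"
  by (induction f rule: mpoly_induct) (auto intro: continuous_intros)

lemma isCont_zero:
  fixes g :: "complex \<Rightarrow> complex"
  assumes "isCont g z" "\<forall>\<^sub>F t in at z. g t = 0" shows "g z = 0"
proof -
  have "(g \<longlongrightarrow> g z) (at z)" using assms(1) by (simp add: isCont_def)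
  moreover have "(g \<longlongrightarrow> 0) (at z)" by (rule tendsto_eventually[OF assms(2)])
  ultimately show ?thesis by (rule tendsto_unique[OF trivial_limit_at])
qed

text \<open>
  Even quintics with \<open>\<alpha> \<gamma> \<noteq> 0\<close> are divisors in involution, and the others are limits of them.
\<close>

lemma vanishes_on_HI:
  assumes "\<And>v. v \<in> involution_divisors \<Longrightarrow> eval (($) v) f = 0" shows "vanishes_on_H f"
  unfolding vanishes_on_H_def
proof
  fix a assume "a \<in> even_quintics"
  then obtain p q r s \<alpha> \<beta> \<gamma> where D: "p * s - q * r \<noteq> 0" and a: "a = act p q r s (coeffs \<alpha> 0 \<beta> 0 \<gamma> 0)"
    unfolding even_quintics_def gl_equivalent_def by blast
  let ?c = "\<lambda>t. act p q r s (coeffs (\<alpha> + t) 0 \<beta> 0 (\<gamma> + t) 0)"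
  have "eval (?c 0) f = 0"
  proof (rule isCont_zero[where g = "\<lambda>t. eval (?c t) f" and z = 0])
    have "\<forall>i. isCont (\<lambda>t. ?c t i) 0" unfolding all_6 act_simps coeffs_simps by (intro conjI continuous_intros)
    then show "isCont (\<lambda>t. eval (?c t) f) 0" by (intro isCont_eval) blast
    have "\<forall>\<^sub>F t in at 0. t \<noteq> - \<alpha> \<and> t \<noteq> - \<gamma>" by (intro eventually_conj eventually_neq_at_within)
    then show "\<forall>\<^sub>F t in at 0. eval (?c t) f = 0"
    proof (rule eventually_mono)
      fix t assume "t \<noteq> - \<alpha> \<and> t \<noteq> - \<gamma>"
      then have "\<alpha> + t \<noteq> 0" "\<gamma> + t \<noteq> 0" by (auto simp: add_eq_0_iff)
      from assms[OF even_involution[OF D this]] show "eval (?c t) f = 0" by (simp only: vec_nth_lambda)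
    qed
  qed
  then show "eval a f = 0" by (simp add: a)
qed

lemma involution_divisors_subset: "v \<in> involution_divisors \<Longrightarrow> ($) v \<in> even_quintics"
  using involution_divisors_even unfolding even_quintics_def by blast

lemma vanishing_ideal_eval: "f \<in> vanishing_ideal X \<Longrightarrow> v \<in> X \<Longrightarrow> eval (($) v) f = 0"
  unfolding vanishing_ideal_def by (induction rule: ideal_gen_induct) auto

lemma involution_subset_calH: "involution_divisors \<subseteq> calH"
proof
  fix v assume v: "v \<in> involution_divisors"
  have "v \<noteq> 0"
  proof
    assume "v = 0"
    then have "quintic (($) v) = 0" by (intro mpoly_eqI) (simp add: eval_quintic' form_def)
    then show False using v unfolding involution_divisors_def by auto
  qed
  then show "v \<in> calH" unfolding calH_def zariski_closure_def using vanishing_ideal_eval v by blast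
qed

text \<open>
  Even quintics form a cone, and a polynomial in the scaling factor that vanishes identically has
  vanishing coefficients.
\<close>

lemma vanishes_on_H_hom_part:
  assumes "vanishes_on_H f" shows "vanishes_on_H (hom_part d f)"
  unfolding vanishes_on_H_def
proof
  fix a assume a: "a \<in> even_quintics"
  define n where "n = (\<Sum>t\<in>Poly_Mapping.keys f. mdeg t) + d"
  have f: "f = (\<Sum>d\<le>n. hom_part d f)"
    by (rule sum_hom_parts) (auto simp: n_def intro!: trans_le_add1 member_le_sum[where f = mdeg])
  have "(\<Sum>i\<le>n. eval a (hom_part i f) * t ^ i) = 0" for t
  proof -
    have "0 = eval (\<lambda>i. t * a i) f" using assms even_quintics_scale[OF a] by (simp add: vanishes_on_H_def)
    also have "\<dots> = (\<Sum>i\<le>n. eval (\<lambda>i. t * a i) (hom_part i f))" by (subst f) simp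
    also have "\<dots> = (\<Sum>i\<le>n. eval a (hom_part i f) * t ^ i)"
      by (intro sum.cong refl) (simp add: eval_scale[OF homogeneous_hom_part] mult.commute)
    finally show ?thesis by simp
  qed
  then have "\<forall>t. (\<Sum>i\<le>n. eval a (hom_part i f) * t ^ i) = 0" by blast
  then have "\<forall>i\<le>n. eval a (hom_part i f) = 0" by (rule iffD1[OF polyfun_eq_0])
  then show "eval a (hom_part d f) = 0" by (simp add: n_def)
qed

lemma vanishing_ideal_calH: "f \<in> vanishing_ideal calH \<longleftrightarrow> vanishes_on_H f"
proof
  show "f \<in> vanishing_ideal calH \<Longrightarrow> vanishes_on_H f"
    by (rule vanishes_on_HI) (use vanishing_ideal_eval involution_subset_calH in blast)
  assume f: "vanishes_on_H f"
  have "hom_part d f \<in> vanishing_ideal calH" for d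
    unfolding vanishing_ideal_def
  proof (intro ideal_gen_base CollectI conjI ballI exI[of _ d] homogeneous_hom_part)
    fix v assume v: "v \<in> calH"
    have "hom_part d f \<in> vanishing_ideal involution_divisors"
      unfolding vanishing_ideal_def
      using vanishes_on_H_hom_part[OF f, of d] involution_divisors_subset
      by (intro ideal_gen_base CollectI conjI ballI exI[of _ d] homogeneous_hom_part) (auto simp: vanishes_on_H_def)
    then show "eval (($) v) (hom_part d f) = 0" using v unfolding calH_def zariski_closure_def by blast
  qed
  then have "(\<Sum>d\<le>(\<Sum>t\<in>Poly_Mapping.keys f. mdeg t). hom_part d f) \<in> vanishing_ideal calH"
    unfolding vanishing_ideal_def by (intro ideal_gen_sum)
  moreover have "f = (\<Sum>d\<le>(\<Sum>t\<in>Poly_Mapping.keys f. mdeg t). hom_part d f)"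
    by (rule sum_hom_parts, rule ballI, rule member_le_sum[where f = mdeg]) auto
  ultimately show "f \<in> vanishing_ideal calH" by simp
qed

lemma calH_iff: "v \<in> calH \<longleftrightarrow> v \<noteq> 0 \<and> (\<forall>f. vanishes_on_H f \<longrightarrow> eval (($) v) f = 0)"
proof
  show "v \<in> calH \<Longrightarrow> v \<noteq> 0 \<and> (\<forall>f. vanishes_on_H f \<longrightarrow> eval (($) v) f = 0)"
    using vanishing_ideal_eval by (auto simp: vanishing_ideal_calH[symmetric] calH_def zariski_closure_def)
  assume v: "v \<noteq> 0 \<and> (\<forall>f. vanishes_on_H f \<longrightarrow> eval (($) v) f = 0)"
  moreover have "vanishes_on_H f" if "f \<in> vanishing_ideal involution_divisors" for f
    by (rule vanishes_on_HI) (rule vanishing_ideal_eval[OF that])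
  ultimately show "v \<in> calH" unfolding calH_def zariski_closure_def by blast
qed

lemma vanishes_on_H_act:
  assumes "vanishes_on_H f" "p * s - q * r \<noteq> 0"
  shows "vanishes_on_H (subst (act (Const p) (Const q) (Const r) (Const s) Var) f)"
    and "eval a (subst (act (Const p) (Const q) (Const r) (Const s) Var) f) = eval (act p q r s a) f"
proof -
  show *: "eval a (subst (act (Const p) (Const q) (Const r) (Const s) Var) f) = eval (act p q r s a) f" for a
    unfolding eval_subst eval_act by simp
  show "vanishes_on_H (subst (act (Const p) (Const q) (Const r) (Const s) Var) f)"
    unfolding vanishes_on_H_def * using assms even_quintics_act by (auto simp: vanishes_on_H_def)
qed

lemma tangent:
  assumes f: "vanishes_on_H f" and d: "\<And>i. ((\<lambda>t. \<gamma> t i) has_field_derivative \<gamma>' i) (at 0)"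
    and K: "\<forall>\<^sub>F t in nhds 0. \<gamma> t \<in> even_quintics"
  shows "(\<Sum>i\<in>UNIV. \<gamma>' i * eval (\<gamma> 0) (partial i f)) = 0"
proof -
  have "\<forall>\<^sub>F t in nhds 0. eval (\<gamma> t) f = 0"
    using K by (rule eventually_mono) (use f in \<open>simp add: vanishes_on_H_def\<close>)
  then have "((\<lambda>t. eval (\<gamma> t) f) has_field_derivative 0) (at 0) \<longleftrightarrow> ((\<lambda>t. 0 :: complex) has_field_derivative 0) (at 0)"
    by (intro DERIV_cong_ev refl)
  then have "((\<lambda>t. eval (\<gamma> t) f) has_field_derivative 0) (at 0)" by simp
  with eval_has_derivative[where \<gamma> = \<gamma> and \<gamma>' = \<gamma>' and z = 0, OF d] show ?thesis by (rule DERIV_unique)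
qed

lemma even_tangent:
  assumes f: "vanishes_on_H f" and D: "p * s - q * r \<noteq> 0"
  shows "(\<Sum>i\<in>UNIV. act p q r s (coeffs x 0 y 0 z 0) i * eval (act p q r s (coeffs \<alpha> 0 \<beta> 0 \<gamma> 0)) (partial i f)) = 0"
proof -
  let ?c = "\<lambda>t. act p q r s (coeffs (\<alpha> + t * x) 0 (\<beta> + t * y) 0 (\<gamma> + t * z) 0)"
  have "\<forall>i. ((\<lambda>t. ?c t i) has_field_derivative act p q r s (coeffs x 0 y 0 z 0) i) (at 0)"
    unfolding all_6 act_simps coeffs_simps by (intro conjI) (auto intro!: derivative_eq_intros)
  then have "(\<Sum>i\<in>UNIV. act p q r s (coeffs x 0 y 0 z 0) i * eval (?c 0) (partial i f)) = 0"
    by (intro tangent[OF f, of ?c]) (auto intro!: always_eventually even_quinticsI D)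
  then show ?thesis by simp
qed

text \<open>
  The tangent vectors of the orbit under the general linear group, one for each matrix unit.
\<close>

lemma gl_tangent:
  assumes f: "vanishes_on_H f" and a: "a \<in> even_quintics"
  shows "5 * a 0 * eval a (partial 0 f) + 4 * a 1 * eval a (partial 1 f) + 3 * a 2 * eval a (partial 2 f)
      + 2 * a 3 * eval a (partial 3 f) + a 4 * eval a (partial 4 f) = 0"
    and "a 1 * eval a (partial 1 f) + 2 * a 2 * eval a (partial 2 f)
      + 3 * a 3 * eval a (partial 3 f) + 4 * a 4 * eval a (partial 4 f) + 5 * a 5 * eval a (partial 5 f) = 0"
    and "a 0 * eval a (partial 1 f) + 2 * a 1 * eval a (partial 2 f)
      + 3 * a 2 * eval a (partial 3 f) + 4 * a 3 * eval a (partial 4 f) + 5 * a 4 * eval a (partial 5 f) = 0"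
    and "5 * a 1 * eval a (partial 0 f) + 4 * a 2 * eval a (partial 1 f) + 3 * a 3 * eval a (partial 2 f)
      + 2 * a 4 * eval a (partial 3 f) + a 5 * eval a (partial 4 f) = 0"
proof -
  have ev: "\<forall>\<^sub>F t in nhds 0. 1 + t \<noteq> (0 :: complex)"
  proof -
    have "\<forall>\<^sub>F t in nhds 0. t \<in> - {- 1 :: complex}" by (rule eventually_nhds_in_open) auto
    then show ?thesis
    proof (rule eventually_mono)
      fix t :: complex assume t: "t \<in> - {- 1}"
      show "1 + t \<noteq> 0"
      proof
        assume "1 + t = 0"
        then have "t = - 1" by algebra
        with t show False by simp
      qed
    qed
  qed
  have "\<forall>i. ((\<lambda>t. act (1 + t) 0 0 1 a i) has_field_derivative coeffs (5 * a 0) (4 * a 1) (3 * a 2) (2 * a 3) (a 4) 0 i) (at 0)"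
    "\<forall>i. ((\<lambda>t. act 1 0 0 (1 + t) a i) has_field_derivative coeffs 0 (a 1) (2 * a 2) (3 * a 3) (4 * a 4) (5 * a 5) i) (at 0)"
    "\<forall>i. ((\<lambda>t. act 1 t 0 1 a i) has_field_derivative coeffs 0 (a 0) (2 * a 1) (3 * a 2) (4 * a 3) (5 * a 4) i) (at 0)"
    "\<forall>i. ((\<lambda>t. act 1 0 t 1 a i) has_field_derivative coeffs (5 * a 1) (4 * a 2) (3 * a 3) (2 * a 4) (a 5) 0 i) (at 0)"
    unfolding all_6 act_simps coeffs_simps by (intro conjI; auto intro!: derivative_eq_intros)+
  note d = this[THEN spec]
  note t = tangent[where \<gamma> = "\<lambda>t. act (1 + t) 0 0 1 a", OF f d(1)] tangent[where \<gamma> = "\<lambda>t. act 1 0 0 (1 + t) a", OF f d(2)]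
    tangent[where \<gamma> = "\<lambda>t. act 1 t 0 1 a", OF f d(3)] tangent[where \<gamma> = "\<lambda>t. act 1 0 t 1 a", OF f d(4)]
  have "\<forall>\<^sub>F t in nhds 0. act (1 + t) 0 0 1 a \<in> even_quintics" "\<forall>\<^sub>F t in nhds 0. act 1 0 0 (1 + t) a \<in> even_quintics"
    using ev by (rule eventually_mono, intro even_quintics_act a, simp)+
  moreover have "\<forall>\<^sub>F t in nhds 0. act 1 t 0 1 a \<in> even_quintics" "\<forall>\<^sub>F t in nhds 0. act 1 0 t 1 a \<in> even_quintics"
    by (intro always_eventually allI even_quintics_act a, simp)+
  ultimately show "5 * a 0 * eval a (partial 0 f) + 4 * a 1 * eval a (partial 1 f) + 3 * a 2 * eval a (partial 2 f)
      + 2 * a 3 * eval a (partial 3 f) + a 4 * eval a (partial 4 f) = 0"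
    and "a 1 * eval a (partial 1 f) + 2 * a 2 * eval a (partial 2 f)
      + 3 * a 3 * eval a (partial 3 f) + 4 * a 4 * eval a (partial 4 f) + 5 * a 5 * eval a (partial 5 f) = 0"
    and "a 0 * eval a (partial 1 f) + 2 * a 1 * eval a (partial 2 f)
      + 3 * a 2 * eval a (partial 3 f) + 4 * a 3 * eval a (partial 4 f) + 5 * a 4 * eval a (partial 5 f) = 0"
    and "5 * a 1 * eval a (partial 0 f) + 4 * a 2 * eval a (partial 1 f) + 3 * a 3 * eval a (partial 2 f)
      + 2 * a 4 * eval a (partial 3 f) + a 5 * eval a (partial 4 f) = 0"
    using t by (simp_all add: sum_6 act_id)
qed

section \<open>Singularity along the orbits\<close>

definition singular_point :: "(6 \<Rightarrow> complex) \<Rightarrow> bool" where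
  "singular_point a \<longleftrightarrow> (\<forall>f. vanishes_on_H f \<longrightarrow> (\<forall>i. eval a (partial i f) = 0))"

text \<open>
  The gradients of \<open>f\<close> at \<open>act p q r s a\<close> and of its pull-back at \<open>a\<close> correspond under the linear
  map \<open>act p q r s\<close>; the direction \<open>d\<close> is the preimage of the \<open>j\<close>-th unit vector.
\<close>

lemma singular_point_act:
  assumes a: "singular_point a" and D: "p * s - q * r \<noteq> 0"
  shows "singular_point (act p q r s a)"
  unfolding singular_point_def
proof (intro allI impI)
  fix f j assume f: "vanishes_on_H f"
  let ?f = "subst (act (Const p) (Const q) (Const r) (Const s) Var) f"
  let ?D = "p * s - q * r"
  define e :: "6 \<Rightarrow> complex" where "e = (\<lambda>i. if i = j then 1 else 0)"
  define d where "d = act (s / ?D) (- q / ?D) (- r / ?D) (p / ?D) e"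
  have grad: "eval a (partial i ?f) = 0" for i
    using a vanishes_on_H_act(1)[OF f D] unfolding singular_point_def by blast
  have "act p q r s (\<lambda>i. 1 * a i + t * d i) = (\<lambda>i. 1 * act p q r s a i + t * e i)" for t
    unfolding act_linear d_def act_inverse(2)[OF D] ..
  then have eq: "eval (\<lambda>i. a i + t * d i) ?f = eval (\<lambda>i. act p q r s a i + t * e i) f" for t
    unfolding vanishes_on_H_act(2)[OF f D] by simp
  have "((\<lambda>t. eval (\<lambda>i. a i + t * d i) ?f) has_field_derivative (\<Sum>i\<in>UNIV. d i * eval (\<lambda>i. a i + 0 * d i) (partial i ?f))) (at 0)"
    by (rule eval_has_derivative) (auto intro!: derivative_eq_intros)
  moreover have "((\<lambda>t. eval (\<lambda>i. act p q r s a i + t * e i) f) has_field_derivative (\<Sum>i\<in>UNIV. e i * eval (\<lambda>i. act p q r s a i + 0 * e i) (partial i f))) (at 0)"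
    by (rule eval_has_derivative) (auto intro!: derivative_eq_intros)
  ultimately have "(\<Sum>i\<in>UNIV. e i * eval (\<lambda>i. act p q r s a i + 0 * e i) (partial i f)) = (\<Sum>i\<in>UNIV. d i * eval (\<lambda>i. a i + 0 * d i) (partial i ?f))"
    unfolding eq by (rule DERIV_unique[rotated])
  also have "\<dots> = 0" by (simp add: grad)
  also have "(\<Sum>i\<in>UNIV. e i * eval (\<lambda>i. act p q r s a i + 0 * e i) (partial i f)) = (\<Sum>i\<in>UNIV. if i = j then eval (act p q r s a) (partial i f) else 0)"
    by (intro sum.cong) (auto simp: e_def)
  finally show "eval (act p q r s a) (partial j f) = 0" by simp
qed

lemma singular_point_equivalent: "singular_point b \<Longrightarrow> gl_equivalent a b \<Longrightarrow> singular_point a"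
  unfolding gl_equivalent_def using singular_point_act by blast

lemma singular_point_scale:
  assumes "singular_point a" "k \<noteq> 0" shows "singular_point (\<lambda>i. k * a i)"
proof -
  obtain c where c: "c ^ 5 = k" using complex_root[of 4] by auto
  then have "c \<noteq> 0" using assms(2) by auto
  have "act (c * 1) (c * 0) (c * 0) (c * 1) a = (\<lambda>i. k * a i)" unfolding act_scale act_id c ..
  with singular_point_act[OF assms(1), of c c 0 0] \<open>c \<noteq> 0\<close> show ?thesis by simp
qed

text \<open>
  By Euler's relation, applied in each positive degree; the part of degree zero vanishes because
  it may be evaluated at the origin.
\<close>

lemma singular_vanishing:
  assumes a: "singular_point a" and f: "vanishes_on_H f" shows "eval a f = 0"
proof -
  have part: "eval a (hom_part d f) = 0" for d
  proof (cases "d = 0")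
    case True
    have "eval (\<lambda>i. 0 * a i) (hom_part 0 f) = 0 ^ 0 * eval a (hom_part 0 f)" by (rule eval_scale[OF homogeneous_hom_part])
    moreover have "eval (\<lambda>i. 0 * a i) (hom_part 0 f) = 0"
      using vanishes_on_H_hom_part[OF f, of 0] zero_even by (simp add: vanishes_on_H_def)
    ultimately show ?thesis using True by simp
  next
    case False
    have "((\<lambda>t. eval (\<lambda>i. t * a i) (hom_part d f)) has_field_derivative (\<Sum>i\<in>UNIV. a i * eval (\<lambda>i. 1 * a i) (partial i (hom_part d f)))) (at 1)"
      by (rule eval_has_derivative) (auto intro!: derivative_eq_intros)
    moreover have "(\<Sum>i\<in>UNIV. a i * eval (\<lambda>i. 1 * a i) (partial i (hom_part d f))) = 0"
      using a vanishes_on_H_hom_part[OF f, of d] by (simp add: singular_point_def)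
    ultimately have "((\<lambda>t. t ^ d * eval a (hom_part d f)) has_field_derivative 0) (at 1)"
      by (simp add: eval_scale[OF homogeneous_hom_part])
    moreover have "((\<lambda>t. t ^ d * eval a (hom_part d f)) has_field_derivative of_nat d * eval a (hom_part d f)) (at 1)"
      by (auto intro!: derivative_eq_intros)
    ultimately have "of_nat d * eval a (hom_part d f) = 0" by (rule DERIV_unique[rotated])
    then show ?thesis using False by simp
  qed
  have "f = (\<Sum>d\<le>(\<Sum>t\<in>Poly_Mapping.keys f. mdeg t). hom_part d f)"
    by (rule sum_hom_parts, rule ballI, rule member_le_sum[where f = mdeg]) auto
  then have "eval a f = (\<Sum>d\<le>(\<Sum>t\<in>Poly_Mapping.keys f. mdeg t). eval a (hom_part d f))" by (metis eval_sum)
  then show ?thesis by (simp add: part)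
qed

lemma poly_root:
  assumes "degree p > 0" obtains z :: complex where "poly p z = 0"
  using fundamental_theorem_of_algebra_alt[of p] assms by (metis degree_pCons_0 less_irrefl)

text \<open>
  The involution of an even quintic exchanges \<open>l + m\<close> and \<open>l - m\<close>, up to sign.  In terms of these,
  \<open>l\<^sup>5 + 10 l\<^sup>3 m\<^sup>2 + 5 l m\<^sup>4\<close> is half of \<open>(l + m)\<^sup>5 + (l - m)\<^sup>5\<close>, and
  \<open>- 5 l\<^sup>5 - 10 l\<^sup>3 m\<^sup>2 + 15 l m\<^sup>4 = 5 l (m\<^sup>2 - l\<^sup>2) (l\<^sup>2 + 3 m\<^sup>2)\<close>, a multiple of
  \<open>(m + l) (m - l) ((m + l)\<^sup>3 - (m - l)\<^sup>3)\<close>.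
\<close>

lemma even_in_eigenbasis:
  "act p q p (- q) (coeffs 1 0 1 0 1 0) = coeffs (16 * p^5) 0 0 0 0 (16 * q^5 :: complex)"
  "act p (- q) p q (coeffs (- 5) 0 (- 1) 0 3 0) = coeffs 0 (16 * (p^4 * q)) 0 0 (- 16 * (p * q^4)) (0 :: complex)"
  by (simp_all add: fun_eq_6 act_simps algebra_simps eval_nat_numeral)

text \<open>
  For every fifth root of unity \<open>\<zeta>\<close>, \<open>x\<^sup>5 + y\<^sup>5\<close> is even for the involution exchanging \<open>x\<close> and \<open>\<zeta> y\<close>, and
  \<open>(x + \<zeta> y)\<^sup>5\<close> is a tangent vector of that branch.  The fifth powers for \<open>\<zeta> = 1\<close> and for one nontrivial
  \<open>\<zeta>\<close> span everything together with the tangent space of the orbit.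
\<close>

lemma singular_pentagon: "singular_point (coeffs 16 0 0 0 0 16)"
  unfolding singular_point_def
proof (intro allI impI)
  fix f assume f: "vanishes_on_H f"
  let ?a = "coeffs 16 0 0 0 0 (16 :: complex)"
  define g where "g i = eval ?a (partial i f)" for i
  obtain z :: complex where "poly [:1, 1, 1, 1, 1:] z = 0" by (rule poly_root[of "[:1, 1, 1, 1, 1:]"]) auto
  then have z: "1 + z + z^2 + z^3 + z^4 = 0" by (simp add: eval_nat_numeral algebra_simps)
  have z1: "z \<noteq> 1" "z \<noteq> 0" using z by auto
  have z5: "z^5 = 1" using z by algebra
  have pt: "act 1 y 1 (- y) (coeffs 1 0 1 0 1 0) = ?a" if "y^5 = 1" for y :: complex
    unfolding even_in_eigenbasis using that by simp
  have e: "g 0 + y * g 1 + y^2 * g 2 + y^3 * g 3 + y^4 * g 4 + y^5 * g 5 = 0" if "y^5 = 1" for y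
  proof -
    have "y \<noteq> 0" using that by auto
    then show ?thesis
      using even_tangent[OF f, of 1 "- y" y 1 1 0 0 1 1 1] by (simp add: pt[OF that] sum_6 act_simps g_def)
  qed
  have even: "?a \<in> even_quintics" using even_quinticsI[of 1 "-1" 1 1 1 1 1] pt[of 1] by simp
  have g: "g 0 = 0" "g 5 = 0" "g 1 = 0" "g 4 = 0" using gl_tangent[OF f even] by (simp_all add: g_def)
  have "g 2 + g 3 = 0" using e[of 1] by (simp add: g)
  moreover have "z^2 * g 2 + z^3 * g 3 = 0" using e[OF z5] by (simp add: g)
  ultimately have "z^2 * ((z - 1) * g 3) = 0" by algebra
  then have "g 3 = 0" using z1 by simp
  with \<open>g 2 + g 3 = 0\<close> have "\<forall>i. g i = 0" unfolding all_6 using g by simp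
  then show "eval ?a (partial i f) = 0" for i by (simp add: g_def)
qed

text \<open>
  For every cube root of unity \<open>\<zeta>\<close>, \<open>x y (x\<^sup>3 - y\<^sup>3)\<close> is even for the involution that fixes the root \<open>\<zeta> x - \<zeta>\<^sup>2 y\<close>,
  and the fifth power of that root is a tangent vector of the branch.
\<close>

lemma singular_bipyramid: "singular_point (coeffs 0 16 0 0 (- 16) 0)"
  unfolding singular_point_def
proof (intro allI impI)
  fix f assume f: "vanishes_on_H f"
  let ?a = "coeffs 0 16 0 0 (- 16) (0 :: complex)"
  define g where "g i = eval ?a (partial i f)" for i
  obtain z :: complex where "poly [:1, 1, 1:] z = 0" by (rule poly_root[of "[:1, 1, 1:]"]) auto
  then have z: "1 + z + z^2 = 0" by (simp add: eval_nat_numeral algebra_simps)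
  have z3: "z^3 = 1" using z by algebra
  have pt: "act y (- (y^2)) y (y^2) (coeffs (- 5) 0 (- 1) 0 3 0) = ?a" if "y^3 = 1" for y :: complex
  proof -
    have "y^4 * y^2 = 1" "y * (y^2)^4 = 1" using that by algebra+
    then show ?thesis unfolding even_in_eigenbasis by (simp add: mult.assoc)
  qed
  have e: "y^2 * (g 0 - g 3) + y * (g 2 - g 5) + (g 4 - g 1) = 0" if "y^3 = 1" for y
  proof -
    have "y * y^2 - (- (y^2)) * y = 2" using that by algebra
    then have D: "y * y^2 - (- (y^2)) * y \<noteq> 0" by (simp only:) simp
    have "y^5 * g 0 + y^4 * (- (y^2)) * g 1 + y^3 * (- (y^2))^2 * g 2 + y^2 * (- (y^2))^3 * g 3 + y * (- (y^2))^4 * g 4 + (- (y^2))^5 * g 5 = 0"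
      using even_tangent[OF f D, of 1 0 0 "- 5" "- 1" 3] unfolding pt[OF that] sum_6 act_simps coeffs_simps g_def[symmetric] by simp
    then show ?thesis using that by algebra
  qed
  have even: "?a \<in> even_quintics" using even_quinticsI[of 1 1 "-1" 1 "- 5" "- 1" 3] pt[of 1] by simp
  note t = gl_tangent[OF f even, folded g_def, unfolded coeffs_simps]
  have g14: "g 1 = 0" "g 4 = 0" using t(1,2) by algebra+
  have g5: "2 * g 2 = 5 * g 5" and g0: "5 * g 0 = 2 * g 3" using t(3,4) by algebra+
  have "(g 0 - g 3) + (g 2 - g 5) = 0" using e[of 1] by (simp add: g14)
  moreover have "z^2 * (g 0 - g 3) + z * (g 2 - g 5) = 0" using e[OF z3] by (simp add: g14)
  ultimately have "3 * (g 0 - g 3) = 0" "3 * (g 2 - g 5) = 0" using z by algebra+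
  with g0 g5 have "g 0 = 0" "g 3 = 0" "g 2 = 0" "g 5 = 0" by algebra+
  with g14 have "\<forall>i. g i = 0" unfolding all_6 by simp
  then show "eval ?a (partial i f) = 0" for i by (simp add: g_def)
qed

text \<open>
  A quintic \<open>x\<^sup>3 q\<close> is even for the involution that fixes \<open>x\<close> and exchanges the roots of \<open>q\<close>; this is
  completing the square in \<open>q\<close>.
\<close>

lemma triple_root_normal_form:
  assumes "a2 \<noteq> (0::complex)"
  shows "coeffs a0 a1 a2 0 0 0 = act 1 0 (a1 / (4 * a2)) 1 (coeffs (a0 - 10 * (a1 / (4 * a2))^2 * a2) 0 a2 0 0 0)"
  unfolding fun_eq_6 act_simps coeffs_simps using assms by simp

lemma triple_root_even: "a2 \<noteq> 0 \<Longrightarrow> coeffs a0 a1 a2 0 0 0 \<in> even_quintics"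
  using even_quinticsI[of 1 1 0 "a1 / (4 * a2)" "a0 - 10 * (a1 / (4 * a2))^2 * a2" a2 0] triple_root_normal_form[of a2 a0 a1] by simp

text \<open>
  Variation of the three coefficients of even quintics and the orbit of the general linear group
  provide these directions one after the other, each up to the ones already obtained.
\<close>

lemma triple_root_tangents:
  fixes a0 a1 a2 :: complex
  assumes f: "vanishes_on_H f" and a2: "a2 \<noteq> 0"
  shows "eval (coeffs a0 a1 a2 0 0 0) (partial 0 f) = 0" "eval (coeffs a0 a1 a2 0 0 0) (partial 1 f) = 0"
    "eval (coeffs a0 a1 a2 0 0 0) (partial 2 f) = 0" "eval (coeffs a0 a1 a2 0 0 0) (partial 3 f) = 0"
    "eval (coeffs a0 a1 a2 0 0 0) (partial 4 f) = 0"
proof -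
  define l where "l = a1 / (4 * a2)"
  have D: "1 * 1 - 0 * l \<noteq> 0" by simp
  let ?g = "\<lambda>i. eval (coeffs a0 a1 a2 0 0 0) (partial i f)"
  note nf = triple_root_normal_form[OF a2, of a0 a1, folded l_def]
  note e = even_tangent[OF f D, where \<alpha> = "a0 - 10 * l^2 * a2" and \<beta> = a2 and \<gamma> = 0, folded nf, unfolded sum_6 act_simps coeffs_simps]
  note t = gl_tangent[OF f triple_root_even[OF a2, of a0 a1], unfolded coeffs_simps]
  show g0: "?g 0 = 0" using e[of 1 0 0] by simp
  show g1: "?g 1 = 0" using t(4) a2 by (simp add: g0)
  show g2: "?g 2 = 0" using e[of 0 1 0] by (simp add: g0 g1)
  show g3: "?g 3 = 0" using t(3) a2 by (simp add: g1 g2)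
  show "?g 4 = 0" using e[of 0 0 1] by (simp add: g0 g1 g2 g3)
qed

text \<open>
  Taylor's formula up to second order in \<open>s = t\<^sup>2\<close>, with a base point and a direction that themselves
  depend on \<open>t\<close>.
\<close>

lemma second_order:
  fixes X c :: "complex \<Rightarrow> 'v::finite \<Rightarrow> complex"
  assumes X: "\<And>i. isCont (\<lambda>t. X t i) 0" and c: "\<And>i. isCont (\<lambda>t. c t i) 0"
  shows "\<exists>r. isCont r 0 \<and> (\<forall>t. eval (\<lambda>i. X t i + t^2 * c t i) f =
    eval (X t) f + t^2 * (\<Sum>i\<in>UNIV. c t i * eval (X t) (partial i f)) + t^4 * r t)"
proof (induction f rule: mpoly_induct)
  case (Const k)
  show ?case by (intro exI[of _ "\<lambda>_. 0"]) simp
next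
  case (Var j)
  have "(\<Sum>i\<in>UNIV. c t i * eval (X t) (partial i (Var j))) = (\<Sum>i\<in>UNIV. if i = j then c t i else 0)" for t
    by (intro sum.cong) (auto simp: partial_Var)
  then show ?case by (intro exI[of _ "\<lambda>_. 0"]) simp
next
  case (add p q)
  then obtain r s where r: "isCont r 0" "\<And>t. eval (\<lambda>i. X t i + t^2 * c t i) p = eval (X t) p + t^2 * (\<Sum>i\<in>UNIV. c t i * eval (X t) (partial i p)) + t^4 * r t"
    and s: "isCont s 0" "\<And>t. eval (\<lambda>i. X t i + t^2 * c t i) q = eval (X t) q + t^2 * (\<Sum>i\<in>UNIV. c t i * eval (X t) (partial i q)) + t^4 * s t"
    by blast
  show ?case
    by (intro exI[of _ "\<lambda>t. r t + s t"] conjI continuous_intros r s)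
      (simp add: r(2) s(2) sum.distrib ring_distribs)
next
  case (mult p q)
  then obtain r s where r: "isCont r 0" "\<And>t. eval (\<lambda>i. X t i + t^2 * c t i) p = eval (X t) p + t^2 * (\<Sum>i\<in>UNIV. c t i * eval (X t) (partial i p)) + t^4 * r t"
    and s: "isCont s 0" "\<And>t. eval (\<lambda>i. X t i + t^2 * c t i) q = eval (X t) q + t^2 * (\<Sum>i\<in>UNIV. c t i * eval (X t) (partial i q)) + t^4 * s t"
    by blast
  define P P' Q Q' where "P t = eval (X t) p" and "P' t = (\<Sum>i\<in>UNIV. c t i * eval (X t) (partial i p))"
    and "Q t = eval (X t) q" and "Q' t = (\<Sum>i\<in>UNIV. c t i * eval (X t) (partial i q))" for t
  have cont: "isCont P 0" "isCont P' 0" "isCont Q 0" "isCont Q' 0"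
    unfolding P_def P'_def Q_def Q'_def by (intro continuous_intros isCont_eval X c)+
  have sum: "(\<Sum>i\<in>UNIV. c t i * eval (X t) (partial i (p * q))) = P' t * Q t + P t * Q' t" for t
    unfolding P_def P'_def Q_def Q'_def by (simp add: sum_distrib_left sum_distrib_right sum.distrib ring_distribs mult_ac)
  let ?R = "\<lambda>t. P' t * Q' t + r t * Q t + P t * s t + t^2 * (P' t * s t + r t * Q' t) + t^4 * (r t * s t)"
  have "isCont ?R 0" by (intro continuous_intros cont r s)
  moreover have "eval (\<lambda>i. X t i + t^2 * c t i) (p * q) = eval (X t) (p * q) + t^2 * (P' t * Q t + P t * Q' t) + t^4 * ?R t" for t
    unfolding eval_simps(2) r(2) s(2) P_def[symmetric] P'_def[symmetric] Q_def[symmetric] Q'_def[symmetric] by algebra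
  ultimately show ?case unfolding sum by blast
qed

text \<open>
  The quintic \<open>a\<^sub>0 (x + t y)\<^sup>5 + (5/2) a\<^sub>2 y\<^sup>2 (4 x\<^sup>3 - 3 t\<^sup>2 x y\<^sup>2 + t\<^sup>3 y\<^sup>3)\<close> tends to \<open>x\<^sup>3 (a\<^sub>0 x\<^sup>2 + 10 a\<^sub>2 y\<^sup>2)\<close> for \<open>t \<rightarrow> 0\<close>.
  It is even for \<open>t \<noteq> 0\<close>, because with \<open>l = x + t y\<close> and \<open>m = x - 2 t y\<close> the second summand is a multiple of
  \<open>l (l\<^sup>2 - m\<^sup>2)\<^sup>2\<close>.  Its coefficient vector is \<open>X t + t\<^sup>2 c t\<close>, where \<open>X t\<close> has a triple root and the first three coordinates of \<open>c t\<close>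
  vanish.  The derivatives in the directions \<open>0, \<dots>, 4\<close> vanish at \<open>X t\<close>, so the expansion of \<open>f\<close> starts with
  \<open>(5/2) a\<^sub>2 t\<^sup>3\<close> times the derivative in the last direction.
\<close>

lemma triple_root_last:
  assumes f: "vanishes_on_H f" and a2: "a2 \<noteq> 0"
  shows "eval (coeffs a0 0 a2 0 0 0) (partial 5 f) = 0"
proof -
  define X where "X t = coeffs a0 (a0 * t) (a2 + a0 * t^2) 0 0 0" for t
  define c where "c t = coeffs 0 0 0 (a0 * t) (a0 * t^2 - 3 * a2 / 2) (a0 * t^3 + 5 * a2 / 2 * t)" for t
  have "\<forall>i. isCont (\<lambda>t. X t i) 0" "\<forall>i. isCont (\<lambda>t. c t i) 0"
    unfolding all_6 X_def c_def coeffs_simps by (intro conjI continuous_intros; simp)+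
  then obtain r where r: "isCont r 0" and taylor: "\<And>t. eval (\<lambda>i. X t i + t^2 * c t i) f =
    eval (X t) f + t^2 * (\<Sum>i\<in>UNIV. c t i * eval (X t) (partial i f)) + t^4 * r t"
    using second_order[of X c f] by blast
  let ?h = "\<lambda>t. (a0 * t^2 + 5 * a2 / 2) * eval (X t) (partial 5 f) + t * r t"
  have "?h 0 = 0"
  proof (rule isCont_zero[where g = ?h and z = 0])
    show "isCont ?h 0" using \<open>\<forall>i. isCont (\<lambda>t. X t i) 0\<close> by (intro continuous_intros r isCont_eval) auto
    have "isCont (\<lambda>t. a2 + a0 * t^2) 0" by (intro continuous_intros)
    then have "\<forall>\<^sub>F t in at 0. a2 + a0 * t^2 \<noteq> 0"
      using a2 by (intro tendsto_imp_eventually_ne[of _ a2]) (auto simp: isCont_def)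
    then have "\<forall>\<^sub>F t in at 0. a2 + a0 * t^2 \<noteq> 0 \<and> t \<noteq> 0" by (intro eventually_conj eventually_neq_at_within)
    then show "\<forall>\<^sub>F t in at 0. ?h t = 0"
    proof (rule eventually_mono)
      fix t :: complex assume t: "a2 + a0 * t^2 \<noteq> 0 \<and> t \<noteq> 0"
      \<comment> \<open>The choice that makes \<open>5 h l (l\<^sup>2 - m\<^sup>2)\<^sup>2 = 45 h t\<^sup>2 y\<^sup>2 (x + t y) (2 x - t y)\<^sup>2\<close> the second summand of the curve.\<close>
      define h where "h = a2 / (18 * t^2)"
      have h: "a2 = 18 * h * t^2" using t by (simp add: h_def)
      have "1 * (- 2 * t) - t * 1 \<noteq> 0" using t by simp
      have "act 1 t 1 (- 2 * t) (coeffs (a0 + 5 * h) 0 (- h) 0 h 0) = (\<lambda>i. X t i + t^2 * c t i)"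
        unfolding fun_eq_6 X_def c_def act_simps coeffs_simps h by (simp add: algebra_simps eval_nat_numeral)
      then have "(\<lambda>i. X t i + t^2 * c t i) \<in> even_quintics"
        using even_quinticsI[OF \<open>1 * (- 2 * t) - t * 1 \<noteq> 0\<close>] by metis
      then have 0: "eval (\<lambda>i. X t i + t^2 * c t i) f = 0" using f by (simp add: vanishes_on_H_def)
      have 1: "eval (X t) f = 0" using f triple_root_even[of "a2 + a0 * t^2"] t by (simp add: vanishes_on_H_def X_def)
      have "eval (X t) (partial 3 f) = 0" "eval (X t) (partial 4 f) = 0"
        using triple_root_tangents[OF f, of "a2 + a0 * t^2" a0 "a0 * t"] t by (simp_all add: X_def)
      then have "(\<Sum>i\<in>UNIV. c t i * eval (X t) (partial i f)) = (a0 * t^3 + 5 * a2 / 2 * t) * eval (X t) (partial 5 f)"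
        unfolding sum_6 by (simp add: c_def)
      with taylor[of t] have "t^2 * ((a0 * t^3 + 5 * a2 / 2 * t) * eval (X t) (partial 5 f)) + t^4 * r t = 0" by (simp add: 0 1)
      then have "t^3 * ?h t = 0" by (simp add: algebra_simps eval_nat_numeral)
      then show "?h t = 0" using t by simp
    qed
  qed
  then show ?thesis using a2 by (simp add: X_def)
qed

text \<open>
  Singular points form a closed set, so that the case \<open>a\<^sub>2 = 0\<close> follows by continuity.
\<close>

lemma singular_triple_root: "singular_point (coeffs a0 a1 a2 0 0 0)"
proof -
  have normal: "singular_point (coeffs a0 0 a2 0 0 0)" if "a2 \<noteq> 0" for a0 a2
    unfolding singular_point_def
  proof (intro allI impI)
    fix f i assume f: "vanishes_on_H f"
    have "\<forall>i. eval (coeffs a0 0 a2 0 0 0) (partial i f) = 0"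
      unfolding all_6 using triple_root_tangents[OF f that, of a0 0] triple_root_last[OF f that] by simp
    then show "eval (coeffs a0 0 a2 0 0 0) (partial i f) = 0" ..
  qed
  have generic: "singular_point (coeffs a0 a1 a2 0 0 0)" if "a2 \<noteq> 0" for a0 a1 a2
    unfolding triple_root_normal_form[OF that, of a0 a1] by (rule singular_point_act[OF normal[OF that]]) simp
  show ?thesis
    unfolding singular_point_def
  proof (intro allI impI)
    fix f i assume f: "vanishes_on_H f"
    let ?h = "\<lambda>t. eval (coeffs a0 a1 (a2 + t) 0 0 0) (partial i f)"
    have "?h 0 = 0"
    proof (rule isCont_zero[where g = ?h and z = 0])
      have "\<forall>i. isCont (\<lambda>t. coeffs a0 a1 (a2 + t) 0 0 0 i) 0"
        unfolding all_6 coeffs_simps by (intro conjI continuous_intros)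
      then show "isCont ?h 0" by (intro isCont_eval) blast
      have "\<forall>\<^sub>F t in at 0. t \<noteq> - a2" by (rule eventually_neq_at_within)
      then show "\<forall>\<^sub>F t in at 0. ?h t = 0"
      proof (rule eventually_mono)
        fix t assume "t \<noteq> - a2"
        then have "a2 + t \<noteq> 0" by (metis add.inverse_unique)
        then show "?h t = 0" using generic f unfolding singular_point_def by blast
      qed
    qed
    then show "eval (coeffs a0 a1 a2 0 0 0) (partial i f) = 0" by simp
  qed
qed

text \<open>
  The factors \<open>1/16\<close> and \<open>1/80\<close> remove the constants from the diagonalised forms.
\<close>

lemma singular_representatives:
  assumes "b \<in> orbit_representatives" shows "singular_point b"
proof -
  have e: "(\<lambda>i. 1/16 * coeffs 16 0 0 0 0 16 i) = coeffs 1 0 0 0 0 (1 :: complex)"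
    "(\<lambda>i. 1/80 * coeffs 0 16 0 0 (- 16) 0 i) = coeffs 0 (1/5) 0 0 (- 1/5) (0 :: complex)"
    by (simp_all add: fun_eq_6)
  have "singular_point (coeffs 1 0 0 0 0 1)"
    using singular_point_scale[OF singular_pentagon, of "1/16"] unfolding e by simp
  moreover have "singular_point (coeffs 0 (1/5) 0 0 (- 1/5) 0)"
    using singular_point_scale[OF singular_bipyramid, of "1/80"] unfolding e by simp
  ultimately show ?thesis using assms singular_triple_root by (auto simp: orbit_representatives_def)
qed

theorem calB_subset_singular: "calB \<subseteq> hypersurface_singular_locus calH"
proof
  fix v assume v: "v \<in> calB"
  then have "th0 (($) v) = 0 \<and> th1 (($) v) = 0 \<and> ($) v \<noteq> (\<lambda>_. 0)" "v \<noteq> 0" by (auto simp: calB_eq fun_eq_iff vec_eq_iff)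
  then obtain b where "b \<in> orbit_representatives" "gl_equivalent (($) v) b" unfolding th_zero_iff by blast
  then have sing: "singular_point (($) v)" using singular_representatives singular_point_equivalent by blast
  then have "v \<in> calH" using \<open>v \<noteq> 0\<close> singular_vanishing by (auto simp: calH_iff)
  with sing show "v \<in> hypersurface_singular_locus calH"
    by (auto simp: hypersurface_singular_locus_def vanishing_ideal_calH singular_point_def)
qed

section \<open>Smoothness away from the orbits\<close>

text \<open>
  The Jacobian determinant of \<open>i\<close> and \<open>L\<close> is the linear form \<open>jac0 x + jac1 y\<close>.
\<close>

definition jac0 :: "(6 \<Rightarrow> 'a) \<Rightarrow> 'a::comm_ring_1" where "jac0 a = 2 * iA a * th1 a - iB a * th0 a"
definition jac1 :: "(6 \<Rightarrow> 'a) \<Rightarrow> 'a::comm_ring_1" where "jac1 a = iB a * th1 a - 2 * iC a * th0 a"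

text \<open>
  The quintic in the frame formed by the root of \<open>L\<close> and the root of the Jacobian.  For the even quintic
  \<open>l (\<alpha> l\<^sup>4 + 10 \<beta> l\<^sup>2 m\<^sup>2 + 5 \<gamma> m\<^sup>4)\<close> symmetry makes \<open>L\<close> a multiple of \<open>l\<close> and the Jacobian a multiple of \<open>m\<close>, so
  in this frame only odd powers of the second variable occur.
\<close>

definition adapted :: "(6 \<Rightarrow> 'a) \<Rightarrow> 6 \<Rightarrow> 'a::comm_ring_1" where
  "adapted a = act (th1 a) (jac1 a) (- th0 a) (- jac0 a) a"

lemma jac_act:
  fixes a :: "6 \<Rightarrow> complex"
  shows "jac0 (act p q r s a) = (p * s - q * r) ^ 17 * (p * jac0 a + r * jac1 a)"
    and "jac1 (act p q r s a) = (p * s - q * r) ^ 17 * (q * jac0 a + s * jac1 a)"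
proof -
  have 1: "2 * (A * p^2 + B * p * r + C * r^2) * (q * t + s * u) - (2 * A * p * q + B * (p * s + q * r) + 2 * C * r * s) * (p * t + r * u)
     = (p * s - q * r) * (p * (2 * A * u - B * t) + r * (B * u - 2 * C * t))"
    "(2 * A * p * q + B * (p * s + q * r) + 2 * C * r * s) * (q * t + s * u) - 2 * (A * q^2 + B * q * s + C * s^2) * (p * t + r * u)
     = (p * s - q * r) * (q * (2 * A * u - B * t) + s * (B * u - 2 * C * t))" for A B C t u :: complex
    by algebra+
  have 2: "2 * (D^4 * x) * (D^12 * y) - D^4 * z * (D^12 * w) = D^16 * (2 * x * y - z * w)"
    "D^4 * x * (D^12 * y) - 2 * (D^4 * z) * (D^12 * w) = D^16 * (x * y - 2 * z * w)"
    "D^16 * (D * x) = D^17 * x" for D x y z w :: complex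
    by algebra+
  show "jac0 (act p q r s a) = (p * s - q * r) ^ 17 * (p * jac0 a + r * jac1 a)"
    "jac1 (act p q r s a) = (p * s - q * r) ^ 17 * (q * jac0 a + s * jac1 a)"
    unfolding jac0_def jac1_def i_act th_act 2(1,2) 1 2(3) by (rule refl)+
qed

lemma act_scale_columns:
  "act (x * p) (y * q) (x * r) (y * s) a 0 = x^5 * act p q r s a 0"
  "act (x * p) (y * q) (x * r) (y * s) a 2 = x^3 * y^2 * act p q r s a 2"
  "act (x * p) (y * q) (x * r) (y * s) a 4 = x * y^4 * act p q r s (a :: 6 \<Rightarrow> complex) 4"
  unfolding act_simps by algebra+

text \<open>
  The frame is covariant, so a change of coordinates scales its two vectors by powers of the
  determinant, and each coefficient only acquires a factor.
\<close>

lemma adapted_act: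
  fixes a :: "6 \<Rightarrow> complex"
  assumes "adapted a 0 = 0" "adapted a 2 = 0" "adapted a 4 = 0"
  shows "adapted (act p q r s a) 0 = 0" "adapted (act p q r s a) 2 = 0" "adapted (act p q r s a) 4 = 0"
proof -
  let ?D = "p * s - q * r"
  have th: "p * (D12 * (q * t + s * u)) + q * (- (D12 * (p * t + r * u))) = (D12 * ?D) * u"
    "r * (D12 * (q * t + s * u)) + s * (- (D12 * (p * t + r * u))) = (D12 * ?D) * (- t)" for D12 t u :: complex
    by algebra+
  have "adapted (act p q r s a) = act ((?D^12 * ?D) * th1 a) ((?D^17 * ?D) * jac1 a) ((?D^12 * ?D) * (- th0 a)) ((?D^17 * ?D) * (- jac0 a)) a"
    unfolding adapted_def act_act th_act jac_act th by (rule refl)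
  note eq = this
  show "adapted (act p q r s a) 0 = 0" "adapted (act p q r s a) 2 = 0" "adapted (act p q r s a) 4 = 0"
    unfolding eq act_scale_columns assms[unfolded adapted_def] by (rule mult_zero_right)+
qed

lemma adapted_even:
  assumes "a \<in> even_quintics" shows "adapted a 0 = 0" "adapted a 2 = 0" "adapted a 4 = 0"
proof -
  obtain p q r s \<alpha> \<beta> \<gamma> where a: "a = act p q r s (coeffs \<alpha> 0 \<beta> 0 \<gamma> 0)"
    using assms unfolding even_quintics_def gl_equivalent_def by blast
  let ?e = "coeffs \<alpha> 0 \<beta> 0 \<gamma> (0 :: complex)"
  have B: "iB ?e = 0" by (simp add: iB_def)
  have t: "th1 ?e = 0" by (simp add: th1_def linear_covariant_def B)
  have j: "jac0 ?e = 0" by (simp add: jac0_def B t)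
  have "adapted ?e 0 = 0" "adapted ?e 2 = 0" "adapted ?e 4 = 0" by (simp_all add: adapted_def t j act_simps)
  from adapted_act[OF this] show "adapted a 0 = 0" "adapted a 2 = 0" "adapted a 4 = 0" unfolding a by blast+
qed

lemma eval_adapted: "eval v (adapted h k) = adapted (\<lambda>i. eval v (h i)) k"
  by (simp add: adapted_def eval_act eval_covariants jac0_def jac1_def)

lemma adapted_vanishes:
  "vanishes_on_H (adapted Var 0)" "vanishes_on_H (adapted Var 2)" "vanishes_on_H (adapted Var 4)"
  unfolding vanishes_on_H_def eval_adapted using adapted_even by simp_all

definition cone_point :: "(6 \<Rightarrow> complex) \<Rightarrow> bool" where
  "cone_point a \<longleftrightarrow> singular_point a \<and> (\<forall>f. vanishes_on_H f \<longrightarrow> eval a f = 0)"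

text \<open>
  At an even quintic two entries of the adapted frame vanish; when \<open>a\<^sub>1\<close> varies, they change at the rates
  \<open>\<kappa>\<close> and \<open>- \<nu>\<close>, and the other two are stationary.  If \<open>th0\<close> is nonzero, the derivatives of the
  coefficients \<open>0\<close> and \<open>2\<close> of the adapted quintic vanish only for \<open>\<kappa> = \<nu> = 0\<close>.  Then the whole frame is stationary,
  and the derivative of the coefficient \<open>4\<close> is a product of its nonzero entries.
\<close>

lemma even_point_smooth:
  fixes a0 a2 a4 :: complex
  assumes sing: "singular_point (coeffs a0 0 a2 0 a4 0)" shows "th0 (coeffs a0 0 a2 0 a4 0) = 0"
proof (rule ccontr)
  let ?g = "\<lambda>t. coeffs a0 t a2 0 a4 0"
  define T where "T = th0 (?g 0)"
  assume "th0 (coeffs a0 0 a2 0 a4 0) \<noteq> 0"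
  then have T: "T \<noteq> 0" by (simp add: T_def)
  define A C where "A = a0 * a4 + 3 * a2^2" and "C = - 4 * a2 * a4"
  define \<kappa> where "\<kappa> = 6 * A * a4^2 + 6 * C * a2 * a4 + C^2"
  define \<nu> where "\<nu> = 2 * A * \<kappa> + 3 * a4 * T"
  have i: "iA (?g t) = A" "iB (?g t) = - 3 * t * a4" "iC (?g t) = C" for t
    by (simp_all add: iA_def iB_def iC_def A_def C_def)
  have t0: "th0 (?g t) = A^2 * a4 + 2 * A * C * a2 + C^2 * a0 + t^2 * (9 * a4^2 * a2 + 6 * a4 * C)" for t
    unfolding th0_def i linear_covariant_def coeffs_simps by algebra
  have Tv: "T = A^2 * a4 + 2 * A * C * a2 + C^2 * a0" by (simp add: T_def t0)
  have t1: "th1 (?g t) = t * \<kappa>" for t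
    unfolding th1_def i linear_covariant_def coeffs_simps \<kappa>_def by algebra
  have dt: "((\<lambda>t. ?g t i) has_field_derivative coeffs 0 1 0 0 0 0 i) (at 0)" for i
  proof -
    have "\<forall>i. ((\<lambda>t. ?g t i) has_field_derivative coeffs 0 1 0 0 0 0 i) (at 0)"
      unfolding all_6 coeffs_simps by (intro conjI) (auto intro!: derivative_eq_intros)
    then show ?thesis ..
  qed
  have dP: "((\<lambda>t. th1 (?g t)) has_field_derivative \<kappa>) (at 0)"
    unfolding t1 by (auto intro!: derivative_eq_intros)
  have dR: "((\<lambda>t. - th0 (?g t)) has_field_derivative 0) (at 0)"
    unfolding t0 by (auto intro!: derivative_eq_intros)
  have dQ: "((\<lambda>t. jac1 (?g t)) has_field_derivative 0) (at 0)"
    unfolding jac1_def i t0 t1 by (auto intro!: derivative_eq_intros)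
  have dS: "((\<lambda>t. - jac0 (?g t)) has_field_derivative - \<nu>) (at 0)"
    unfolding jac0_def i t0 t1 \<nu>_def by (auto intro!: derivative_eq_intros simp: Tv)
  have v: "th1 (?g 0) = 0" "- th0 (?g 0) = - T" "jac1 (?g 0) = - 2 * C * T" "- jac0 (?g 0) = 0"
    unfolding jac0_def jac1_def i by (simp_all add: t1 T_def)
  have zero: "((\<lambda>t. adapted (?g t) k) has_field_derivative 0) (at 0)" if "k \<in> {0, 2, 4}" for k
  proof -
    have "vanishes_on_H (adapted Var k)" using that adapted_vanishes by auto
    then have "eval (?g 0) (partial i (adapted Var k)) = 0" for i
      using sing unfolding singular_point_def by blast
    then have "((\<lambda>t. eval (?g t) (adapted Var k)) has_field_derivative 0) (at 0)"
      using eval_has_derivative[where \<gamma> = ?g, OF dt, of "adapted Var k"] by simp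
    then show ?thesis unfolding eval_adapted by simp
  qed
  define P Q R S' where "P t = th1 (?g t)" and "Q t = jac1 (?g t)" and "R t = - th0 (?g t)" and "S' t = - jac0 (?g t)" for t
  note d = dP[folded P_def] dQ[folded Q_def] dR[folded R_def] dS[folded S'_def]
  have v': "P 0 = 0" "R 0 = - T" "Q 0 = - 2 * C * T" "S' 0 = 0" using v by (simp_all add: P_def Q_def R_def S'_def)
  have ad: "adapted (?g t) k = act (P t) (Q t) (R t) (S' t) (?g t) k" for t k
    by (simp add: adapted_def P_def Q_def R_def S'_def)
  have "((\<lambda>t. adapted (?g t) 0) has_field_derivative 5 * \<kappa> * T^4 * a4) (at 0)"
    unfolding ad act_simps coeffs_simps by (auto intro!: derivative_eq_intros d simp: v')
  from DERIV_unique[OF this zero] have k: "\<kappa> * a4 = 0" using T by simp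
  have a4: "a4 \<noteq> 0"
  proof
    assume "a4 = 0"
    then have "T = 0" by (simp add: Tv C_def)
    with T show False by simp
  qed
  with k have \<kappa>: "\<kappa> = 0" by simp
  have "C \<noteq> 0"
  proof
    assume C: "C = 0"
    then have "A * a4 = 0" using \<kappa> a4 by (simp add: \<kappa>_def)
    then have "T = 0" by (simp add: Tv C power2_eq_square)
    with T show False by simp
  qed
  have "((\<lambda>t. adapted (?g t) 2) has_field_derivative 2 * (- T)^3 * (- 2 * C * T) * (- \<nu>) * a4) (at 0)"
    unfolding ad act_simps coeffs_simps by (auto intro!: derivative_eq_intros d simp: v' \<kappa>)
  from DERIV_unique[OF this zero] have \<nu>: "\<nu> = 0" using T \<open>C \<noteq> 0\<close> a4 by simp
  have "((\<lambda>t. adapted (?g t) 4) has_field_derivative - T * (- 2 * C * T)^4) (at 0)"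
    unfolding ad act_simps coeffs_simps by (auto intro!: derivative_eq_intros d simp: v' \<kappa> \<nu>)
  from DERIV_unique[OF this zero] show False using T \<open>C \<noteq> 0\<close> by simp
qed

lemma cone_point_act:
  assumes "cone_point a" "p * s - q * r \<noteq> 0" shows "cone_point (act p q r s a)"
  unfolding cone_point_def
proof (intro conjI allI impI)
  show "singular_point (act p q r s a)" using assms singular_point_act unfolding cone_point_def by blast
  fix f assume f: "vanishes_on_H f"
  show "eval (act p q r s a) f = 0"
    using vanishes_on_H_act[OF f assms(2)] assms(1) unfolding cone_point_def by metis
qed

lemma th_zero_act:
  assumes "p * s - q * r \<noteq> 0" "th0 (act p q r s a) = 0" "th1 (act p q r s a) = 0"
  shows "th0 a = 0 \<and> th1 (a :: 6 \<Rightarrow> complex) = 0"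
  using th_gl_equivalent[OF gl_equivalent_sym[OF gl_equivalentI[OF assms(1) refl]] assms(2,3)] by blast

text \<open>
  Let \<open>L = th0 x\<close> with \<open>th0 \<noteq> 0\<close>.  If \<open>C \<noteq> 0\<close>, completing the square in \<open>i\<close> makes the Jacobian a nonzero
  multiple of \<open>y\<close>; the adapted frame then consists of the coordinate axes, so the point is an even
  quintic, and \<open>even_point_smooth\<close> applies.  If \<open>C = 0\<close>, the frame degenerates, but the vanishing of the
  coefficient \<open>0\<close> and of \<open>th1\<close> already forces the quintic to be \<open>\<alpha> x\<^sup>5 + 5 \<gamma> x y\<^sup>4\<close> up to a translation of \<open>y\<close>,
  which is even too.
\<close>

lemma normalised_cone_point:
  assumes b: "cone_point b" and t1: "th1 b = 0" shows "th0 b = 0"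
proof (rule ccontr)
  assume t0: "th0 b \<noteq> 0"
  have ad: "adapted b k = 0" if "k \<in> {0, 2, 4}" for k
  proof -
    have "vanishes_on_H (adapted Var k)" using that adapted_vanishes by auto
    then have "eval b (adapted Var k) = 0" using b unfolding cone_point_def by blast
    then show ?thesis by (simp add: eval_adapted)
  qed
  have b5: "b 5 = 0" using ad[of 0] t0 by (simp add: adapted_def act_simps t1)
  have even: False if e: "act 1 0 l 1 b = coeffs x 0 y 0 z 0" for l x y z
  proof -
    have "cone_point (act 1 0 l 1 b)" by (rule cone_point_act[OF b]) simp
    then have "th0 (act 1 0 l 1 b) = 0" unfolding e cone_point_def using even_point_smooth by blast
    then show False using t0 by (simp add: th_act t1)
  qed
  show False
  proof (cases "iC b = 0")
    case True
    have C: "3 * b 3 ^ 2 = 4 * b 2 * b 4" using True by (simp add: iC_def b5)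
    have L0: "th0 b = iA b ^ 2 * b 4 - 2 * iA b * iB b * b 3 + iB b ^ 2 * b 2" by (simp add: th0_def linear_covariant_def True)
    have L1: "iB b * (iB b * b 3 - 2 * iA b * b 4) = 0"
      using t1 by (simp add: th1_def linear_covariant_def True b5 algebra_simps power2_eq_square)
    have B: "iB b = 0"
    proof (rule ccontr)
      assume B: "iB b \<noteq> 0"
      then have 3: "iB b * b 3 = 2 * iA b * b 4" using L1 by simp
      have "4 * (b 4 * th0 b) = 0" using C 3 L0 by algebra
      with t0 have b4: "b 4 = 0" by simp
      with 3 B have b3: "b 3 = 0" by simp
      have "iB b = 0" by (simp add: iB_def b3 b4 b5)
      with B show False ..
    qed
    then have b4: "b 4 \<noteq> 0" using t0 L0 by auto
    define t where "t = b 3 / b 4"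
    have b3: "b 3 = t * b 4" using b4 by (simp add: t_def)
    have "b 4 * (4 * b 2) = b 4 * (3 * t^2 * b 4)" using C[unfolded b3] by algebra
    then have b2': "4 * b 2 = 3 * t^2 * b 4" by (rule iffD1[OF mult_left_cancel[OF b4]])
    then have b2: "b 2 = 3 * t^2 * b 4 / 4" by (simp add: field_simps)
    have "b 4 * (2 * b 1) = b 4 * (t^3 * b 4)" using B[unfolded iB_def b3 b5] b2' by algebra
    then have "2 * b 1 = t^3 * b 4" by (rule iffD1[OF mult_left_cancel[OF b4]])
    then have b1: "b 1 = t^3 * b 4 / 2" by (simp add: field_simps)
    have "act 1 0 (- t / 2) 1 b = coeffs (act 1 0 (- t / 2) 1 b 0) 0 0 0 (b 4) 0"
      unfolding fun_eq_6 coeffs_simps by (simp add: act_simps b1 b2 b3 b5 field_simps eval_nat_numeral)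
    then show False by (rule even)
  next
    case False
    define l where "l = - iB b / (2 * iC b)"
    have D: "1 * 1 - 0 * l \<noteq> 0" by simp
    define c where "c = act 1 0 l 1 b"
    have c: "cone_point c" unfolding c_def by (rule cone_point_act[OF b D])
    have "2 * iC b * l = - iB b" using False by (simp add: l_def)
    then have B: "iB c = 0" by (simp add: c_def i_act)
    have C: "iC c = iC b" by (simp add: c_def i_act)
    have th: "th0 c = th0 b" "th1 c = 0" by (simp_all add: c_def th_act t1)
    have ad': "adapted c k = 0" if "k \<in> {0, 2, 4}" for k
    proof -
      have "vanishes_on_H (adapted Var k)" using that adapted_vanishes by auto
      then have "eval c (adapted Var k) = 0" using c unfolding cone_point_def by blast
      then show ?thesis by (simp add: eval_adapted)
    qed
    have j: "jac0 c = 0" "jac1 c = - 2 * iC b * th0 b" by (simp_all add: jac0_def jac1_def B C th)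
    have "c 5 = 0" using ad'[of 0] t0 by (simp add: adapted_def act_simps th)
    moreover have "c 3 = 0" using ad'[of 2] t0 False by (simp add: adapted_def act_simps th j)
    moreover have "c 1 = 0" using ad'[of 4] t0 False by (simp add: adapted_def act_simps th j)
    ultimately have "c = coeffs (c 0) 0 (c 2) 0 (c 4) 0" by (simp add: fun_eq_6)
    then show False using even[of l] unfolding c_def by blast
  qed
qed

theorem singular_subset_calB: "hypersurface_singular_locus calH \<subseteq> calB"
proof
  fix v assume v: "v \<in> hypersurface_singular_locus calH"
  then have cone: "cone_point (($) v)" and "v \<noteq> 0"
    by (auto simp: hypersurface_singular_locus_def vanishing_ideal_calH singular_point_def cone_point_def calH_iff)
  let ?a = "($) v"
  have "th0 ?a = 0 \<and> th1 ?a = 0"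
  proof (rule ccontr)
    assume ne: "\<not> (th0 ?a = 0 \<and> th1 ?a = 0)"
    obtain p r where D: "p * (- th0 ?a) - th1 ?a * r \<noteq> 0"
    proof (cases "th0 ?a = 0")
      case True then show ?thesis using ne by (intro that[of 0 1]) simp
    next
      case False then show ?thesis by (intro that[of 1 0]) simp
    qed
    \<comment> \<open>The second column is the root of \<open>L\<close>, so in the new coordinates \<open>L\<close> is a multiple of the first variable.\<close>
    have t1: "th1 (act p (th1 ?a) r (- th0 ?a) ?a) = 0" by (simp add: th_act)
    have "th0 (act p (th1 ?a) r (- th0 ?a) ?a) = 0" by (rule normalised_cone_point[OF cone_point_act[OF cone D] t1])
    with th_zero_act[OF D _ t1] ne show False by blast
  qed
  then show "v \<in> calB" using \<open>v \<noteq> 0\<close> by (simp add: calB_eq)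
qed

section \<open>The complete intersection\<close>

lemma ideal_gen_scaled_pair:
  assumes "c * d = (1 :: 'a::comm_ring_1)"
  shows "ideal_generated {c * x, c * y} = ideal_generated {x, y}"
proof
  have "z \<in> ideal_generated {x, y}" if "z \<in> {c * x, c * y}" for z
    using that ideal_gen_mult[OF ideal_gen_base, of x "{x, y}" c] ideal_gen_mult[OF ideal_gen_base, of y "{x, y}" c] by auto
  then show "ideal_generated {c * x, c * y} \<subseteq> ideal_generated {x, y}" by (rule ideal_gen_subset)
  have "d * (c * z) = z" for z using assms by (simp add: mult.assoc[symmetric] mult.commute[of d])
  then have "z \<in> ideal_generated {c * x, c * y}" if "z \<in> {x, y}" for z
    using ideal_gen_mult[OF ideal_gen_base, of "c * z" "{c * x, c * y}" d] that by auto
  then show "ideal_generated {x, y} \<subseteq> ideal_generated {c * x, c * y}" by (rule ideal_gen_subset)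
qed

text \<open>
  Evaluation at the origin maps the ideal to zero.
\<close>

lemma homogeneous_ideal_proper:
  assumes "homogeneous 5 g" "homogeneous 5 (h :: R)" shows "1 \<notin> ideal_generated {g, h}"
proof
  assume "1 \<in> ideal_generated {g, h}"
  then obtain u v where uv: "1 = u * g + v * h" unfolding ideal_gen_pair by blast
  have "eval (\<lambda>i. 0 * 0) g = 0 ^ 5 * eval (\<lambda>_. 0) g" "eval (\<lambda>i. 0 * 0) h = 0 ^ 5 * eval (\<lambda>_. 0) h"
    by (rule eval_scale, fact)+
  then have "eval (\<lambda>_. 0) g = 0" "eval (\<lambda>_. 0) h = 0" by simp_all
  with arg_cong[OF uv, of "eval (\<lambda>_. 0)"] show False by simp
qed

theorem proposition2p6:
  shows "hypersurface_singular_locus calH = calB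
    \<and> homogeneous 1 theta51
    \<and> homogeneous 5 (theta51_coeff 1) \<and> homogeneous 5 (theta51_coeff 2)
    \<and> vanishing_ideal calB = ideal_generated {theta51_coeff 1, theta51_coeff 2}
    \<and> regular_sequence [theta51_coeff 1, theta51_coeff 2]"
proof (intro conjI)
  show "hypersurface_singular_locus calH = calB"
    using singular_subset_calB calB_subset_singular by blast
  show "homogeneous 1 theta51" by (rule homogeneous_theta51)
  show h: "homogeneous 5 (theta51_coeff 1)" "homogeneous 5 (theta51_coeff 2)"
    unfolding theta51_coeff_eq by (intro homogeneous_numeral_mult homogeneous_th homogeneous_Var)+
  have unit: "(4 :: R) * Const (1/4) = 1" by (simp flip: Const_numeral Const_mult add: Const_1)
  show "vanishing_ideal calB = ideal_generated {theta51_coeff 1, theta51_coeff 2}"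
    unfolding vanishing_ideal_calB theta51_coeff_eq ideal_gen_scaled_pair[OF unit] ..
  have unit_dvd: "4 * x dvd y \<longleftrightarrow> x dvd y" for x y :: R
  proof
    assume "x dvd y"
    then obtain k where "y = x * k" by (rule dvdE)
    then have "y = (4 * x) * (Const (1/4) * k)" using unit by (simp add: mult_ac mult.assoc[symmetric])
    then show "4 * x dvd y" by (rule dvdI)
  qed (rule dvd_mult_right)
  have "u * theta51_coeff 1 \<in> ideal_generated {} \<longrightarrow> u \<in> ideal_generated {}" for u
    using th_regular(3) by (simp add: ideal_gen_empty theta51_coeff_eq)
  moreover have "u * theta51_coeff 2 \<in> ideal_generated {theta51_coeff 1} \<longrightarrow> u \<in> ideal_generated {theta51_coeff 1}" for u
  proof
    assume "u * theta51_coeff 2 \<in> ideal_generated {theta51_coeff 1}"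
    then have "th0 Var dvd 4 * (u * th1 Var)" by (simp add: ideal_gen_single theta51_coeff_eq unit_dvd mult.left_commute)
    then have "th0 Var dvd Const (1/4) * (4 * (u * th1 Var))" by (rule dvd_mult)
    then have "th0 Var dvd u * th1 Var" using unit by (simp add: mult.assoc[symmetric] mult.commute[of "Const (1/4)"])
    then have "th0 Var dvd u" by (rule nonzerodivisor_mod_singleD[OF th_regular(1)])
    then show "u \<in> ideal_generated {theta51_coeff 1}" by (simp add: ideal_gen_single theta51_coeff_eq unit_dvd)
  qed
  moreover have "ideal_generated {theta51_coeff 1, theta51_coeff 2} \<noteq> UNIV"
    using homogeneous_ideal_proper[OF h] by blast
  ultimately show "regular_sequence [theta51_coeff 1, theta51_coeff 2]"
    unfolding regular_sequence_def by (simp add: less_Suc_eq)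
qed

end
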